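(* Let $H$ be an infinite-dimensional complex separable Hilbert space and let $T\in\mathcal B(H)\setminus\mathcal K(H)$. Then the following are equivalent: (1) $T\in\overline{\mathcal{AN}(H)}$, the closure of $\mathcal{AN}(H)$ with respect to the operator norm. (2) $\sigma_{\mathrm{ess}}(T^*T)=\{\alpha\}$ for some $\alpha>0$. (3) There exist $\alpha>0$, $K\in\mathcal K(H)$ and a partial isometry $V\in\mathcal B(H)$ with $\dim N(V)<\infty$ such that $T=K+\sqrt{\alpha}\,V$. (4) There exists $\alpha>0$ such that $\alpha I-T^*T\in\mathcal K(H)$. (5) $T$ has closed range, $N(T)$ is finite-dimensional, and there exists $\alpha>0$ such that $\alpha T^\dagger-T^*\in\mathcal K(H)$.
   Context: $\mathcal B(H)$ and $\mathcal K(H)$ denote the bounded and the compact operators on $H$; $N(T)$ and $R(T)$ denote the null space and range of $T$. An operator $T\in\mathcal B(H)$ is absolutely norm attaining if for every non-zero closed subspace $M$ of $H$ the restriction $T|_M$ attains its norm, i.e. there is a unit vector $x\in M$ with $\|Tx\|=\|T|_M\|$; $\mathcal{AN}(H)$ is the set of all absolutely norm attaining operators in $\mathcal B(H)$. An operator $A$ is Fredholm if $R(A)$ is closed and $N(A)$, $N(A^* )$ are finite-dimensional; $\sigma_{\mathrm{ess}}(A)=\{\mu\in\mathbb C: A-\mu I\text{ is not Fredholm}\}$. If $T$ has closed range, the Moore--Penrose inverse $T^\dagger\in\mathcal B(H)$ is the unique operator such that $TT^\dagger$ and $T^\dagger T$ are self-adjoint, $TT^\dagger T=T$ and $T^\dagger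 TT^\dagger=T^\dagger$. *)

theory Defs
  imports "HOL-Analysis.Analysis"
begin

section \<open>Complex Hilbert spaces\<close>

class complex_vector = real_vector +
  fixes scaleC :: "complex \<Rightarrow> 'a \<Rightarrow> 'a"  (infixr \<open>*\<^sub>C\<close> 75)
  assumes scaleC_add_right: "a *\<^sub>C (x + y) = a *\<^sub>C x + a *\<^sub>C y"
    and scaleC_add_left: "(a + b) *\<^sub>C x = a *\<^sub>C x + b *\<^sub>C x"
    and scaleC_scaleC: "a *\<^sub>C (b *\<^sub>C x) = (a * b) *\<^sub>C x"
    and scaleR_scaleC: "r *\<^sub>R x = complex_of_real r *\<^sub>C x"

lemma scaleC_one: "1 *\<^sub>C x = (x :: 'a :: complex_vector)"
  using scaleR_scaleC[of 1 x] by simp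

global_interpretation complex_vector: vector_space "scaleC :: complex \<Rightarrow> 'a \<Rightarrow> 'a :: complex_vector"
  defines csubspace = complex_vector.subspace
    and cspan = complex_vector.span
  by unfold_locales (simp_all add: scaleC_add_right scaleC_add_left scaleC_scaleC scaleC_one)

definition cfinite_dim :: "'a :: complex_vector set \<Rightarrow> bool" where
  "cfinite_dim S \<longleftrightarrow> (\<exists>B. finite B \<and> cspan B = S)"

class complex_normed_vector = complex_vector + real_normed_vector +
  assumes norm_scaleC: "norm (a *\<^sub>C x) = cmod a * norm x"

(* Linear in the first argument. Positive definiteness follows from cinner_self together
   with the axioms of real_normed_vector. *)
class complex_inner = complex_normed_vector +
  fixes cinner :: "'a \<Rightarrow> 'a \<Rightarrow> complex"
  assumes cinner_commute: "cinner x y = cnj (cinner y x)"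
    and cinner_add_left: "cinner (x + y) z = cinner x z + cinner y z"
    and cinner_scaleC_left: "cinner (a *\<^sub>C x) y = a * cinner x y"
    and cinner_self: "cinner x x = complex_of_real ((norm x)\<^sup>2)"

class complex_hilbert = complex_inner + complete_space


section \<open>Bounded operators\<close>

lemma bounded_linear_scaleC_right:
  "bounded_linear (\<lambda>x :: 'a :: complex_normed_vector. a *\<^sub>C x)"
proof (rule bounded_linear_intro[where K = "cmod a"])
  show "a *\<^sub>C (r *\<^sub>R x) = r *\<^sub>R (a *\<^sub>C x)" for r and x :: 'a
    by (simp add: scaleR_scaleC scaleC_scaleC mult.commute)
qed (simp_all add: scaleC_add_right norm_scaleC)

instantiation blinfun :: (real_normed_vector, complex_normed_vector) complex_vector
begin

lift_definition scaleC_blinfun :: "complex \<Rightarrow> 'a \<Rightarrow>\<^sub>L 'b \<Rightarrow> 'a \<Rightarrow>\<^sub>L 'b" is "\<lambda>a f x. a *\<^sub>C f x"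
  by (metis bounded_linear_compose bounded_linear_scaleC_right)

instance
  by standard
    (transfer, simp add: scaleC_add_right scaleC_add_left scaleC_scaleC scaleR_scaleC)+

end

(* The type of bounded operators in the library only requires real-linearity; B(H) is the
   (norm-closed) set of its complex-linear members, with the operator norm inherited. *)
definition bounded_ops :: "('a :: complex_normed_vector \<Rightarrow>\<^sub>L 'a) set" where
  "bounded_ops = {T. \<forall>a x. blinfun_apply T (a *\<^sub>C x) = a *\<^sub>C blinfun_apply T x}"

definition compact_ops :: "('a :: complex_normed_vector \<Rightarrow>\<^sub>L 'a) set" where
  "compact_ops = {T \<in> bounded_ops. compact (closure (blinfun_apply T ` cball 0 1))}"

definition null_space :: "('a :: complex_normed_vector \<Rightarrow>\<^sub>L 'a) \<Rightarrow> 'a set" where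
  "null_space T = {x. blinfun_apply T x = 0}"

definition adjoint_op :: "('a :: complex_hilbert \<Rightarrow>\<^sub>L 'a) \<Rightarrow> ('a \<Rightarrow>\<^sub>L 'a)" where
  "adjoint_op T = (THE S. S \<in> bounded_ops \<and>
     (\<forall>x y. cinner (blinfun_apply T x) y = cinner x (blinfun_apply S y)))"

definition selfadjoint_op :: "('a :: complex_hilbert \<Rightarrow>\<^sub>L 'a) \<Rightarrow> bool" where
  "selfadjoint_op T \<longleftrightarrow> adjoint_op T = T"

definition restriction_norm :: "('a :: complex_normed_vector \<Rightarrow>\<^sub>L 'a) \<Rightarrow> 'a set \<Rightarrow> real" where
  "restriction_norm T M = (SUP x \<in> {x \<in> M. norm x \<le> 1}. norm (blinfun_apply T x))"

definition AN_ops :: "('a :: complex_normed_vector \<Rightarrow>\<^sub>L 'a) set" where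
  "AN_ops = {T \<in> bounded_ops. \<forall>M. csubspace M \<and> closed M \<and> M \<noteq> {0} \<longrightarrow>
     (\<exists>x \<in> M. norm x = 1 \<and> norm (blinfun_apply T x) = restriction_norm T M)}"

definition fredholm :: "('a :: complex_hilbert \<Rightarrow>\<^sub>L 'a) \<Rightarrow> bool" where
  "fredholm A \<longleftrightarrow> closed (range (blinfun_apply A)) \<and>
     cfinite_dim (null_space A) \<and> cfinite_dim (null_space (adjoint_op A))"

definition essential_spectrum :: "('a :: complex_hilbert \<Rightarrow>\<^sub>L 'a) \<Rightarrow> complex set" where
  "essential_spectrum A = {\<mu>. \<not> fredholm (A - \<mu> *\<^sub>C id_blinfun)}"

(* Isometric on the orthogonal complement of the null space. *)
definition partial_isometry :: "('a :: complex_hilbert \<Rightarrow>\<^sub>L 'a) \<Rightarrow> bool" where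
  "partial_isometry V \<longleftrightarrow>
     (\<forall>x. (\<forall>y \<in> null_space V. cinner x y = 0) \<longrightarrow> norm (blinfun_apply V x) = norm x)"

(* Meaningful only for operators with closed range. *)
definition mp_inverse :: "('a :: complex_hilbert \<Rightarrow>\<^sub>L 'a) \<Rightarrow> ('a \<Rightarrow>\<^sub>L 'a)" where
  "mp_inverse T = (THE S. S \<in> bounded_ops \<and>
     selfadjoint_op (T o\<^sub>L S) \<and> selfadjoint_op (S o\<^sub>L T) \<and>
     T o\<^sub>L S o\<^sub>L T = T \<and> S o\<^sub>L T o\<^sub>L S = S)"

end

theory Submission
  imports Defs
begin

text \<open>
  Every condition is equivalent to one property of \<open>T\<close>, called \<^emph>\<open>essentially \<open>s\<close>-isometric\<close>
  (\<open>s = \<surd>\<alpha> > 0\<close>): for each \<open>e > 0\<close> there is a finite set \<open>B\<close> such that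
  \<open>\<bar>\<parallel>T x\<parallel> - s \<parallel>x\<parallel>\<bar> \<le> e \<parallel>x\<parallel>\<close> for all \<open>x \<bottom> B\<close>.  The same language describes compactness:
  \<open>K\<close> is compact iff for each \<open>e > 0\<close> there is a finite \<open>B\<close> with \<open>\<parallel>K x\<parallel> \<le> e \<parallel>x\<parallel>\<close> for all \<open>x \<bottom> B\<close>
  (\<open>compact_ops_iff\<close>).  Arguments about compact operators thus become estimates on subspaces of
  finite codimension.

  \<^item> \<open>\<alpha> I - T\<^sup>* T\<close> compact: its quadratic form is \<open>\<alpha> \<parallel>x\<parallel>\<^sup>2 - \<parallel>T x\<parallel>\<^sup>2\<close>, and polarisation recovers a
    symmetric operator from its form (\<open>defect_small_iff\<close>).

  \<^item> Limits of absolutely norm attaining operators: let \<open>a\<close> and \<open>b\<close> be the limits, over larger and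
    larger finite \<open>B\<close>, of the infimum and the supremum of \<open>\<parallel>T x\<parallel>\<close> over the unit vectors
    orthogonal to \<open>B\<close>.  If \<open>a < b\<close>, one can build an orthonormal sequence with orthogonal images
    whose norms increase strictly to a limit, and \<open>T\<close> does not attain its norm on the closed span
    (\<open>essential_gap_not_AN\<close>).  A gap survives small perturbations, so \<open>a = b\<close> on the closure.
    For the converse, correct \<open>T\<close> by an inverse square root of \<open>T\<^sup>* T / \<alpha>\<close>, taken up to finite
    rank: this square root is \<open>I + Y\<close> with \<open>Y\<close> compact and arbitrarily small, and it is obtained from
    the Banach fixed point theorem (\<open>compact_inverse_square_root\<close>).  The corrected operator
    is exactly \<open>s\<close> times an isometry off finitely many vectors
    (\<open>small_perturbation_isometric_off_finite\<close>), and such operators are absolutely norm attaining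
    because everything else happens in finite dimensions (\<open>AN_if_isometric_off_finite\<close>).

  \<^item> Compact plus multiple of a partial isometry: the corrected operator, set to zero on
    the span of \<open>B\<close>, is \<open>s\<close> times a partial isometry and differs from \<open>T\<close> by a compact operator.

  \<^item> Essential spectrum: \<open>a\<^sup>2\<close> and \<open>b\<^sup>2\<close> always belong to it
    (\<open>not_ess_bounded_below_at_top\<close>), so \<open>a = b\<close> if it is a singleton.

  \<^item> Moore--Penrose inverse: \<open>\<alpha> T\<^sup>\<dagger> - T\<^sup>* = (\<alpha> I - T\<^sup>* T) T\<^sup>\<dagger>\<close>, and \<open>T\<^sup>\<dagger> T\<close> is the identity up to finite
    rank.
\<close>

instance complex_hilbert \<subseteq> banach ..

section \<open>Geometry of complex inner product spaces\<close>

lemma cinner_add_right: "cinner x (y + z) = cinner x y + cinner x z"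
  for x :: "'a :: complex_inner"
  by (metis cinner_add_left cinner_commute complex_cnj_add)

lemma cinner_scaleC_right: "cinner x (a *\<^sub>C y) = cnj a * cinner x y"
  for x :: "'a :: complex_inner"
  by (metis cinner_scaleC_left cinner_commute complex_cnj_mult)

lemma cinner_scaleR_left: "cinner (r *\<^sub>R x) y = r *\<^sub>R cinner x y"
  for x :: "'a :: complex_inner"
  by (simp add: scaleR_scaleC cinner_scaleC_left scaleR_conv_of_real)

lemma cinner_scaleR_right: "cinner x (r *\<^sub>R y) = r *\<^sub>R cinner x y"
  for x :: "'a :: complex_inner"
  by (simp add: scaleR_scaleC cinner_scaleC_right scaleR_conv_of_real)

lemma norm_add_sq:
  "(norm (x + y))\<^sup>2 = (norm x)\<^sup>2 + (norm y)\<^sup>2 + 2 * Re (cinner x y)"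
  for x :: "'a :: complex_inner"
proof -
  have "complex_of_real ((norm (x + y))\<^sup>2)
      = cinner x x + cinner y y + (cinner x y + cnj (cinner x y))"
    unfolding cinner_self[symmetric] cinner_commute[of x y, symmetric]
    by (simp add: cinner_add_left cinner_add_right cinner_commute[of y x])
  then have "Re (complex_of_real ((norm (x + y))\<^sup>2))
      = Re (cinner x x + cinner y y + (cinner x y + cnj (cinner x y)))"
    by (rule arg_cong)
  then show ?thesis by (simp add: cinner_self)
qed

lemma Re_cnj_div_mult: "Re (cnj (c / complex_of_real n) * c) = (cmod c)\<^sup>2 / n"
proof -
  have "cnj (c / complex_of_real n) * c = c * cnj c / complex_of_real n" by simp
  also have "\<dots> = complex_of_real ((cmod c)\<^sup>2 / n)"
    by (simp only: of_real_divide complex_norm_square)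
  finally show ?thesis by (simp only: Re_complex_of_real)
qed

lemma Cauchy_Schwarz: "cmod (cinner x y) \<le> norm x * norm y"
  for x :: "'a :: complex_inner"
proof (cases "y = 0")
  case True
  then show ?thesis using cinner_scaleR_right[of x 0 0] by simp
next
  case False
  define n where "n = (norm y)\<^sup>2"
  have n: "n > 0" using False by (simp add: n_def)
  define a where "a = cinner x y / complex_of_real n"
  have 1: "Re (cinner x ((- a) *\<^sub>C y)) = - ((cmod (cinner x y))\<^sup>2 / n)"
    by (simp only: cinner_scaleC_right a_def complex_cnj_minus mult_minus_left
        uminus_complex.sel Re_cnj_div_mult)
  have 2: "(norm ((- a) *\<^sub>C y))\<^sup>2 = (cmod (cinner x y))\<^sup>2 / n"
    unfolding norm_scaleC power_mult_distrib n_def[symmetric] a_def using n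
    by (simp add: norm_divide power_divide) (simp add: power2_eq_square)
  have "0 \<le> (norm x)\<^sup>2 + (cmod (cinner x y))\<^sup>2 / n + 2 * - ((cmod (cinner x y))\<^sup>2 / n)"
    using zero_le_power2[of "norm (x + (- a) *\<^sub>C y)"] unfolding norm_add_sq 1 2 .
  then have "(cmod (cinner x y))\<^sup>2 / n \<le> (norm x)\<^sup>2" by linarith
  then have "(cmod (cinner x y))\<^sup>2 \<le> (norm x * norm y)\<^sup>2"
    using n by (simp add: divide_le_eq n_def power_mult_distrib)
  then show ?thesis by (rule power2_le_imp_le) simp
qed

text \<open>Bilinearity over the reals suffices to inherit continuity and the algebraic rules for the
  inner product from the library.\<close>
lemma bounded_bilinear_cinner: "bounded_bilinear (cinner :: 'a :: complex_inner \<Rightarrow> _)"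
proof
  show "\<exists>K. \<forall>a b :: 'a. norm (cinner a b) \<le> norm a * norm b * K"
    by (rule exI[of _ 1]) (simp add: Cauchy_Schwarz)
qed (simp_all add: cinner_add_left cinner_add_right cinner_scaleR_left cinner_scaleR_right)

interpretation cinner: bounded_bilinear "cinner :: 'a :: complex_inner \<Rightarrow> _"
  by (rule bounded_bilinear_cinner)

declare cinner.zero_left [simp] cinner.zero_right [simp]

lemmas cinner_simps = cinner.add_left cinner.add_right cinner.diff_left cinner.diff_right
  cinner.minus_left cinner.minus_right cinner_scaleC_left cinner_scaleC_right
  cinner_scaleR_left cinner_scaleR_right

lemma norm_diff_sq:
  "(norm (x - y))\<^sup>2 = (norm x)\<^sup>2 + (norm y)\<^sup>2 - 2 * Re (cinner x y)"
  for x :: "'a :: complex_inner"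
  using norm_add_sq[of x "- y"] by (simp add: cinner.minus_right)

lemma norm_add_sq_orth:
  "cinner x y = 0 \<Longrightarrow> (norm (x + y))\<^sup>2 = (norm x)\<^sup>2 + (norm y)\<^sup>2"
  for x :: "'a :: complex_inner"
  by (simp add: norm_add_sq)

lemma Re_cinner_self: "Re (cinner x x) = (norm x)\<^sup>2"
  for x :: "'a :: complex_inner"
  by (simp add: cinner_self)

lemma cinner_eq_0_commute: "cinner x y = 0 \<longleftrightarrow> cinner y x = 0"
  for x :: "'a :: complex_inner"
  by (metis cinner_commute complex_cnj_zero_iff)

lemma cinner_self_eq_0: "cinner x x = 0 \<longleftrightarrow> x = 0"
  for x :: "'a :: complex_inner"
  by (simp add: cinner_self)

lemma cinner_ext: "(\<And>y. cinner x y = cinner z y) \<Longrightarrow> x = z"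
  for x :: "'a :: complex_inner"
  by (metis cinner.diff_left cinner_self_eq_0 right_minus_eq)

lemma parallelogram:
  "(norm (x + y))\<^sup>2 + (norm (x - y))\<^sup>2 = 2 * (norm x)\<^sup>2 + 2 * (norm y)\<^sup>2"
  for x :: "'a :: complex_inner"
  by (simp add: norm_add_sq norm_diff_sq)


section \<open>Closed subspaces and orthogonal projections\<close>

definition orth :: "'a :: complex_inner set \<Rightarrow> 'a set" where
  "orth B = {x. \<forall>b\<in>B. cinner x b = 0}"

lemma orth_Un: "orth (A \<union> B) = orth A \<inter> orth B"
  by (auto simp: orth_def)

lemma csubspace_orth: "csubspace (orth B)"
  by (auto simp: complex_vector.subspace_def orth_def cinner_simps)

lemma csubspace_scaleR: "csubspace M \<Longrightarrow> x \<in> M \<Longrightarrow> r *\<^sub>R x \<in> M"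
  by (simp add: scaleR_scaleC complex_vector.subspace_scale)

lemma closed_orth: "closed (orth B)"
proof -
  have "orth B = (\<Inter>b\<in>B. {x. cinner x b = 0})" by (auto simp: orth_def)
  moreover have "closed {x. cinner x b = 0}" for b :: 'a
    by (intro closed_Collect_eq continuous_intros cinner.continuous_on)
  ultimately show ?thesis by (simp add: closed_INT)
qed

lemma orth_cspan: "orth (cspan B) = orth B"
proof
  show "orth (cspan B) \<subseteq> orth B"
    using complex_vector.span_superset by (auto simp: orth_def)
  show "orth B \<subseteq> orth (cspan B)"
  proof
    fix x assume x: "x \<in> orth B"
    have "csubspace {y. cinner x y = 0}"
      by (auto simp: complex_vector.subspace_def cinner_simps)
    then have "cspan B \<subseteq> {y. cinner x y = 0}"
      using x by (intro complex_vector.span_minimal) (auto simp: orth_def)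
    then show "x \<in> orth (cspan B)" by (auto simp: orth_def)
  qed
qed

text \<open>A minimising sequence for the distance to a closed subspace is Cauchy by the parallelogram
  law; the error of the limit is orthogonal to the subspace because otherwise a small correction
  along a non-orthogonal direction would decrease the distance.\<close>
lemma projection_exists:
  fixes M :: "'a :: complex_hilbert set"
  assumes M: "csubspace M" "closed M"
  shows "\<exists>p\<in>M. x - p \<in> orth M"
proof -
  define d where "d = infdist x M"
  have ne: "M \<noteq> {}" using complex_vector.subspace_0[OF M(1)] by blast
  have dle: "d \<le> norm (x - m)" if "m \<in> M" for m
    using infdist_le[OF that, of x] by (simp add: d_def dist_norm)
  have d0: "d \<ge> 0" by (simp add: d_def infdist_nonneg)
  have "\<exists>m\<in>M. norm (x - m) < d + 1 / real (Suc n)" for n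
  proof -
    have "infdist x M < d + 1 / real (Suc n)" by (simp add: d_def)
    moreover have "bdd_below (dist x ` M)" by (rule bdd_belowI[of _ 0]) auto
    ultimately show ?thesis
      using ne by (auto simp: infdist_notempty cINF_less_iff dist_norm)
  qed
  then obtain m where mM: "\<And>n. m n \<in> M" and m: "\<And>n. norm (x - m n) < d + 1 / real (Suc n)"
    by metis
  have half: "(1/2::real) *\<^sub>R (a + b) \<in> M" if "a \<in> M" "b \<in> M" for a b
    using that M(1) csubspace_scaleR complex_vector.subspace_add by blast
  have close: "(norm (m i - m j))\<^sup>2 \<le> 2 * (norm (x - m i))\<^sup>2 + 2 * (norm (x - m j))\<^sup>2 - 4 * d\<^sup>2" for i j
  proof -
    have "(norm ((x - m i) + (x - m j)))\<^sup>2 = (2 * norm (x - (1/2::real) *\<^sub>R (m i + m j)))\<^sup>2"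
    proof -
      have "(x - m i) + (x - m j) = 2 *\<^sub>R (x - (1/2::real) *\<^sub>R (m i + m j))"
        by (simp add: algebra_simps scaleR_2)
      then show ?thesis by simp
    qed
    moreover have "d\<^sup>2 \<le> (norm (x - (1/2::real) *\<^sub>R (m i + m j)))\<^sup>2"
      using dle[OF half[OF mM mM]] d0 by (simp add: power_mono)
    ultimately have "(norm ((x - m i) + (x - m j)))\<^sup>2 \<ge> 4 * d\<^sup>2" by (simp add: power_mult_distrib)
    then show ?thesis
      using parallelogram[of "x - m i" "x - m j"] by (simp add: norm_minus_commute)
  qed
  have lim: "(\<lambda>n. norm (x - m n)) \<longlonglongrightarrow> d"
  proof (rule tendsto_sandwich[of "\<lambda>_. d" _ _ "\<lambda>n. d + 1 / real (Suc n)"])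
    show "(\<lambda>n. d + 1 / real (Suc n)) \<longlonglongrightarrow> d"
      using tendsto_add[OF tendsto_const LIMSEQ_inverse_real_of_nat, of d]
      by (simp add: inverse_eq_divide)
    show "\<forall>\<^sub>F n in sequentially. d \<le> norm (x - m n)" using dle mM by simp
    show "\<forall>\<^sub>F n in sequentially. norm (x - m n) \<le> d + 1 / real (Suc n)"
      by (rule always_eventually) (use m less_imp_le in blast)
  qed simp
  have "Cauchy m"
  proof (rule metric_CauchyI)
    fix e :: real assume e: "e > 0"
    have "(\<lambda>n. 2 * (norm (x - m n))\<^sup>2) \<longlonglongrightarrow> 2 * d\<^sup>2"
      by (intro tendsto_intros lim)
    then have "\<forall>\<^sub>F n in sequentially. dist (2 * (norm (x - m n))\<^sup>2) (2 * d\<^sup>2) < e\<^sup>2 / 2"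
      using e by (intro tendstoD) auto
    then obtain N where N: "\<And>n. n \<ge> N \<Longrightarrow> dist (2 * (norm (x - m n))\<^sup>2) (2 * d\<^sup>2) < e\<^sup>2 / 2"
      by (auto simp: eventually_sequentially)
    have "dist (m i) (m j) < e" if "i \<ge> N" "j \<ge> N" for i j
    proof -
      have "(norm (m i - m j))\<^sup>2 < e\<^sup>2"
        using close[of i j] N[OF that(1)] N[OF that(2)]
        unfolding dist_real_def by linarith
      then show ?thesis using e by (simp add: dist_norm power_less_imp_less_base)
    qed
    then show "\<exists>N. \<forall>i\<ge>N. \<forall>j\<ge>N. dist (m i) (m j) < e" by blast
  qed
  then obtain p where p: "m \<longlonglongrightarrow> p" using Cauchy_convergent convergent_def by blast
  have pM: "p \<in> M" using M(2) p mM closed_sequentially by blast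
  have "(\<lambda>n. norm (x - m n)) \<longlonglongrightarrow> norm (x - p)" by (intro tendsto_intros p)
  then have dp: "norm (x - p) = d" using lim LIMSEQ_unique by blast
  have "cinner (x - p) b = 0" if b: "b \<in> M" for b
  proof (cases "b = 0")
    case False
    define c where "c = cinner (x - p) b"
    define n where "n = (norm b)\<^sup>2"
    have n: "n > 0" using False by (simp add: n_def)
    define a where "a = c / complex_of_real n"
    have "p + a *\<^sub>C b \<in> M"
      using pM b M(1) by (simp add: complex_vector.subspace_add complex_vector.subspace_scale)
    then have "d\<^sup>2 \<le> (norm (x - (p + a *\<^sub>C b)))\<^sup>2" using dle d0 by (simp add: power_mono)
    also have "x - (p + a *\<^sub>C b) = (x - p) - a *\<^sub>C b" by simp
    also have "(norm \<dots>)\<^sup>2 = d\<^sup>2 + (cmod a)\<^sup>2 * n - 2 * Re (cnj a * c)"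
      unfolding norm_diff_sq dp cinner_scaleC_right
      by (simp add: norm_scaleC power_mult_distrib n_def c_def)
    also have "Re (cnj a * c) = (cmod c)\<^sup>2 / n"
      unfolding a_def by (rule Re_cnj_div_mult)
    also have "(cmod a)\<^sup>2 * n = (cmod c)\<^sup>2 / n"
      unfolding a_def using n by (simp add: norm_divide power_divide) (simp add: power2_eq_square)
    finally have "(cmod c)\<^sup>2 / n \<le> 0" by simp
    then show ?thesis using n by (simp add: c_def divide_le_0_iff)
  qed simp
  then show ?thesis using pM by (auto simp: orth_def)
qed

lemma bounded_linear_scaleC_left: "bounded_linear (\<lambda>c. c *\<^sub>C x)"
  for x :: "'a :: complex_normed_vector"
proof (rule bounded_linear_intro[where K = "norm x"])
  show "(r *\<^sub>R c) *\<^sub>C x = r *\<^sub>R (c *\<^sub>C x)" for r c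
    by (simp add: scaleR_scaleC scaleC_scaleC scaleR_conv_of_real)
qed (simp_all add: scaleC_add_left norm_scaleC)

lemma orth_disjoint: "x \<in> M \<Longrightarrow> x \<in> orth M \<Longrightarrow> x = 0"
  by (auto simp: orth_def cinner_self_eq_0)

text \<open>A closed subspace stays closed when one vector \<open>f\<close> is adjoined: after replacing \<open>f\<close> by its
  component \<open>g\<close> orthogonal to \<open>M\<close>, membership of \<open>x\<close> means that \<open>x - (\<langle>x,g\<rangle>/\<langle>g,g\<rangle>) g\<close> lies in \<open>M\<close>,
  which is a closed condition.\<close>
lemma closed_cspan_Un:
  fixes M :: "'a :: complex_hilbert set"
  assumes M: "csubspace M" "closed M" and B: "finite B"
  shows "closed (cspan (M \<union> B))"
  using B
proof induction
  case empty
  then show ?case using M by (simp add: complex_vector.span_eq_iff[THEN iffD2])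
next
  case (insert f B)
  let ?N = "cspan (M \<union> B)"
  have N: "csubspace ?N" by simp
  obtain p where p: "p \<in> ?N" "f - p \<in> orth ?N"
    using projection_exists[OF N insert.IH] by blast
  define g where "g = f - p"
  have mem: "x \<in> cspan (M \<union> insert f B) \<longleftrightarrow> x - (cinner x g / cinner g g) *\<^sub>C g \<in> ?N" for x
  proof
    assume "x \<in> cspan (M \<union> insert f B)"
    then obtain k where k: "x - k *\<^sub>C f \<in> ?N"
      using complex_vector.span_breakdown_eq[of x f "M \<union> B"] by auto
    have xk: "x - k *\<^sub>C g \<in> ?N"
    proof -
      have "x - k *\<^sub>C g = (x - k *\<^sub>C f) + k *\<^sub>C p"
        by (simp add: g_def complex_vector.scale_right_diff_distrib)
      then show ?thesis
        using complex_vector.span_add[OF k complex_vector.span_scale[OF p(1)]] by (simp only:)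
    qed
    then have "cinner (x - k *\<^sub>C g) g = 0"
      using p(2) by (subst cinner_eq_0_commute) (simp add: orth_def g_def)
    then have eq: "cinner x g = k * cinner g g" by (simp only: cinner_simps right_minus_eq)
    have "(cinner x g / cinner g g) *\<^sub>C g = k *\<^sub>C g"
      unfolding eq by (cases "g = 0") (simp_all add: cinner_self_eq_0)
    then show "x - (cinner x g / cinner g g) *\<^sub>C g \<in> ?N"
      using xk by (simp only:)
  next
    assume a: "x - (cinner x g / cinner g g) *\<^sub>C g \<in> ?N"
    define k where "k = cinner x g / cinner g g"
    have "x - k *\<^sub>C f = (x - k *\<^sub>C g) - k *\<^sub>C p"
      by (simp add: g_def complex_vector.scale_right_diff_distrib)
    then have "x - k *\<^sub>C f \<in> ?N"
      using complex_vector.span_diff[OF a complex_vector.span_scale[OF p(1), of k]]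
      by (simp only: k_def)
    then show "x \<in> cspan (M \<union> insert f B)"
      using complex_vector.span_breakdown_eq[of x f "M \<union> B"] by auto
  qed
  have "bounded_linear (\<lambda>x. (cinner x g / cinner g g) *\<^sub>C g)"
    by (intro bounded_linear_compose[OF bounded_linear_scaleC_left]
        bounded_linear_compose[OF bounded_linear_divide] cinner.bounded_linear_left)
  then have "continuous_on UNIV (\<lambda>x. x - (cinner x g / cinner g g) *\<^sub>C g)"
    by (intro continuous_on_diff continuous_on_id linear_continuous_on)
  then have "closed ((\<lambda>x. x - (cinner x g / cinner g g) *\<^sub>C g) -` ?N)"
    by (rule closed_vimage[OF insert.IH])
  also have "(\<lambda>x. x - (cinner x g / cinner g g) *\<^sub>C g) -` ?N = cspan (M \<union> insert f B)"
    using mem by auto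
  finally show ?case .
qed

lemma closed_cspan_finite: "finite B \<Longrightarrow> closed (cspan B)"
  for B :: "'a :: complex_hilbert set"
  using closed_cspan_Un[of "{0}" B] complex_vector.subspace_single_0 by simp

lemma unit_vector_orth_finite:
  assumes "\<not> cfinite_dim (UNIV :: 'a :: complex_hilbert set)" and B: "finite B"
  shows "\<exists>x \<in> orth B. norm (x :: 'a) = 1"
proof -
  obtain x where x: "x \<notin> cspan B" using assms by (auto simp: cfinite_dim_def)
  obtain p where p: "p \<in> cspan B" "x - p \<in> orth (cspan B)"
    using projection_exists[OF _ closed_cspan_finite[OF B]] by auto
  then have "x - p \<noteq> 0" using x by auto
  moreover have "(1 / norm (x - p)) *\<^sub>R (x - p) \<in> orth B"
    using p(2) csubspace_scaleR[OF csubspace_orth] by (simp only: orth_cspan)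
  ultimately show ?thesis by (intro bexI) auto
qed

text \<open>Inside a closed subspace \<open>M\<close>, being orthogonal to \<open>b\<close> is the same as being orthogonal to the
  projection of \<open>b\<close> to \<open>M\<close>; so the part of \<open>M\<close> orthogonal to finitely many vectors has a
  finite-dimensional complement within \<open>M\<close>.\<close>
lemma finite_codim_decomposition:
  fixes M :: "'a :: complex_hilbert set"
  assumes M: "csubspace M" "closed M" and B: "finite B"
  shows "\<exists>F. finite F \<and> F \<subseteq> M \<and>
    (\<forall>x\<in>M. \<exists>p\<in>cspan F. x - p \<in> M \<and> x - p \<in> orth B \<and> x - p \<in> orth (cspan F))"
proof -
  obtain P where P: "\<And>x. P x \<in> M" "\<And>x. x - P x \<in> orth M"
    using projection_exists[OF M] by metis
  let ?F = "P ` B"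
  have FM: "cspan ?F \<subseteq> M" using M(1) P(1) by (intro complex_vector.span_minimal) auto
  have "\<exists>p\<in>cspan ?F. x - p \<in> M \<and> x - p \<in> orth B \<and> x - p \<in> orth (cspan ?F)" if x: "x \<in> M" for x
  proof -
    obtain p where p: "p \<in> cspan ?F" "x - p \<in> orth (cspan ?F)"
      using projection_exists[OF _ closed_cspan_finite, of ?F] B by auto
    have xp: "x - p \<in> M" using x p(1) FM M(1) by (auto intro: complex_vector.subspace_diff)
    have "cinner (x - p) b = 0" if b: "b \<in> B" for b
    proof -
      have "cinner (x - p) (P b) = 0"
        using p(2) b by (auto simp: orth_def complex_vector.span_base)
      moreover have "cinner (x - p) (b - P b) = 0"
        using P(2)[of b] xp by (subst cinner_eq_0_commute) (auto simp: orth_def)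
      ultimately show ?thesis by (simp add: cinner.diff_right)
    qed
    then show ?thesis using p xp by (auto simp: orth_def)
  qed
  then show ?thesis using B P(1) by (intro exI[of _ ?F]) auto
qed

text \<open>The decomposition above has no room for a component orthogonal to \<open>B\<close>, so \<open>M\<close> is its
  finite-dimensional part.\<close>
lemma cfinite_dim_if_disjoint_orth:
  fixes M :: "'a :: complex_hilbert set"
  assumes M: "csubspace M" "closed M" and B: "finite B" and disj: "M \<inter> orth B \<subseteq> {0}"
  shows "cfinite_dim M"
proof -
  obtain F where F: "finite F" "F \<subseteq> M"
    "\<forall>x\<in>M. \<exists>p\<in>cspan F. x - p \<in> M \<and> x - p \<in> orth B \<and> x - p \<in> orth (cspan F)"
    using finite_codim_decomposition[OF M B] by blast
  have "x \<in> cspan F" if "x \<in> M" for x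
    using F(3) that disj by (metis IntI eq_iff_diff_eq_0 singletonD subsetD)
  then have "cspan F = M" using M(1) F(2) complex_vector.span_minimal by blast
  then show ?thesis using F(1) by (auto simp: cfinite_dim_def)
qed

text \<open>By induction: with \<open>g\<close> the normalised component of the new vector \<open>f\<close> orthogonal to the span of
  \<open>B\<close>, Pythagoras bounds both coordinates of a vector \<open>c g + w\<close> of the ball, so the ball lies in a
  continuous image of a compact product.\<close>
lemma compact_ball_cspan_finite:
  fixes B :: "'a :: complex_hilbert set"
  assumes "finite B"
  shows "compact (cspan B \<inter> cball 0 r)"
  using assms
proof induction
  case empty
  then show ?case by (cases "r \<ge> 0") auto
next
  case (insert f B)
  let ?N = "cspan B"
  obtain p where p: "p \<in> ?N" "f - p \<in> orth ?N"
    using projection_exists[OF _ closed_cspan_finite[OF insert.hyps(1)]] by auto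
  define g where "g = (1 / norm (f - p)) *\<^sub>R (f - p)"
  let ?K = "(\<lambda>(c, w). c *\<^sub>C g + w) ` (cball 0 r \<times> (?N \<inter> cball 0 r))"
  have "compact ?K"
  proof (rule compact_continuous_image)
    show "continuous_on (cball 0 r \<times> (?N \<inter> cball 0 r)) (\<lambda>(c, w). c *\<^sub>C g + w)"
      unfolding case_prod_beta
      by (intro continuous_on_add continuous_on_snd continuous_on_id
          bounded_linear.continuous_on[OF bounded_linear_scaleC_left] continuous_on_fst)
    show "compact (cball (0::complex) r \<times> (?N \<inter> cball 0 r))"
      using insert.IH by (intro compact_Times) auto
  qed
  moreover have "cspan (insert f B) \<inter> cball 0 r \<subseteq> ?K"
  proof
    fix x assume x: "x \<in> cspan (insert f B) \<inter> cball 0 r"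
    then obtain k where k: "x - k *\<^sub>C f \<in> ?N"
      using complex_vector.span_breakdown_eq[of x f B] by auto
    define w where "w = (x - k *\<^sub>C f) + k *\<^sub>C p"
    define c where "c = k * complex_of_real (norm (f - p))"
    have w: "w \<in> ?N" using k p(1) by (simp add: w_def complex_vector.span_add complex_vector.span_scale)
    have cg: "c *\<^sub>C g = k *\<^sub>C (f - p)"
      by (cases "f = p") (simp_all add: c_def g_def scaleR_scaleC scaleC_scaleC)
    have x': "x = c *\<^sub>C g + w"
      by (simp add: cg w_def complex_vector.scale_right_diff_distrib)
    have "cinner (c *\<^sub>C g) w = 0"
      using p(2) w by (simp add: cg cinner_simps orth_def)
    then have "(norm x)\<^sup>2 = (norm (c *\<^sub>C g))\<^sup>2 + (norm w)\<^sup>2"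
      unfolding x' by (rule norm_add_sq_orth)
    moreover have "norm (c *\<^sub>C g) = cmod c"
      unfolding cg norm_scaleC by (simp add: c_def norm_mult)
    ultimately have "(cmod c)\<^sup>2 \<le> (norm x)\<^sup>2" "(norm w)\<^sup>2 \<le> (norm x)\<^sup>2" by simp_all
    then have "cmod c \<le> norm x" "norm w \<le> norm x" using power2_le_imp_le norm_ge_zero by blast+
    then have "(c, w) \<in> cball 0 r \<times> (?N \<inter> cball 0 r)" using x w by auto
    then show "x \<in> ?K" unfolding x' by (rule rev_image_eqI) simp
  qed
  moreover have "closed (cspan (insert f B) \<inter> cball 0 r)"
    using insert.hyps by (intro closed_Int closed_cspan_finite) auto
  ultimately show ?case
    by (metis Int_absorb1 compact_Int_closed)
qed


lemma orth_decomposition: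
  fixes x :: "'a :: complex_hilbert"
  assumes "finite B"
  obtains p where "p \<in> cspan B" "x - p \<in> orth B" "norm p \<le> norm x" "norm (x - p) \<le> norm x"
proof -
  obtain p where p: "p \<in> cspan B" "x - p \<in> orth (cspan B)"
    using projection_exists[OF _ closed_cspan_finite[OF assms]] by auto
  have "(norm ((x - p) + p))\<^sup>2 = (norm (x - p))\<^sup>2 + (norm p)\<^sup>2"
    using p by (intro norm_add_sq_orth) (simp add: orth_def)
  then have "(norm p)\<^sup>2 \<le> (norm x)\<^sup>2" "(norm (x - p))\<^sup>2 \<le> (norm x)\<^sup>2" by simp_all
  then have "norm p \<le> norm x" "norm (x - p) \<le> norm x"
    using power2_le_imp_le norm_ge_zero by blast+
  then show thesis using that p by (simp only: orth_cspan)
qed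

section \<open>Adjoints\<close>

lemma bounded_opsD: "T \<in> bounded_ops \<Longrightarrow> blinfun_apply T (a *\<^sub>C x) = a *\<^sub>C blinfun_apply T x"
  by (auto simp: bounded_ops_def)

lemma closed_null_space: "closed (null_space T)"
  unfolding null_space_def by (intro closed_Collect_eq continuous_intros)

lemma csubspace_null_space: "T \<in> bounded_ops \<Longrightarrow> csubspace (null_space T)"
  by (auto simp: complex_vector.subspace_def null_space_def blinfun.bilinear_simps bounded_opsD)

lemma csubspace_range: "T \<in> bounded_ops \<Longrightarrow> csubspace (range (blinfun_apply T))"
  unfolding complex_vector.subspace_def
  by (auto simp flip: blinfun.add_right bounded_opsD intro: range_eqI[of _ _ 0])

text \<open>If \<open>f\<close> is not zero, take a vector \<open>u\<close> orthogonal to the kernel of \<open>f\<close>; a multiple of \<open>u\<close>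
  represents \<open>f\<close>, since \<open>f u x - f x u\<close> always lies in the kernel.\<close>
lemma Riesz_representation:
  fixes f :: "'a :: complex_hilbert \<Rightarrow> complex"
  assumes f: "bounded_linear f" and fC: "\<And>a x. f (a *\<^sub>C x) = a * f x"
  shows "\<exists>z. \<forall>x. f x = cinner x z"
proof (cases "\<forall>x. f x = 0")
  case True
  then show ?thesis by (intro exI[of _ 0]) simp
next
  case False
  interpret f: bounded_linear f by fact
  let ?N = "{x. f x = 0}"
  obtain v where v: "f v \<noteq> 0" using False by blast
  have "csubspace ?N" by (auto simp: complex_vector.subspace_def f.add f.zero fC)
  moreover have "closed ?N" by (intro closed_Collect_eq continuous_intros f.continuous_on)
  ultimately obtain p where p: "p \<in> ?N" "v - p \<in> orth ?N" using projection_exists by blast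
  define u where "u = v - p"
  have fu: "f u \<noteq> 0" using v p(1) by (simp add: u_def f.diff)
  then have u0: "cinner u u \<noteq> 0" by (auto simp: cinner_self_eq_0 f.zero)
  have "f x = cinner x ((cnj (f u) / cinner u u) *\<^sub>C u)" for x
  proof -
    have "f u *\<^sub>C x - f x *\<^sub>C u \<in> ?N" by (simp add: f.diff fC)
    then have "cinner u (f u *\<^sub>C x - f x *\<^sub>C u) = 0" using p(2) by (auto simp: orth_def u_def)
    then have "cinner (f u *\<^sub>C x - f x *\<^sub>C u) u = 0" by (subst cinner_eq_0_commute)
    then have "f x * cinner u u = f u * cinner x u" by (simp add: cinner_simps)
    moreover have "cnj (cinner u u) = cinner u u" by (simp add: cinner_self)
    ultimately show ?thesis using u0 by (simp add: cinner_simps field_simps)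
  qed
  then show ?thesis by blast
qed

lemma adjoint_exists:
  fixes T :: "'a :: complex_hilbert \<Rightarrow>\<^sub>L 'a"
  assumes T: "T \<in> bounded_ops"
  shows "\<exists>S\<in>bounded_ops. \<forall>x y. cinner (blinfun_apply T x) y = cinner x (blinfun_apply S y)"
proof -
  have "\<exists>z. \<forall>x. cinner (blinfun_apply T x) y = cinner x z" for y
  proof (rule Riesz_representation)
    show "bounded_linear (\<lambda>x. cinner (blinfun_apply T x) y)"
      by (intro bounded_linear_compose[OF cinner.bounded_linear_left] blinfun.bounded_linear_right)
  qed (simp add: bounded_opsD[OF T] cinner_simps)
  then obtain S where S: "\<And>x y. cinner (blinfun_apply T x) y = cinner x (S y)" by metis
  have ext: "u = v" if "\<And>x. cinner x u = cinner x v" for u v :: 'a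
    using that by (intro cinner_ext) (metis cinner_commute)
  have SC: "S (a *\<^sub>C x) = a *\<^sub>C S x" for a x
    by (rule ext) (simp add: S[symmetric] cinner_simps)
  have "bounded_linear S"
  proof (rule bounded_linear_intro[where K = "norm T"])
    show "S (x + y) = S x + S y" for x y by (rule ext) (simp add: S[symmetric] cinner_simps)
    show "S (r *\<^sub>R x) = r *\<^sub>R S x" for r x by (simp add: scaleR_scaleC SC)
    show "norm (S x) \<le> norm x * norm T" for x
    proof -
      have "(norm (S x))\<^sup>2 = Re (cinner (blinfun_apply T (S x)) x)" by (simp add: S Re_cinner_self)
      also have "\<dots> \<le> norm (blinfun_apply T (S x)) * norm x"
        using Cauchy_Schwarz complex_Re_le_cmod order_trans by blast
      also have "\<dots> \<le> norm T * norm (S x) * norm x" by (intro mult_right_mono norm_blinfun) auto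
      finally show ?thesis
        by (cases "S x = 0") (simp_all add: power2_eq_square algebra_simps)
    qed
  qed
  then show ?thesis
    by (intro bexI[of _ "Blinfun S"]) (auto simp: bounded_linear_Blinfun_apply S SC bounded_ops_def)
qed

lemma adjoint_unique:
  fixes S :: "'a :: complex_hilbert \<Rightarrow>\<^sub>L 'a"
  assumes "S \<in> bounded_ops"
    and "\<And>x y. cinner (blinfun_apply T x) y = cinner x (blinfun_apply S y)"
  shows "adjoint_op T = S"
  unfolding adjoint_op_def
proof (rule the_equality)
  fix S' :: "'a \<Rightarrow>\<^sub>L 'a"
  assume S': "S' \<in> bounded_ops \<and>
    (\<forall>x y. cinner (blinfun_apply T x) y = cinner x (blinfun_apply S' y))"
  have "cinner (blinfun_apply S' y) x = cinner (blinfun_apply S y) x" for x y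
    using S' assms(2) by (metis cinner_commute)
  then show "S' = S" by (intro blinfun_eqI cinner_ext) 
qed (use assms in blast)

lemma
  fixes T :: "'a :: complex_hilbert \<Rightarrow>\<^sub>L 'a"
  assumes "T \<in> bounded_ops"
  shows adjoint_bounded_op: "adjoint_op T \<in> bounded_ops"
    and cinner_adjoint: "cinner (blinfun_apply T x) y = cinner x (blinfun_apply (adjoint_op T) y)"
  using adjoint_exists[OF assms] adjoint_unique[of _ T] by auto

lemma cinner_adjoint':
  fixes T :: "'a :: complex_hilbert \<Rightarrow>\<^sub>L 'a"
  assumes "T \<in> bounded_ops"
  shows "cinner (blinfun_apply (adjoint_op T) x) y = cinner x (blinfun_apply T y)"
  using cinner_adjoint[OF assms, of y x] by (metis cinner_commute)

text \<open>This is how conditions \<open>x \<in> B\<^sup>\<bottom>\<close> are pulled back along operators.\<close>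
lemma adjoint_mem_orth:
  fixes T :: "'a :: complex_hilbert \<Rightarrow>\<^sub>L 'a"
  assumes "T \<in> bounded_ops"
  shows "x \<in> orth (blinfun_apply (adjoint_op T) ` B) \<longleftrightarrow> blinfun_apply T x \<in> orth B"
  by (simp add: orth_def cinner_adjoint[OF assms])

lemma selfadjoint_op_iff:
  fixes T :: "'a :: complex_hilbert \<Rightarrow>\<^sub>L 'a"
  assumes "T \<in> bounded_ops"
  shows "selfadjoint_op T \<longleftrightarrow>
    (\<forall>x y. cinner (blinfun_apply T x) y = cinner x (blinfun_apply T y))"
  unfolding selfadjoint_op_def
  using adjoint_unique[OF assms, of T] cinner_adjoint[OF assms] by metis

lemma
  shows bounded_ops_add: "S \<in> bounded_ops \<Longrightarrow> T \<in> bounded_ops \<Longrightarrow> S + T \<in> bounded_ops"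
    and bounded_ops_diff: "S \<in> bounded_ops \<Longrightarrow> T \<in> bounded_ops \<Longrightarrow> S - T \<in> bounded_ops"
    and bounded_ops_scaleR: "T \<in> bounded_ops \<Longrightarrow> r *\<^sub>R T \<in> bounded_ops"
    and bounded_ops_scaleC: "T \<in> bounded_ops \<Longrightarrow> c *\<^sub>C T \<in> bounded_ops"
    and bounded_ops_compose: "S \<in> bounded_ops \<Longrightarrow> T \<in> bounded_ops \<Longrightarrow> S o\<^sub>L T \<in> bounded_ops"
    and bounded_ops_id: "id_blinfun \<in> bounded_ops"
  by (simp_all add: bounded_ops_def blinfun.bilinear_simps scaleC_add_right scaleR_scaleC
      complex_vector.scale_right_diff_distrib scaleC_scaleC mult.commute scaleC_blinfun.rep_eq)

section \<open>Compact operators\<close>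

text \<open>Orthogonality to a finite set is the working form of ``on a closed subspace of finite
  codimension'': such conditions are combined by taking unions of finite sets.\<close>
definition ess_small :: "('a :: complex_hilbert \<Rightarrow>\<^sub>L 'a) \<Rightarrow> bool" where
  "ess_small K \<longleftrightarrow>
    (\<forall>e>0. \<exists>B. finite B \<and> (\<forall>x\<in>orth B. norm (blinfun_apply K x) \<le> e * norm x))"

lemma ess_smallD:
  assumes "ess_small K" "e > 0"
  obtains B where "finite B" "\<And>x. x \<in> orth B \<Longrightarrow> norm (blinfun_apply K x) \<le> e * norm x"
proof -
  have "\<exists>B. finite B \<and> (\<forall>x\<in>orth B. norm (blinfun_apply K x) \<le> e * norm x)"
    using assms by (simp add: ess_small_def)
  then show thesis using that by blast
qed

lemma norm_bound_from_unit:
  fixes T :: "'a :: real_normed_vector \<Rightarrow>\<^sub>L 'b :: real_normed_vector"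
  assumes "norm (blinfun_apply T ((1 / norm x) *\<^sub>R x)) \<le> e"
  shows "norm (blinfun_apply T x) \<le> e * norm x"
proof (cases "x = 0")
  case False
  then have "norm (blinfun_apply T ((1 / norm x) *\<^sub>R x)) * norm x = norm (blinfun_apply T x)"
    by (simp add: blinfun.scaleR_right)
  then show ?thesis using mult_right_mono[OF assms norm_ge_zero[of x]] by simp
qed (simp add: blinfun.zero_right)

text \<open>Given a finite net \<open>k\<close> of the image of the unit ball, a vector \<open>x\<close> orthogonal to \<open>K\<^sup>* k\<close> has
  \<open>K x\<close> orthogonal to every point of the net; by Pythagoras the net point near \<open>K x\<close> is at least
  as far from it as the origin is.\<close>
lemma compact_imp_ess_small:
  fixes K :: "'a :: complex_hilbert \<Rightarrow>\<^sub>L 'a"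
  assumes "K \<in> compact_ops"
  shows "ess_small K"
  unfolding ess_small_def
proof (intro allI impI)
  fix e :: real assume e: "e > 0"
  have K: "K \<in> bounded_ops" "compact (closure (blinfun_apply K ` cball 0 1))"
    using assms by (auto simp: compact_ops_def)
  obtain k where k: "finite k" "closure (blinfun_apply K ` cball 0 1) \<subseteq> (\<Union>y\<in>k. ball y e)"
    using K(2) e unfolding compact_eq_totally_bounded by blast
  have "norm (blinfun_apply K x) \<le> e * norm x" if x: "x \<in> orth (blinfun_apply (adjoint_op K) ` k)" for x
  proof (rule norm_bound_from_unit)
    let ?u = "(1 / norm x) *\<^sub>R x"
    have "?u \<in> cball 0 1" by (cases "x = 0") auto
    then have "blinfun_apply K ?u \<in> closure (blinfun_apply K ` cball 0 1)"
      by (intro subsetD[OF closure_subset] imageI)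
    then have "blinfun_apply K ?u \<in> (\<Union>y\<in>k. ball y e)" using k(2) by (rule subsetD[rotated])
    then obtain y where y: "y \<in> k" "norm (blinfun_apply K ?u - y) < e"
      by (auto simp: dist_norm norm_minus_commute)
    have "cinner (blinfun_apply K ?u) y = 0"
      using x y(1) unfolding adjoint_mem_orth[OF K(1)]
      by (simp add: orth_def blinfun.scaleR_right cinner_simps)
    then have "(norm (blinfun_apply K ?u))\<^sup>2 \<le> (norm (blinfun_apply K ?u - y))\<^sup>2"
      unfolding norm_diff_sq by simp
    then have "norm (blinfun_apply K ?u) \<le> norm (blinfun_apply K ?u - y)"
      using power2_le_imp_le norm_ge_zero by blast
    then show "norm (blinfun_apply K ?u) \<le> e" using y(2) by simp
  qed
  then show "\<exists>B. finite B \<and> (\<forall>x\<in>orth B. norm (blinfun_apply K x) \<le> e * norm x)"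
    using k(1) by (intro exI[of _ "blinfun_apply (adjoint_op K) ` k"]) auto
qed

text \<open>Conversely, up to an error \<open>e\<close> the image of the unit ball is the image of a ball of a
  finite-dimensional space, hence totally bounded.\<close>
lemma ess_small_imp_compact:
  fixes K :: "'a :: complex_hilbert \<Rightarrow>\<^sub>L 'a"
  assumes "K \<in> bounded_ops" and small: "ess_small K"
  shows "K \<in> compact_ops"
proof -
  have "\<exists>k. finite k \<and> closure (blinfun_apply K ` cball 0 1) \<subseteq> (\<Union>y\<in>k. ball y e)"
    if e: "e > 0" for e
  proof -
    obtain B where B: "finite B" "\<And>x. x \<in> orth B \<Longrightarrow> norm (blinfun_apply K x) \<le> (e / 3) * norm x"
      using ess_smallD[OF small, of "e / 3"] e by auto
    have "compact (blinfun_apply K ` (cspan B \<inter> cball 0 1))"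
      by (intro compact_continuous_image compact_ball_cspan_finite B(1)
          linear_continuous_on blinfun.bounded_linear_right)
    then have "\<exists>k. finite k \<and> blinfun_apply K ` (cspan B \<inter> cball 0 1) \<subseteq> (\<Union>y\<in>k. ball y (e / 3))"
      using e unfolding compact_eq_totally_bounded by (meson divide_pos_pos zero_less_numeral)
    then obtain k where k: "finite k" "blinfun_apply K ` (cspan B \<inter> cball 0 1) \<subseteq> (\<Union>y\<in>k. ball y (e / 3))"
      by blast
    have "blinfun_apply K ` cball 0 1 \<subseteq> (\<Union>y\<in>k. cball y (2 * e / 3))"
    proof
      fix z assume "z \<in> blinfun_apply K ` cball 0 1"
      then obtain x where x: "norm x \<le> 1" "z = blinfun_apply K x" by auto
      obtain p where p: "p \<in> cspan B" "x - p \<in> orth B" "norm p \<le> norm x" "norm (x - p) \<le> norm x"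
        using orth_decomposition[OF B(1)] by blast
      have "p \<in> cspan B \<inter> cball 0 1" using p x by auto
      then obtain y where y: "y \<in> k" "dist y (blinfun_apply K p) < e / 3" using k(2) by fastforce
      have "norm (blinfun_apply K (x - p)) \<le> (e / 3) * norm (x - p)" using B(2) p(2) by blast
      also have "\<dots> \<le> (e / 3) * 1" using p(4) x e by (intro mult_left_mono) auto
      finally have "dist (blinfun_apply K p) z \<le> e / 3"
        by (simp add: x(2) dist_norm blinfun.diff_right norm_minus_commute)
      then have "dist y z \<le> 2 * e / 3"
        using y(2) dist_triangle[of y z "blinfun_apply K p"] by simp
      then show "z \<in> (\<Union>y\<in>k. cball y (2 * e / 3))" using y(1) by auto
    qed
    moreover have "closed (\<Union>y\<in>k. cball y (2 * e / 3))" using k(1) by (intro closed_UN) auto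
    ultimately have "closure (blinfun_apply K ` cball 0 1) \<subseteq> (\<Union>y\<in>k. cball y (2 * e / 3))"
      by (rule closure_minimal)
    also have "\<dots> \<subseteq> (\<Union>y\<in>k. ball y e)" using e by fastforce
    finally show ?thesis using k(1) by blast
  qed
  then show ?thesis
    using assms(1) by (auto simp: compact_ops_def compact_eq_totally_bounded complete_eq_closed)
qed

lemma compact_ops_iff: "K \<in> compact_ops \<longleftrightarrow> K \<in> bounded_ops \<and> ess_small K"
  for K :: "'a :: complex_hilbert \<Rightarrow>\<^sub>L 'a"
  using compact_imp_ess_small ess_small_imp_compact by (auto simp: compact_ops_def)

lemma ess_small_scaled:
  fixes L :: "'a :: complex_hilbert \<Rightarrow>\<^sub>L 'a"
  assumes K: "ess_small K" and C: "C \<ge> 0"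
    and L: "\<And>x. norm (blinfun_apply L x) \<le> C * norm (blinfun_apply K x)"
  shows "ess_small L"
  unfolding ess_small_def
proof (intro allI impI)
  fix e :: real assume e: "e > 0"
  obtain B where B: "finite B" "\<And>x. x \<in> orth B \<Longrightarrow> norm (blinfun_apply K x) \<le> (e / (C + 1)) * norm x"
    using ess_smallD[OF K, of "e / (C + 1)"] e C by auto
  have "norm (blinfun_apply L x) \<le> e * norm x" if "x \<in> orth B" for x
  proof -
    have "norm (blinfun_apply L x) \<le> C * ((e / (C + 1)) * norm x)"
      using L[of x] mult_left_mono[OF B(2)[OF that] C] by linarith
    also have "\<dots> = (C / (C + 1)) * (e * norm x)" by simp
    also have "\<dots> \<le> 1 * (e * norm x)" using C e by (intro mult_right_mono) auto
    finally show ?thesis by simp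
  qed
  then show "\<exists>B. finite B \<and> (\<forall>x\<in>orth B. norm (blinfun_apply L x) \<le> e * norm x)" using B(1) by blast
qed

lemma ess_small_compose_left: "ess_small K \<Longrightarrow> ess_small (S o\<^sub>L K)"
  by (rule ess_small_scaled[where C = "norm S"]) (auto simp: norm_blinfun)

lemma ess_small_scaleR: "ess_small K \<Longrightarrow> ess_small (r *\<^sub>R K)"
  by (rule ess_small_scaled[where C = "\<bar>r\<bar>"]) (auto simp: blinfun.scaleR_left)

lemma ess_small_compose_right:
  fixes S :: "'a :: complex_hilbert \<Rightarrow>\<^sub>L 'a"
  assumes K: "ess_small K" and S: "S \<in> bounded_ops"
  shows "ess_small (K o\<^sub>L S)"
  unfolding ess_small_def
proof (intro allI impI)
  fix e :: real assume e: "e > 0"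
  let ?c = "norm S + 1"
  have c: "?c > 0" by (simp add: add_nonneg_pos)
  obtain B where B: "finite B" "\<And>x. x \<in> orth B \<Longrightarrow> norm (blinfun_apply K x) \<le> (e / ?c) * norm x"
    using ess_smallD[OF K, of "e / ?c"] e c by auto
  have "norm (blinfun_apply (K o\<^sub>L S) x) \<le> e * norm x"
    if x: "x \<in> orth (blinfun_apply (adjoint_op S) ` B)" for x
  proof -
    have "norm (blinfun_apply (K o\<^sub>L S) x) \<le> (e / ?c) * norm (blinfun_apply S x)"
      using B(2) x by (simp add: adjoint_mem_orth[OF S])
    also have "\<dots> \<le> (e / ?c) * (?c * norm x)"
      using norm_blinfun[of S x] c e by (intro mult_left_mono) (auto simp: distrib_right add_increasing2)
    finally show ?thesis using c by simp
  qed
  then show "\<exists>B. finite B \<and> (\<forall>x\<in>orth B. norm (blinfun_apply (K o\<^sub>L S) x) \<le> e * norm x)"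
    using B(1) by (intro exI[of _ "blinfun_apply (adjoint_op S) ` B"]) auto
qed

text \<open>In other words, the essentially small operators are closed in the operator norm.\<close>
lemma ess_small_approx:
  fixes K :: "'a :: complex_hilbert \<Rightarrow>\<^sub>L 'a"
  assumes "\<And>e. e > 0 \<Longrightarrow> \<exists>L. ess_small L \<and> norm (K - L) \<le> e"
  shows "ess_small K"
  unfolding ess_small_def
proof (intro allI impI)
  fix e :: real assume e: "e > 0"
  obtain L where L: "ess_small L" "norm (K - L) \<le> e / 2" using assms[of "e / 2"] e by auto
  obtain B where B: "finite B" "\<And>x. x \<in> orth B \<Longrightarrow> norm (blinfun_apply L x) \<le> (e / 2) * norm x"
    using ess_smallD[OF L(1), of "e / 2"] e by auto
  have "norm (blinfun_apply K x) \<le> e * norm x" if "x \<in> orth B" for x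
  proof -
    have "norm (blinfun_apply (K - L) x) \<le> (e / 2) * norm x"
      using norm_blinfun[of "K - L" x] mult_right_mono[OF L(2) norm_ge_zero[of x]] by linarith
    moreover have "blinfun_apply K x = blinfun_apply (K - L) x + blinfun_apply L x"
      by (simp add: blinfun.diff_left)
    ultimately show ?thesis
      using norm_triangle_ineq[of "blinfun_apply (K - L) x" "blinfun_apply L x"] B(2)[OF that]
      by (simp only:)
  qed
  then show "\<exists>B. finite B \<and> (\<forall>x\<in>orth B. norm (blinfun_apply K x) \<le> e * norm x)" using B(1) by blast
qed

lemma ess_small_add:
  fixes K L :: "'a :: complex_hilbert \<Rightarrow>\<^sub>L 'a"
  assumes "ess_small K" "ess_small L"
  shows "ess_small (K + L)"
  unfolding ess_small_def
proof (intro allI impI)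
  fix e :: real assume e: "e > 0"
  obtain A where A: "finite A" "\<And>x. x \<in> orth A \<Longrightarrow> norm (blinfun_apply K x) \<le> (e / 2) * norm x"
    using ess_smallD[OF assms(1), of "e / 2"] e by auto
  obtain B where B: "finite B" "\<And>x. x \<in> orth B \<Longrightarrow> norm (blinfun_apply L x) \<le> (e / 2) * norm x"
    using ess_smallD[OF assms(2), of "e / 2"] e by auto
  have "norm (blinfun_apply (K + L) x) \<le> e * norm x" if "x \<in> orth (A \<union> B)" for x
    using norm_triangle_ineq[of "blinfun_apply K x" "blinfun_apply L x"] A(2)[of x] B(2)[of x] that
    by (simp add: orth_Un blinfun.add_left)
  then show "\<exists>B. finite B \<and> (\<forall>x\<in>orth B. norm (blinfun_apply (K + L) x) \<le> e * norm x)"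
    using A(1) B(1) by (intro exI[of _ "A \<union> B"]) auto
qed

lemma ess_small_diff: "ess_small K \<Longrightarrow> ess_small L \<Longrightarrow> ess_small (K - L)"
  using ess_small_add[of K "(- 1) *\<^sub>R L"] ess_small_scaleR[of L "- 1"] by simp

lemma ess_small_if_zero_on_orth:
  "finite B \<Longrightarrow> (\<And>x. x \<in> orth B \<Longrightarrow> blinfun_apply K x = 0) \<Longrightarrow> ess_small K"
  unfolding ess_small_def by (intro allI impI exI[of _ B]) auto


section \<open>Closed range and Fredholm operators\<close>

lemma closed_image_if_bounded_below:
  fixes T :: "'a :: complex_hilbert \<Rightarrow>\<^sub>L 'a"
  assumes "csubspace M" "closed M" "c > 0"
    and "\<And>x. x \<in> M \<Longrightarrow> c * norm x \<le> norm (blinfun_apply T x)"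
  shows "closed (blinfun_apply T ` M)"
proof -
  have "subspace M"
    using assms(1) by (auto simp: subspace_def csubspace_scaleR complex_vector.subspace_def)
  then have "complete (blinfun_apply T ` M)"
    using assms by (intro complete_isometric_image[of c] blinfun.bounded_linear_right)
      (auto simp: complete_eq_closed)
  then show ?thesis by (simp add: complete_eq_closed)
qed

lemma csubspace_vimage:
  "T \<in> bounded_ops \<Longrightarrow> csubspace M \<Longrightarrow> csubspace (blinfun_apply T -` M)"
  by (auto simp: complex_vector.subspace_def blinfun.bilinear_simps bounded_opsD)

lemma csubspace_image:
  assumes "T \<in> bounded_ops" "csubspace M"
  shows "csubspace (blinfun_apply T ` M)"
  unfolding complex_vector.subspace_def
proof (intro conjI ballI allI)
  show "0 \<in> blinfun_apply T ` M"
    using complex_vector.subspace_0[OF assms(2)] by (metis blinfun.zero_right imageI)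
qed (use assms complex_vector.subspace_add[OF assms(2)] complex_vector.subspace_scale[OF assms(2)]
    in \<open>auto simp flip: blinfun.add_right bounded_opsD\<close>)

text \<open>The range is the sum of the image of \<open>B\<^sup>\<bottom>\<close>, which is closed because \<open>T\<close> is bounded
  below there, and of the finite-dimensional image of the span of \<open>B\<close>.\<close>
lemma bounded_below_imp_closed_range:
  fixes T :: "'a :: complex_hilbert \<Rightarrow>\<^sub>L 'a"
  assumes T: "T \<in> bounded_ops" and B: "finite B" and c: "c > 0"
    and bb: "\<And>x. x \<in> orth B \<Longrightarrow> c * norm x \<le> norm (blinfun_apply T x)"
  shows "closed (range (blinfun_apply T))" and "cfinite_dim (null_space T)"
proof -
  let ?M = "blinfun_apply T ` orth B"
  have M: "csubspace ?M" "closed ?M"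
    using T c bb by (auto intro!: csubspace_image closed_image_if_bounded_below csubspace_orth closed_orth)
  let ?S = "cspan (?M \<union> blinfun_apply T ` B)"
  have "cspan B \<subseteq> blinfun_apply T -` ?S"
    using T by (intro complex_vector.span_minimal csubspace_vimage)
      (auto intro: complex_vector.span_base)
  then have "blinfun_apply T x \<in> ?S" for x
  proof -
    obtain p where p: "p \<in> cspan B" "x - p \<in> orth B" using orth_decomposition[OF B] by metis
    have "blinfun_apply T p + blinfun_apply T (x - p) \<in> ?S"
      using p \<open>cspan B \<subseteq> _\<close>
      by (intro complex_vector.span_add) (auto intro: complex_vector.span_base)
    then show ?thesis by (simp add: blinfun.diff_right)
  qed
  moreover have "?S \<subseteq> range (blinfun_apply T)"
    by (intro complex_vector.span_minimal csubspace_range T) auto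
  ultimately have "range (blinfun_apply T) = ?S" by blast
  then show "closed (range (blinfun_apply T))" using closed_cspan_Un[OF M] B by simp
  show "cfinite_dim (null_space T)"
  proof (rule cfinite_dim_if_disjoint_orth[OF csubspace_null_space[OF T] closed_null_space B])
    show "null_space T \<inter> orth B \<subseteq> {0}"
      using bb c by (force simp: null_space_def mult_le_0_iff)
  qed
qed

text \<open>The uniform boundedness principle, obtained from the Baire category theorem applied to the
  closed sets on which all functionals are bounded by \<open>n\<close>.\<close>
lemma uniform_boundedness:
  fixes Z :: "'a :: complex_hilbert set"
  assumes pw: "\<And>y. \<exists>C. \<forall>z\<in>Z. cmod (cinner y z) \<le> C"
  shows "\<exists>C>0. \<forall>z\<in>Z. norm z \<le> C"
proof -
  define F where "F n = {y. \<forall>z\<in>Z. cmod (cinner y z) \<le> real n}" for n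
  have "closed (F n)" for n
  proof -
    have F: "F n = (\<Inter>z\<in>Z. {y. cmod (cinner y z) \<le> real n})" by (auto simp: F_def)
    have "closed {y. cmod (cinner y z) \<le> real n}" for z
      by (intro closed_Collect_le continuous_intros cinner.continuous_on)
    then show ?thesis unfolding F by (intro closed_INT ballI)
  qed
  moreover have "\<Union>(range F) = UNIV"
  proof -
    have "\<exists>n. y \<in> F n" for y
    proof -
      obtain C where C: "\<forall>z\<in>Z. cmod (cinner y z) \<le> C" using pw by blast
      obtain n where "C \<le> real n" using real_arch_simple by blast
      then have "y \<in> F n" using C by (force simp: F_def)
      then show ?thesis ..
    qed
    then show ?thesis by auto
  qed
  ultimately have "\<exists>n. interior (F n) \<noteq> {}"
    using Baire_category_alt[of "euclidean :: 'a topology" "range F"]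
      completely_metrizable_space_euclidean by fastforce
  then obtain n y where "y \<in> interior (F n)" by blast
  then obtain r where r: "r > 0" "cball y r \<subseteq> F n"
    by (metis interior_subset open_contains_cball open_interior order_trans)
  have "norm z \<le> 2 * real n / r + 1" if z: "z \<in> Z" for z
  proof -
    define w where "w = (r / norm z) *\<^sub>R z"
    have "y + w \<in> F n" "y \<in> F n" using r by (auto simp: w_def dist_norm intro!: subsetD[OF r(2)])
    then have "cmod (cinner (y + w) z) \<le> n" "cmod (cinner y z) \<le> n" using z by (auto simp: F_def)
    then have "cmod (cinner w z) \<le> 2 * real n"
      using norm_triangle_ineq4[of "cinner (y + w) z" "cinner y z"] by (simp add: cinner_simps)
    moreover have "cmod (cinner w z) = r * norm z"
      using r(1) by (cases "z = 0")
        (simp_all add: w_def cinner_simps cinner_self norm_power norm_mult power2_eq_square)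
    ultimately have "norm z \<le> 2 * real n / r" using r(1) by (simp add: field_simps)
    then show ?thesis by simp
  qed
  moreover have "2 * real n / r + 1 > 0" using r(1) by (simp add: add_nonneg_pos)
  ultimately show ?thesis by blast
qed

text \<open>The vectors \<open>z\<close> of the range with \<open>\<parallel>T\<^sup>* z\<parallel> \<le> 1\<close> are weakly bounded, because \<open>\<langle>T x, z\<rangle> =
  \<langle>x, T\<^sup>* z\<rangle>\<close> and the range is closed; hence they are bounded, which makes \<open>T\<^sup>*\<close> bounded below on the
  range.  Then \<open>T\<^sup>*\<close> maps the range onto \<open>N(T)\<^sup>\<bottom>\<close>, and \<open>\<parallel>x\<parallel>\<^sup>2 = \<langle>T x, z\<rangle>\<close> for \<open>x = T\<^sup>* z\<close> transfers
  the bound to \<open>T\<close>.\<close>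
lemma closed_range_imp_bounded_below:
  fixes T :: "'a :: complex_hilbert \<Rightarrow>\<^sub>L 'a"
  assumes T: "T \<in> bounded_ops" and closed: "closed (range (blinfun_apply T))"
  shows "\<exists>c>0. \<forall>x\<in>orth (null_space T). c * norm x \<le> norm (blinfun_apply T x)"
proof -
  let ?R = "range (blinfun_apply T)" and ?A = "blinfun_apply (adjoint_op T)"
  have adj: "adjoint_op T \<in> bounded_ops" using adjoint_bounded_op[OF T] .
  define Z where "Z = {z \<in> ?R. norm (?A z) \<le> 1}"
  have "\<exists>C. \<forall>z\<in>Z. cmod (cinner y z) \<le> C" for y
  proof -
    obtain x where x: "y - blinfun_apply T x \<in> orth ?R"
      using projection_exists[OF csubspace_range[OF T] closed] by blast
    have "cmod (cinner y z) \<le> norm x" if z: "z \<in> Z" for z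
    proof -
      have "cinner y z = cinner (blinfun_apply T x) z"
        using x z by (auto simp: orth_def Z_def cinner.diff_left)
      also have "\<dots> = cinner x (?A z)" by (rule cinner_adjoint[OF T])
      also have "cmod \<dots> \<le> norm x * norm (?A z)" by (rule Cauchy_Schwarz)
      also have "\<dots> \<le> norm x * 1" using z by (intro mult_left_mono) (auto simp: Z_def)
      finally show ?thesis by simp
    qed
    then show ?thesis by blast
  qed
  then have "\<exists>C>0. \<forall>z\<in>Z. norm z \<le> C" by (rule uniform_boundedness)
  then obtain C where C: "C > 0" "\<And>z. z \<in> Z \<Longrightarrow> norm z \<le> C" by auto
  have R_scale: "r *\<^sub>R z \<in> ?R" if "z \<in> ?R" for r z
    using csubspace_scaleR[OF csubspace_range[OF T] that] .
  have lower: "norm z \<le> C * norm (?A z)" if z: "z \<in> ?R" for z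
  proof (cases "?A z = 0")
    case True
    have "z = 0"
    proof (rule ccontr)
      assume "z \<noteq> 0"
      have "((C + 1) / norm z) *\<^sub>R z \<in> Z"
        using R_scale[OF z] True by (simp add: Z_def blinfun.scaleR_right)
      from C(2)[OF this] show False using \<open>z \<noteq> 0\<close> C(1) by simp
    qed
    then show ?thesis using True by simp
  next
    case False
    then have "norm (?A ((1 / norm (?A z)) *\<^sub>R z)) \<le> 1" by (simp add: blinfun.scaleR_right)
    then have "(1 / norm (?A z)) *\<^sub>R z \<in> Z"
      unfolding Z_def using R_scale[OF z] by blast
    from C(2)[OF this] show ?thesis using False by (simp add: field_simps)
  qed
  have clA: "closed (?A ` ?R)"
    using lower C(1)
    by (intro closed_image_if_bounded_below[OF csubspace_range[OF T] closed, of "1 / C"])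
      (auto simp: field_simps)
  have "(1 / C) * norm x \<le> norm (blinfun_apply T x)" if x: "x \<in> orth (null_space T)" for x
  proof -
    obtain p where p: "p \<in> ?A ` ?R" "x - p \<in> orth (?A ` ?R)"
      using projection_exists[OF csubspace_image[OF adj csubspace_range[OF T]] clA] by blast
    have "blinfun_apply T (x - p) \<in> orth ?R"
      using p(2) adjoint_mem_orth[OF T] by blast
    then have "x - p \<in> null_space T" using orth_disjoint[of _ ?R] by (auto simp: null_space_def)
    moreover have "p \<in> orth (null_space T)"
      using p(1) by (auto simp: orth_def null_space_def cinner_adjoint'[OF T])
    then have "x - p \<in> orth (null_space T)"
      using x complex_vector.subspace_diff[OF csubspace_orth] by blast
    ultimately have "x = p" using orth_disjoint by fastforce
    then obtain z where z: "z \<in> ?R" "x = ?A z" using p(1) by blast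
    have "(norm x)\<^sup>2 = Re (cinner (blinfun_apply T x) z)"
      unfolding cinner_adjoint[OF T] z(2)[symmetric] by (rule Re_cinner_self[symmetric])
    also have "\<dots> \<le> norm (blinfun_apply T x) * norm z"
      using Cauchy_Schwarz complex_Re_le_cmod order_trans by blast
    also have "\<dots> \<le> norm (blinfun_apply T x) * (C * norm x)"
      using lower[OF z(1)] unfolding z(2)[symmetric] by (intro mult_left_mono) auto
    finally show ?thesis
      using C(1) by (cases "x = 0") (simp_all add: power2_eq_square field_simps)
  qed
  then show ?thesis using C(1) by (intro exI[of _ "1 / C"]) auto
qed

text \<open>The half of the Fredholm property that concerns \<open>A\<close> alone, without its adjoint.\<close>
definition ess_bounded_below :: "('a :: complex_hilbert \<Rightarrow>\<^sub>L 'a) \<Rightarrow> bool" where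
  "ess_bounded_below A \<longleftrightarrow>
    (\<exists>c>0. \<exists>B. finite B \<and> (\<forall>x\<in>orth B. c * norm x \<le> norm (blinfun_apply A x)))"

lemma closed_range_imp_ess_bounded_below:
  assumes "A \<in> bounded_ops" "closed (range (blinfun_apply A))" "cfinite_dim (null_space A)"
  shows "ess_bounded_below A"
proof -
  obtain B where B: "finite B" "cspan B = null_space A" using assms(3) by (auto simp: cfinite_dim_def)
  then show ?thesis
    using closed_range_imp_bounded_below[OF assms(1,2)]
    by (auto simp: ess_bounded_below_def orth_cspan simp flip: B(2))
qed

lemma ess_bounded_below_imp_closed_range:
  assumes "A \<in> bounded_ops" "ess_bounded_below A"
  shows "closed (range (blinfun_apply A))" "cfinite_dim (null_space A)"
  using assms bounded_below_imp_closed_range[OF assms(1)] unfolding ess_bounded_below_def by blast+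

lemma fredholm_iff:
  assumes "A \<in> bounded_ops"
  shows "fredholm A \<longleftrightarrow> ess_bounded_below A \<and> cfinite_dim (null_space (adjoint_op A))"
  using assms ess_bounded_below_imp_closed_range closed_range_imp_ess_bounded_below
  unfolding fredholm_def by blast

section \<open>Essentially isometric operators\<close>

text \<open>The pivot of all the equivalences.  For \<open>s = 0\<close> this is essential smallness.\<close>
definition ess_isometric :: "real \<Rightarrow> ('a :: complex_hilbert \<Rightarrow>\<^sub>L 'a) \<Rightarrow> bool" where
  "ess_isometric s T \<longleftrightarrow> (\<forall>e>0. \<exists>B. finite B \<and>
     (\<forall>x\<in>orth B. \<bar>norm (blinfun_apply T x) - s * norm x\<bar> \<le> e * norm x))"

text \<open>The numbers \<open>a\<close> and \<open>b\<close> are the lower and upper end of the part of the range of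
  \<open>\<parallel>T x\<parallel>\<close>, \<open>\<parallel>x\<parallel> = 1\<close>, that cannot be removed by passing to a subspace of finite codimension.\<close>
lemma essential_bounds:
  fixes T :: "'a :: complex_hilbert \<Rightarrow>\<^sub>L 'a"
  assumes inf: "\<not> cfinite_dim (UNIV :: 'a set)"
  obtains a b where "0 \<le> a" "a \<le> b"
    "\<And>e. e > 0 \<Longrightarrow> \<exists>B. finite B \<and> (\<forall>x\<in>orth B.
        (a - e) * norm x \<le> norm (blinfun_apply T x) \<and> norm (blinfun_apply T x) \<le> (b + e) * norm x)"
    "\<And>e B. e > 0 \<Longrightarrow> finite B \<Longrightarrow> \<exists>x\<in>orth B. norm x = 1 \<and> norm (blinfun_apply T x) \<le> a + e"
    "\<And>e B. e > 0 \<Longrightarrow> finite B \<Longrightarrow> \<exists>x\<in>orth B. norm x = 1 \<and> b - e \<le> norm (blinfun_apply T x)"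
proof -
  \<comment> \<open>\<open>L\<close> and \<open>U\<close> collect the lower and upper bounds that hold off some finite set.\<close>
  define L where "L = {r. \<exists>B. finite B \<and> (\<forall>x\<in>orth B. norm x = 1 \<longrightarrow> r \<le> norm (blinfun_apply T x))}"
  define U where "U = {r. \<exists>B. finite B \<and> (\<forall>x\<in>orth B. norm x = 1 \<longrightarrow> norm (blinfun_apply T x) \<le> r)}"
  have LU: "l \<le> r" if lr: "l \<in> L" "r \<in> U" for l r
  proof -
    obtain A where A: "finite A" "\<And>x. x \<in> orth A \<Longrightarrow> norm x = 1 \<Longrightarrow> l \<le> norm (blinfun_apply T x)"
      using lr(1) by (auto simp: L_def)
    obtain B where B: "finite B" "\<And>x. x \<in> orth B \<Longrightarrow> norm x = 1 \<Longrightarrow> norm (blinfun_apply T x) \<le> r"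
      using lr(2) by (auto simp: U_def)
    obtain x where "x \<in> orth (A \<union> B)" "norm x = 1"
      using unit_vector_orth_finite[OF inf, of "A \<union> B"] A B by auto
    then show ?thesis using A(2)[of x] B(2)[of x] by (simp add: orth_Un)
  qed
  have L0: "0 \<in> L" by (auto simp: L_def)
  have UT: "norm T \<in> U"
    unfolding U_def using norm_blinfun[of T] by (auto intro!: exI[of _ "{}"]) (metis mult.right_neutral)
  have bL: "bdd_above L" using LU UT by (auto simp: bdd_above_def)
  have bU: "bdd_below U" using LU L0 by (auto simp: bdd_below_def)
  show thesis
  proof (rule that)
    show "0 \<le> Sup L" using cSup_upper[OF L0 bL] .
    show "Sup L \<le> Inf U" using LU L0 UT by (intro cSup_least cInf_greatest) auto
  next
    fix e :: real assume e: "e > 0"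
    have "\<exists>l\<in>L. Sup L - e < l" using e L0 by (subst less_cSup_iff[symmetric]) (use bL in auto)
    then obtain l A where A: "Sup L - e < l" "finite A"
      "\<And>x. x \<in> orth A \<Longrightarrow> norm x = 1 \<Longrightarrow> l \<le> norm (blinfun_apply T x)"
      by (auto simp: L_def)
    have "\<exists>r\<in>U. r < Inf U + e" using e UT by (subst cInf_less_iff[symmetric]) (use bU in auto)
    then obtain r B where B: "r < Inf U + e" "finite B"
      "\<And>x. x \<in> orth B \<Longrightarrow> norm x = 1 \<Longrightarrow> norm (blinfun_apply T x) \<le> r"
      by (auto simp: U_def)
    have "(Sup L - e) * norm x \<le> norm (blinfun_apply T x) \<and> norm (blinfun_apply T x) \<le> (Inf U + e) * norm x"
      if x: "x \<in> orth (A \<union> B)" for x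
    proof (cases "x = 0")
      case False
      let ?u = "(1 / norm x) *\<^sub>R x"
      have "?u \<in> orth (A \<union> B)" "norm ?u = 1"
        using csubspace_scaleR[OF csubspace_orth x] False by simp_all
      then have "Sup L - e \<le> norm (blinfun_apply T ?u)" "norm (blinfun_apply T ?u) \<le> Inf U + e"
        using A(1) A(3)[of ?u] B(1) B(3)[of ?u] unfolding orth_Un by fastforce+
      then have "(Sup L - e) * norm x \<le> norm (blinfun_apply T ?u) * norm x"
        "norm (blinfun_apply T ?u) * norm x \<le> (Inf U + e) * norm x"
        by (simp_all only: mult_right_mono norm_ge_zero)
      moreover have "norm (blinfun_apply T ?u) * norm x = norm (blinfun_apply T x)"
        using False by (simp add: blinfun.scaleR_right)
      ultimately show ?thesis by simp
    qed (simp add: blinfun.zero_right)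
    then show "\<exists>B. finite B \<and> (\<forall>x\<in>orth B.
        (Sup L - e) * norm x \<le> norm (blinfun_apply T x) \<and> norm (blinfun_apply T x) \<le> (Inf U + e) * norm x)"
      using A(2) B(2) by (intro exI[of _ "A \<union> B"]) auto
  next
    fix e :: real and B :: "'a set" assume e: "e > 0" and B: "finite B"
    have "Sup L + e \<notin> L" using e cSup_upper[OF _ bL] by fastforce
    then have "\<not> (\<forall>x\<in>orth B. norm x = 1 \<longrightarrow> Sup L + e \<le> norm (blinfun_apply T x))"
      using B by (auto simp: L_def)
    then show "\<exists>x\<in>orth B. norm x = 1 \<and> norm (blinfun_apply T x) \<le> Sup L + e"
      by (auto simp: not_le intro: less_imp_le)
    have "Inf U - e \<notin> U" using e cInf_lower[OF _ bU] by fastforce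
    then have "\<not> (\<forall>x\<in>orth B. norm x = 1 \<longrightarrow> norm (blinfun_apply T x) \<le> Inf U - e)"
      using B by (auto simp: U_def)
    then show "\<exists>x\<in>orth B. norm x = 1 \<and> Inf U - e \<le> norm (blinfun_apply T x)"
      by (auto simp: not_le intro: less_imp_le)
  qed
qed

lemma ess_isometric_if_equal_bounds:
  fixes T :: "'a :: complex_hilbert \<Rightarrow>\<^sub>L 'a"
  assumes "\<And>e. e > 0 \<Longrightarrow> \<exists>B. finite B \<and> (\<forall>x\<in>orth B.
        (a - e) * norm x \<le> norm (blinfun_apply T x) \<and> norm (blinfun_apply T x) \<le> (a + e) * norm x)"
  shows "ess_isometric a T"
  unfolding ess_isometric_def
proof (intro allI impI)
  fix e :: real assume "e > 0"
  then obtain B where B: "finite B" "\<forall>x\<in>orth B.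
      (a - e) * norm x \<le> norm (blinfun_apply T x) \<and> norm (blinfun_apply T x) \<le> (a + e) * norm x"
    using assms by metis
  then show "\<exists>B. finite B \<and> (\<forall>x\<in>orth B. \<bar>norm (blinfun_apply T x) - a * norm x\<bar> \<le> e * norm x)"
    by (intro exI[of _ B]) (auto simp: abs_le_iff algebra_simps)
qed


section \<open>Limits of absolutely norm attaining operators\<close>

lemma csubspace_closure: "csubspace S \<Longrightarrow> csubspace (closure S)"
  for S :: "'a :: complex_normed_vector set"
  unfolding complex_vector.subspace_def
proof (intro conjI ballI allI; (elim conjE)?)
  assume *: "0 \<in> S" "\<forall>x\<in>S. \<forall>y\<in>S. x + y \<in> S" "\<forall>c. \<forall>x\<in>S. c *\<^sub>C x \<in> S"
  show "0 \<in> closure S" using *(1) closure_subset by blast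
  show "x + y \<in> closure S" if xy: "x \<in> closure S" "y \<in> closure S" for x y
  proof -
    obtain f g where "\<And>n. f n \<in> S" "f \<longlonglongrightarrow> x" "\<And>n. g n \<in> S" "g \<longlonglongrightarrow> y"
      using xy unfolding closure_sequential by metis
    then show ?thesis
      unfolding closure_sequential using *(2)
      by (intro exI[of _ "\<lambda>n. f n + g n"]) (auto intro: tendsto_add)
  qed
  show "c *\<^sub>C x \<in> closure S" if x: "x \<in> closure S" for c x
  proof -
    obtain f where "\<And>n. f n \<in> S" "f \<longlonglongrightarrow> x"
      using x unfolding closure_sequential by metis
    then show ?thesis
      unfolding closure_sequential using *(3)
      by (intro exI[of _ "\<lambda>n. c *\<^sub>C f n"])
        (auto intro: bounded_linear.tendsto[OF bounded_linear_scaleC_right])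
  qed
qed

lemma orth_closure: "orth (closure S) = orth S"
proof
  show "orth (closure S) \<subseteq> orth S" using closure_subset by (auto simp: orth_def)
  show "orth S \<subseteq> orth (closure S)"
  proof
    fix z assume z: "z \<in> orth S"
    have "closed {y. cinner z y = 0}"
      by (intro closed_Collect_eq continuous_intros cinner.continuous_on)
    then have "closure S \<subseteq> {y. cinner z y = 0}"
      using z by (intro closure_minimal) (auto simp: orth_def)
    then show "z \<in> orth (closure S)" by (auto simp: orth_def)
  qed
qed

text \<open>The first-order condition for a minimum at \<open>t = 0\<close>.\<close>
lemma quadratic_nonneg_imp_linear_zero:
  fixes \<beta> \<gamma> :: real
  assumes "\<And>t. 0 \<le> 2 * t * \<beta> + t\<^sup>2 * \<gamma>"
  shows "\<beta> = 0"
proof -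
  define g where "g = \<bar>\<gamma>\<bar> + 1"
  have g: "g > 0" "\<gamma> \<le> g" by (auto simp: g_def)
  have "0 \<le> 2 * (- \<beta> / g) * \<beta> + (- \<beta> / g)\<^sup>2 * \<gamma>" by (rule assms)
  also have "\<dots> \<le> 2 * (- \<beta> / g) * \<beta> + (- \<beta> / g)\<^sup>2 * g"
    by (intro add_left_mono mult_left_mono g) auto
  also have "\<dots> = - (\<beta>\<^sup>2 / g)" using g by (simp add: power2_eq_square field_simps)
  finally have "\<beta>\<^sup>2 / g \<le> 0" by simp
  then show ?thesis using g(1) by (simp add: divide_le_0_iff)
qed

text \<open>Along a segment joining two unit vectors the ratio \<open>\<parallel>T w\<parallel> / \<parallel>w\<parallel>\<close> takes all intermediate
  values.\<close>
lemma intermediate_norm_attained: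
  fixes T :: "'a :: complex_hilbert \<Rightarrow>\<^sub>L 'a"
  assumes M: "csubspace M" and x: "x \<in> M" "norm x = 1" "norm (blinfun_apply T x) \<le> c"
    and y: "y \<in> M" "norm y = 1" "c \<le> norm (blinfun_apply T y)"
    and ne: "norm (blinfun_apply T x) < norm (blinfun_apply T y)"
  shows "\<exists>z\<in>M. norm z = 1 \<and> norm (blinfun_apply T z) = c"
proof -
  define w where "w t = (1 - t) *\<^sub>R x + t *\<^sub>R y" for t :: real
  define f where "f t = norm (blinfun_apply T (w t)) - c * norm (w t)" for t
  have "continuous_on {0..1} f" unfolding f_def w_def by (intro continuous_intros)
  moreover have "f 0 \<le> 0" "0 \<le> f 1" using x y by (auto simp: f_def w_def)
  ultimately obtain t where t: "0 \<le> t" "t \<le> 1" "f t = 0" using IVT'[of f 0 0 1] by auto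
  have w0: "w t \<noteq> 0"
  proof
    assume "w t = 0"
    then have eq: "(1 - t) *\<^sub>R x = - (t *\<^sub>R y)" by (simp add: w_def eq_neg_iff_add_eq_0)
    then have "norm ((1 - t) *\<^sub>R x) = norm (- (t *\<^sub>R y))" by (rule arg_cong)
    then have t2: "t = 1 / 2" using t x(2) y(2) by simp
    have "x = - y" using eq unfolding t2 by (simp flip: scaleR_minus_right)
    then show False using ne by (simp add: blinfun.minus_right)
  qed
  let ?z = "(1 / norm (w t)) *\<^sub>R w t"
  have "w t \<in> M"
    using M x(1) y(1) by (simp add: w_def csubspace_scaleR complex_vector.subspace_add)
  then have "?z \<in> M" by (rule csubspace_scaleR[OF M])
  moreover have "norm ?z = 1" using w0 by simp
  moreover have "norm (blinfun_apply T ?z) = c"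
    using t(3) w0 by (simp add: f_def blinfun.scaleR_right)
  ultimately show ?thesis by blast
qed

text \<open>If \<open>\<parallel>T x\<parallel>\<close> comes below \<open>u\<close> and above \<open>v > u\<close> on the unit spheres of all subspaces of finite
  codimension, one finds orthonormal \<open>x\<^sub>0, x\<^sub>1, \<dots>\<close> with orthogonal images such that
  \<open>\<parallel>T x\<^sub>n\<parallel>\<close> increases strictly to \<open>v\<close>.  On their closed span the norm of \<open>T\<close> is \<open>v\<close>, but it is not
  attained: \<open>T\<close> acts there like a diagonal operator all of whose entries are below \<open>v\<close>.\<close>
lemma essential_gap_not_AN:
  fixes T :: "'a :: complex_hilbert \<Rightarrow>\<^sub>L 'a"
  assumes uv: "u < v"
    and lo: "\<And>B. finite B \<Longrightarrow> \<exists>x\<in>orth B. norm x = 1 \<and> norm (blinfun_apply T x) \<le> u"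
    and hi: "\<And>B. finite B \<Longrightarrow> \<exists>x\<in>orth B. norm x = 1 \<and> v \<le> norm (blinfun_apply T x)"
  shows "T \<notin> AN_ops"
proof
  assume AN: "T \<in> AN_ops"
  then have T: "T \<in> bounded_ops" by (simp add: AN_ops_def)
  define c where "c n = v - (v - u) / real (Suc n)" for n
  have c: "u \<le> c n" "c n < v" for n
  proof -
    have "(v - u) / real (Suc n) \<le> (v - u) / 1" using uv by (intro divide_left_mono) auto
    then show "u \<le> c n" by (simp add: c_def)
    show "c n < v" using uv by (simp add: c_def)
  qed
  let ?TT = "\<lambda>z. blinfun_apply (adjoint_op T) (blinfun_apply T z)"
  have "\<exists>z. z \<in> orth B \<and> norm z = 1 \<and> norm (blinfun_apply T z) = c n" if B: "finite B" for B n
  proof -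
    obtain x where x: "x \<in> orth B" "norm x = 1" "norm (blinfun_apply T x) \<le> u" using lo[OF B] by blast
    obtain y where y: "y \<in> orth B" "norm y = 1" "v \<le> norm (blinfun_apply T y)" using hi[OF B] by blast
    show ?thesis
      using intermediate_norm_attained[OF csubspace_orth x(1,2) _ y(1,2), of T "c n"] x(3) y(3) c[of n] uv
      by auto
  qed
  then obtain X where X: "\<And>B n. finite B \<Longrightarrow>
      X B n \<in> orth B \<and> norm (X B n) = 1 \<and> norm (blinfun_apply T (X B n)) = c n" by metis
  \<comment> \<open>\<open>L n\<close> lists the vectors to which \<open>x\<^sub>n\<close> has to be orthogonal: all earlier \<open>x\<^sub>i\<close> and, so that
    the images become orthogonal as well, all \<open>T\<^sup>* T x\<^sub>i\<close>.\<close>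
  define L where "L = rec_nat {} (\<lambda>n B. B \<union> {X B n, ?TT (X B n)})"
  define x where "x n = X (L n) n" for n
  have L_Suc: "L (Suc n) = L n \<union> {x n, ?TT (x n)}" for n by (simp add: L_def x_def)
  have L_fin: "finite (L n)" for n
    by (induction n) (simp_all only: L_Suc, simp_all add: L_def)
  have L_mono: "L m \<subseteq> L n" if "m \<le> n" for m n
    using that by (rule lift_Suc_mono_le[rotated]) (auto simp: L_Suc)
  have x: "x n \<in> orth (L n)" "norm (x n) = 1" "norm (blinfun_apply T (x n)) = c n" for n
    using X[OF L_fin] by (auto simp: x_def)
  have lt: "cinner (x j) (x i) = 0 \<and> cinner (x j) (?TT (x i)) = 0" if "i < j" for i j
  proof -
    have "x i \<in> L j" "?TT (x i) \<in> L j" using L_mono[of "Suc i" j] that by (auto simp: L_Suc)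
    then show ?thesis using x(1)[of j] by (auto simp: orth_def)
  qed
  have ortho: "cinner (x j) (x i) = 0" "cinner (x j) (?TT (x i)) = 0" if "i \<noteq> j" for i j
  proof -
    have TT: "cinner (x j) (?TT (x i)) = 0" if "cinner (x i) (?TT (x j)) = 0"
      using that cinner_eq_0_commute by (metis cinner_adjoint[OF T])
    show "cinner (x j) (x i) = 0" "cinner (x j) (?TT (x i)) = 0"
      using \<open>i \<noteq> j\<close> lt[of i j] lt[of j i] TT cinner_eq_0_commute by (metis nat_neq_iff)+
  qed
  have bound_span: "norm (blinfun_apply T y) \<le> v * norm y" if "y \<in> cspan (x ` {..<N})" for y N
    using that
  proof (induction N arbitrary: y)
    case 0
    then show ?case by (simp add: blinfun.zero_right)
  next
    case (Suc N)
    obtain k where k: "y - k *\<^sub>C x N \<in> cspan (x ` {..<N})"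
      using Suc.prems unfolding lessThan_Suc image_insert complex_vector.span_breakdown_eq by blast
    define w where "w = y - k *\<^sub>C x N"
    have "x N \<in> orth (x ` {..<N})" "?TT (x N) \<in> orth (x ` {..<N})"
      using ortho by (auto simp: orth_def cinner_eq_0_commute)
    then have "x N \<in> orth (cspan (x ` {..<N}))" "?TT (x N) \<in> orth (cspan (x ` {..<N}))"
      by (simp_all only: orth_cspan)
    then have w0: "cinner w (x N) = 0" "cinner w (?TT (x N)) = 0"
      using k cinner_eq_0_commute by (auto simp: orth_def w_def)
    then have "(norm (w + k *\<^sub>C x N))\<^sup>2 = (norm w)\<^sup>2 + (norm (k *\<^sub>C x N))\<^sup>2"
      by (intro norm_add_sq_orth) (simp add: cinner_simps)
    then have ny: "(norm y)\<^sup>2 = (norm w)\<^sup>2 + (cmod k)\<^sup>2" by (simp add: w_def norm_scaleC x(2))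
    have "(norm (blinfun_apply T w + k *\<^sub>C blinfun_apply T (x N)))\<^sup>2
        = (norm (blinfun_apply T w))\<^sup>2 + (norm (k *\<^sub>C blinfun_apply T (x N)))\<^sup>2"
      using w0 by (intro norm_add_sq_orth) (simp add: cinner_simps cinner_adjoint[OF T])
    then have nTy: "(norm (blinfun_apply T y))\<^sup>2 = (norm (blinfun_apply T w))\<^sup>2 + (cmod k)\<^sup>2 * (c N)\<^sup>2"
      by (simp add: w_def norm_scaleC x(3) blinfun.diff_right bounded_opsD[OF T] power_mult_distrib)
    have v0: "0 \<le> c N" "0 \<le> v" using c(2)[of N] norm_ge_zero[of "blinfun_apply T (x N)"] unfolding x(3) by simp_all
    have "norm (blinfun_apply T w) \<le> v * norm w" using Suc.IH k by (simp add: w_def)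
    then have "(norm (blinfun_apply T w))\<^sup>2 \<le> v\<^sup>2 * (norm w)\<^sup>2"
      using power_mono[of _ _ 2] by (fastforce simp: power_mult_distrib)
    moreover have "(cmod k)\<^sup>2 * (c N)\<^sup>2 \<le> v\<^sup>2 * (cmod k)\<^sup>2"
      using mult_left_mono[OF power_mono[OF less_imp_le[OF c(2)[of N]] v0(1), of 2], of "(cmod k)\<^sup>2"]
      by (simp add: mult.commute)
    ultimately have "(norm (blinfun_apply T y))\<^sup>2 \<le> (v * norm y)\<^sup>2"
      unfolding nTy power_mult_distrib ny by (simp add: distrib_left)
    then show ?case using v0 by - (rule power2_le_imp_le, auto)
  qed
  define M where "M = closure (cspan (range x))"
  have M: "csubspace M" "closed M" by (simp_all add: M_def csubspace_closure)
  have xM: "x n \<in> M" for n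
    unfolding M_def using closure_subset complex_vector.span_base by (metis rangeI subsetD)
  have bound: "norm (blinfun_apply T y) \<le> v * norm y" if "y \<in> M" for y
  proof -
    have "cspan (range x) \<subseteq> {y. norm (blinfun_apply T y) \<le> v * norm y}"
    proof
      fix y assume "y \<in> cspan (range x)"
      then obtain t r where t: "finite t" "t \<subseteq> range x" and "y = (\<Sum>a\<in>t. r a *\<^sub>C a)"
        unfolding complex_vector.span_explicit by blast
      then have yt: "y \<in> cspan t"
        by (simp add: complex_vector.span_sum complex_vector.span_scale complex_vector.span_base)
      then obtain I where I: "finite I" "t = x ` I"
        using finite_subset_image[OF t(1,2)] by auto
      then obtain N where "I \<subseteq> {..<N}" using finite_nat_bounded by blast
      then have "y \<in> cspan (x ` {..<N})"
        using yt I(2) complex_vector.span_mono[of t "x ` {..<N}"] by blast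
      then show "y \<in> {y. norm (blinfun_apply T y) \<le> v * norm y}" using bound_span by blast
    qed
    moreover have "closed {y. norm (blinfun_apply T y) \<le> v * norm y}"
      by (intro closed_Collect_le continuous_intros)
    ultimately show ?thesis using that closure_minimal unfolding M_def by blast
  qed
  \<comment> \<open>If \<open>\<parallel>T y\<parallel> = v \<parallel>y\<parallel>\<close>, then \<open>y\<close> minimises the nonnegative form \<open>v\<^sup>2 \<parallel>z\<parallel>\<^sup>2 - \<parallel>T z\<parallel>\<^sup>2\<close> on \<open>M\<close>.  Varying
    \<open>y\<close> in the direction of its component along \<open>x\<^sub>n\<close> gives \<open>(v\<^sup>2 - c\<^sub>n\<^sup>2) \<bar>\<langle>y, x\<^sub>n\<rangle>\<bar>\<^sup>2 = 0\<close>.\<close>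
  have not_attained: "y = 0" if y: "y \<in> M" "norm (blinfun_apply T y) = v * norm y" for y
  proof -
    have "cinner y (x n) = 0" for n
    proof -
      define k where "k = cinner y (x n)"
      define z where "z = k *\<^sub>C x n"
      have zM: "z \<in> M" using M(1) xM by (simp add: z_def complex_vector.subspace_scale)
      have cTT: "cinner (x n) (?TT (x n)) = complex_of_real ((c n)\<^sup>2)"
        by (simp flip: cinner_adjoint[OF T] add: cinner_self x(3))
      have "?TT (x n) - (c n)\<^sup>2 *\<^sub>R x n \<in> orth (range x)"
      proof -
        have "cinner (x m) (?TT (x n) - (c n)\<^sup>2 *\<^sub>R x n) = 0" for m
        proof (cases "m = n")
          case True
          show ?thesis unfolding True cinner.diff_right cinner_scaleR_right cTT
            by (simp add: cinner_self x(2) scaleR_conv_of_real)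
        next
          case False
          then show ?thesis using ortho[of n m] by (simp add: cinner_simps)
        qed
        then show ?thesis by (subst orth_def) (simp add: cinner_eq_0_commute[of "_ - _"])
      qed
      then have "?TT (x n) - (c n)\<^sup>2 *\<^sub>R x n \<in> orth M" by (simp only: M_def orth_closure orth_cspan)
      then have "cinner y (?TT (x n) - (c n)\<^sup>2 *\<^sub>R x n) = 0"
        using y(1) by (subst cinner_eq_0_commute) (simp add: orth_def)
      then have Ty: "cinner (blinfun_apply T y) (blinfun_apply T (x n)) = (c n)\<^sup>2 *\<^sub>R k"
        by (simp add: cinner_adjoint[OF T] cinner_simps k_def)
      have kk: "Re (cnj k * k) = (cmod k)\<^sup>2" using Re_cnj_div_mult[of k 1] by simp
      have Rez: "Re (cinner y z) = (cmod k)\<^sup>2"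
        unfolding z_def cinner_scaleC_right k_def[symmetric] by (rule kk)
      have ReTz: "Re (cinner (blinfun_apply T y) (blinfun_apply T z)) = (c n)\<^sup>2 * (cmod k)\<^sup>2"
        unfolding z_def bounded_opsD[OF T] cinner_scaleC_right Ty kk[symmetric]
        by (simp add: algebra_simps)
      have "v\<^sup>2 * (cmod k)\<^sup>2 - (c n)\<^sup>2 * (cmod k)\<^sup>2 = 0"
      proof (rule quadratic_nonneg_imp_linear_zero)
        fix t :: real
        have "y + t *\<^sub>R z \<in> M"
          using M(1) y(1) zM by (simp add: csubspace_scaleR complex_vector.subspace_add)
        then have "norm (blinfun_apply T y + t *\<^sub>R blinfun_apply T z) \<le> v * norm (y + t *\<^sub>R z)"
          using bound[of "y + t *\<^sub>R z"] by (simp add: blinfun.bilinear_simps)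
        then have "(norm (blinfun_apply T y + t *\<^sub>R blinfun_apply T z))\<^sup>2 \<le> v\<^sup>2 * (norm (y + t *\<^sub>R z))\<^sup>2"
          using power_mono[of _ _ 2] by (fastforce simp: power_mult_distrib)
        then show "0 \<le> 2 * t * (v\<^sup>2 * (cmod k)\<^sup>2 - (c n)\<^sup>2 * (cmod k)\<^sup>2)
            + t\<^sup>2 * (v\<^sup>2 * (norm z)\<^sup>2 - (norm (blinfun_apply T z))\<^sup>2)"
          unfolding norm_add_sq cinner_scaleR_right y(2)
          by (simp add: Rez ReTz power_mult_distrib algebra_simps)
      qed
      then have "(v\<^sup>2 - (c n)\<^sup>2) * (cmod k)\<^sup>2 = 0" by (simp add: left_diff_distrib)
      moreover have "(c n)\<^sup>2 < v\<^sup>2"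
        using c(2)[of n] norm_ge_zero[of "blinfun_apply T (x n)"] unfolding x(3)
        by (rule power_strict_mono) simp
      ultimately show ?thesis by (simp add: k_def)
    qed
    then have "y \<in> orth (range x)" by (auto simp: orth_def)
    then have "y \<in> orth M" by (simp only: M_def orth_closure orth_cspan)
    then show ?thesis using y(1) orth_disjoint by blast
  qed
  have "M \<noteq> {0}" using xM[of 0] x(2)[of 0] by auto
  then obtain y where y: "y \<in> M" "norm y = 1" "norm (blinfun_apply T y) = restriction_norm T M"
    using AN M by (auto simp: AN_ops_def)
  have "c n \<le> norm (blinfun_apply T y)" for n
  proof -
    have "bdd_above ((\<lambda>x. norm (blinfun_apply T x)) ` {x \<in> M. norm x \<le> 1})"
    proof (rule bdd_aboveI2[of _ _ "norm T"])
      show "norm (blinfun_apply T x) \<le> norm T" if "x \<in> {x \<in> M. norm x \<le> 1}" for x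
        using norm_blinfun[of T x] mult_left_mono[of "norm x" 1 "norm T"] that by simp
    qed
    then have "norm (blinfun_apply T (x n)) \<le> restriction_norm T M"
      unfolding restriction_norm_def using xM x(2) by (intro cSUP_upper) auto
    then show ?thesis by (simp only: x(3) y(3))
  qed
  moreover have "c \<longlonglongrightarrow> v"
  proof -
    have "(\<lambda>n. v - (v - u) * inverse (real (Suc n))) \<longlonglongrightarrow> v - (v - u) * 0"
      by (intro tendsto_intros LIMSEQ_inverse_real_of_nat)
    then show ?thesis by (simp add: c_def[abs_def] divide_inverse)
  qed
  ultimately have "v \<le> norm (blinfun_apply T y)" by (intro LIMSEQ_le_const2) auto
  then have "norm (blinfun_apply T y) = v * norm y" using bound[OF y(1)] y(2) by simp
  then show False using not_attained[OF y(1)] y(2) by simp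
qed

text \<open>A gap between the two essential bounds of \<open>T\<close> survives small perturbations of \<open>T\<close>.\<close>
lemma closure_AN_imp_ess_isometric:
  fixes T :: "'a :: complex_hilbert \<Rightarrow>\<^sub>L 'a"
  assumes inf: "\<not> cfinite_dim (UNIV :: 'a set)" and T: "T \<in> closure AN_ops"
  shows "\<exists>s\<ge>0. ess_isometric s T"
proof -
  obtain a b where ab: "0 \<le> a" "a \<le> b"
    "\<And>e. e > 0 \<Longrightarrow> \<exists>B. finite B \<and> (\<forall>x\<in>orth B.
        (a - e) * norm x \<le> norm (blinfun_apply T x) \<and> norm (blinfun_apply T x) \<le> (b + e) * norm x)"
    "\<And>e B. e > 0 \<Longrightarrow> finite B \<Longrightarrow> \<exists>x\<in>orth B. norm x = 1 \<and> norm (blinfun_apply T x) \<le> a + e"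
    "\<And>e B. e > 0 \<Longrightarrow> finite B \<Longrightarrow> \<exists>x\<in>orth B. norm x = 1 \<and> b - e \<le> norm (blinfun_apply T x)"
    by (rule essential_bounds[OF inf, of T]) (rule that)
  have "a = b"
  proof (rule ccontr)
    assume "a \<noteq> b"
    \<comment> \<open>Each end gives up one \<open>d\<close> to the approximation in the bounds and one to the distance of
      \<open>S\<close> from \<open>T\<close>, which leaves a gap of length \<open>d\<close>.\<close>
    define d where "d = (b - a) / 5"
    have d: "d > 0" using ab(2) \<open>a \<noteq> b\<close> by (simp add: d_def)
    obtain S where S: "S \<in> AN_ops" "dist S T < d" using T d unfolding closure_approachable by blast
    have near: "\<bar>norm (blinfun_apply S x) - norm (blinfun_apply T x)\<bar> \<le> d" if "norm x = 1" for x
    proof -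
      have "norm (blinfun_apply (S - T) x) \<le> d"
        using norm_blinfun[of "S - T" x] S(2) that by (simp add: dist_norm)
      then show ?thesis
        using norm_triangle_ineq3[of "blinfun_apply S x" "blinfun_apply T x"]
        by (simp add: blinfun.diff_left)
    qed
    have "S \<notin> AN_ops"
    proof (rule essential_gap_not_AN[of "a + 2 * d" "b - 2 * d"])
      show "a + 2 * d < b - 2 * d" using d unfolding d_def by (simp add: field_simps)
      fix B :: "'a set" assume B: "finite B"
      obtain x where "x \<in> orth B" "norm x = 1" "norm (blinfun_apply T x) \<le> a + d"
        using ab(4)[OF d B] by blast
      then show "\<exists>x\<in>orth B. norm x = 1 \<and> norm (blinfun_apply S x) \<le> a + 2 * d"
        using near[of x] by (intro bexI[of _ x]) auto
      obtain y where "y \<in> orth B" "norm y = 1" "b - d \<le> norm (blinfun_apply T y)"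
        using ab(5)[OF d B] by blast
      then show "\<exists>x\<in>orth B. norm x = 1 \<and> b - 2 * d \<le> norm (blinfun_apply S x)"
        using near[of y] by (intro bexI[of _ y]) auto
    qed
    then show False using S(1) by contradiction
  qed
  then have "ess_isometric a T" using ab(3) by (intro ess_isometric_if_equal_bounds) simp
  then show ?thesis using ab(1) by blast
qed

text \<open>Split a closed subspace \<open>M\<close> orthogonally into \<open>M \<inter> B\<^sup>\<bottom>\<close>, where \<open>T\<close> is a multiple of an
  isometry with image orthogonal to the image of the rest, and a finite-dimensional part, where
  compactness yields a maximum.\<close>
lemma AN_if_isometric_off_finite:
  fixes T :: "'a :: complex_hilbert \<Rightarrow>\<^sub>L 'a"
  assumes T: "T \<in> bounded_ops" and B: "finite B" and \<alpha>: "\<alpha> \<ge> 0"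
    and iso: "\<And>x y. x \<in> orth B \<Longrightarrow> cinner (blinfun_apply T x) (blinfun_apply T y) = \<alpha> *\<^sub>R cinner x y"
  shows "T \<in> AN_ops"
  unfolding AN_ops_def
proof (intro CollectI conjI allI impI T, elim conjE)
  fix M :: "'a set" assume M: "csubspace M" "closed M" "M \<noteq> {0}"
  obtain F where F: "finite F" "F \<subseteq> M"
    "\<forall>x\<in>M. \<exists>p\<in>cspan F. x - p \<in> M \<and> x - p \<in> orth B \<and> x - p \<in> orth (cspan F)"
    using finite_codim_decomposition[OF M(1,2) B] by blast
  have FM: "cspan F \<subseteq> M" using F(2) M(1) complex_vector.span_minimal by blast
  have nT: "norm (blinfun_apply T x) = sqrt \<alpha> * norm x" if "x \<in> orth B" for x
  proof -
    have "(norm (blinfun_apply T x))\<^sup>2 = \<alpha> * (norm x)\<^sup>2"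
      using iso[OF that, of x] by (simp flip: Re_cinner_self)
    then have "norm (blinfun_apply T x) = sqrt (\<alpha> * (norm x)\<^sup>2)" by (metis norm_ge_zero real_sqrt_unique)
    then show ?thesis by (simp add: real_sqrt_mult)
  qed
  define C0 where "C0 = {x \<in> cspan F. norm x = 1}"
  have C0: "compact C0"
  proof -
    have "C0 = (cspan F \<inter> cball 0 1) \<inter> {x. norm x = 1}" by (auto simp: C0_def)
    moreover have "closed {x :: 'a. norm x = 1}" by (intro closed_Collect_eq continuous_intros)
    ultimately show ?thesis using compact_ball_cspan_finite[OF F(1)] by (metis compact_Int_closed)
  qed
  \<comment> \<open>One unit vector of \<open>M \<inter> B\<^sup>\<bottom>\<close>, if there is any, represents that part.\<close>
  obtain N where N: "finite N" "N \<subseteq> {x \<in> M \<inter> orth B. norm x = 1}"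
    "\<And>x. x \<in> M \<Longrightarrow> x \<in> orth B \<Longrightarrow> x \<noteq> 0 \<Longrightarrow> N \<noteq> {}"
  proof (cases "\<exists>x \<in> M \<inter> orth B. norm x = 1")
    case True
    then obtain n where "n \<in> M \<inter> orth B" "norm n = 1" by blast
    then show ?thesis using that[of "{n}"] by simp
  next
    case False
    have "x = 0" if "x \<in> M" "x \<in> orth B" for x
    proof (rule ccontr)
      assume "x \<noteq> 0"
      then have "norm ((1 / norm x) *\<^sub>R x) = 1" by simp
      moreover have "(1 / norm x) *\<^sub>R x \<in> M \<inter> orth B"
        using that M(1) csubspace_orth by (blast intro: csubspace_scaleR)
      ultimately show False using False by blast
    qed
    then show ?thesis using that[of "{}"] by blast
  qed
  have "C0 \<union> N \<noteq> {}"
  proof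
    assume e: "C0 \<union> N = {}"
    obtain x where x: "x \<in> M" "x \<noteq> 0" using M complex_vector.subspace_0[OF M(1)] by auto
    obtain p where p: "p \<in> cspan F" "x - p \<in> M" "x - p \<in> orth B" using F(3) x by blast
    have "x - p = 0" using N(3)[OF p(2,3)] e by blast
    then have "(1 / norm x) *\<^sub>R x \<in> cspan F"
      using p(1) csubspace_scaleR[OF complex_vector.subspace_span] by simp
    moreover have "norm ((1 / norm x) *\<^sub>R x) = 1" using x(2) by simp
    ultimately show False using e by (auto simp: C0_def)
  qed
  moreover have "compact (C0 \<union> N)" using compact_Un[OF C0 finite_imp_compact[OF N(1)]] .
  moreover have "continuous_on (C0 \<union> N) (\<lambda>x. norm (blinfun_apply T x))" by (intro continuous_intros)
  ultimately obtain m where m: "m \<in> C0 \<union> N" "\<And>x. x \<in> C0 \<union> N \<Longrightarrow> norm (blinfun_apply T x) \<le> norm (blinfun_apply T m)"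
    using continuous_attains_sup by metis
  define \<mu> where "\<mu> = norm (blinfun_apply T m)"
  have mM: "m \<in> M" "norm m = 1" using m(1) N(2) FM by (auto simp: C0_def)
  have bound: "norm (blinfun_apply T x) \<le> \<mu> * norm x" if x: "x \<in> M" for x
  proof -
    obtain p where p: "p \<in> cspan F" "x - p \<in> M" "x - p \<in> orth B" "x - p \<in> orth (cspan F)"
      using F(3) x by blast
    define n where "n = x - p"
    have 1: "norm (blinfun_apply T p) \<le> \<mu> * norm p"
    proof (cases "p = 0")
      case False
      have "(1 / norm p) *\<^sub>R p \<in> C0"
        using False csubspace_scaleR[OF complex_vector.subspace_span p(1)] by (simp add: C0_def)
      then show ?thesis using m(2) norm_bound_from_unit unfolding \<mu>_def by blast
    qed (simp add: blinfun.zero_right)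
    have 2: "norm (blinfun_apply T n) \<le> \<mu> * norm n"
    proof (cases "n = 0")
      case False
      then have "N \<noteq> {}" using N(3)[of n] p(2,3) by (simp add: n_def)
      then obtain k where k: "k \<in> N" by blast
      then have "sqrt \<alpha> \<le> \<mu>" using m(2)[of k] nT[of k] N(2) by (auto simp: \<mu>_def)
      then show ?thesis using nT[of n] p(3) by (simp add: n_def mult_right_mono)
    qed (simp add: blinfun.zero_right)
    have ort: "cinner n p = 0" using p(1,4) by (simp add: n_def orth_def)
    then have "(norm x)\<^sup>2 = (norm n)\<^sup>2 + (norm p)\<^sup>2" using norm_add_sq_orth[OF ort] by (simp add: n_def)
    moreover have "(norm (blinfun_apply T x))\<^sup>2 = (norm (blinfun_apply T n))\<^sup>2 + (norm (blinfun_apply T p))\<^sup>2"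
    proof -
      have "cinner (blinfun_apply T n) (blinfun_apply T p) = 0" using iso[of n p] p(3) ort by (simp add: n_def)
      from norm_add_sq_orth[OF this] show ?thesis by (simp add: n_def blinfun.diff_right)
    qed
    moreover have "(norm (blinfun_apply T n))\<^sup>2 \<le> (\<mu> * norm n)\<^sup>2" "(norm (blinfun_apply T p))\<^sup>2 \<le> (\<mu> * norm p)\<^sup>2"
      using 1 2 by (auto intro: power_mono)
    ultimately have "(norm (blinfun_apply T x))\<^sup>2 \<le> (\<mu> * norm x)\<^sup>2"
      by (simp add: power_mult_distrib distrib_left)
    then show ?thesis by (rule power2_le_imp_le) (simp add: \<mu>_def)
  qed
  have "restriction_norm T M = \<mu>"
    unfolding restriction_norm_def
  proof (rule cSup_eq_maximum)
    show "\<mu> \<in> (\<lambda>x. norm (blinfun_apply T x)) ` {x \<in> M. norm x \<le> 1}" using mM by (auto simp: \<mu>_def)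
    fix r assume "r \<in> (\<lambda>x. norm (blinfun_apply T x)) ` {x \<in> M. norm x \<le> 1}"
    then obtain x where x: "x \<in> M" "norm x \<le> 1" "r = norm (blinfun_apply T x)" by blast
    have "\<mu> * norm x \<le> \<mu> * 1" using x(2) by (intro mult_left_mono) (auto simp: \<mu>_def)
    then show "r \<le> \<mu>" using bound[OF x(1)] x(3) by simp
  qed
  then show "\<exists>x\<in>M. norm x = 1 \<and> norm (blinfun_apply T x) = restriction_norm T M"
    using mM by (auto simp: \<mu>_def)
qed

section \<open>The defect operator\<close>

text \<open>Self-adjointness without reference to the adjoint: in this form it is visibly preserved by
  sums and limits, and it serves as a rewrite rule.\<close>
definition symmetric_op :: "('a :: complex_hilbert \<Rightarrow>\<^sub>L 'a) \<Rightarrow> bool" where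
  "symmetric_op A \<longleftrightarrow>
    (\<forall>x y. cinner (blinfun_apply A x) y = cinner x (blinfun_apply A y))"

lemma symmetric_opD:
  "symmetric_op A \<Longrightarrow> cinner (blinfun_apply A x) y = cinner x (blinfun_apply A y)"
  by (simp add: symmetric_op_def)

text \<open>Its quadratic form \<open>\<alpha> \<parallel>x\<parallel>\<^sup>2 - \<parallel>T x\<parallel>\<^sup>2\<close> measures how far \<open>T\<close> is from \<open>\<surd>\<alpha>\<close> times an isometry.\<close>
definition defect_op :: "real \<Rightarrow> ('a :: complex_hilbert \<Rightarrow>\<^sub>L 'a) \<Rightarrow> ('a \<Rightarrow>\<^sub>L 'a)" where
  "defect_op \<alpha> T = \<alpha> *\<^sub>R id_blinfun - (adjoint_op T o\<^sub>L T)"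

lemma defect_bounded_op: "T \<in> bounded_ops \<Longrightarrow> defect_op \<alpha> T \<in> bounded_ops"
  by (simp add: defect_op_def bounded_ops_diff bounded_ops_scaleR bounded_ops_id
      bounded_ops_compose adjoint_bounded_op)

lemma blinfun_apply_defect_op:
  "blinfun_apply (defect_op \<alpha> T) x = \<alpha> *\<^sub>R x - blinfun_apply (adjoint_op T) (blinfun_apply T x)"
  by (simp add: defect_op_def blinfun.bilinear_simps)

lemma cinner_defect_op:
  "T \<in> bounded_ops \<Longrightarrow> cinner (blinfun_apply (defect_op \<alpha> T) x) y
    = \<alpha> *\<^sub>R cinner x y - cinner (blinfun_apply T x) (blinfun_apply T y)"
  by (simp add: blinfun_apply_defect_op cinner_simps cinner_adjoint')

lemma symmetric_defect_op: "T \<in> bounded_ops \<Longrightarrow> symmetric_op (defect_op \<alpha> T)"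
  unfolding symmetric_op_def
  by (simp add: blinfun_apply_defect_op cinner_simps cinner_adjoint cinner_adjoint')

lemma Re_cinner_defect_op:
  "T \<in> bounded_ops \<Longrightarrow> Re (cinner (blinfun_apply (defect_op \<alpha> T) x) x)
    = \<alpha> * (norm x)\<^sup>2 - (norm (blinfun_apply T x))\<^sup>2"
  by (simp add: cinner_defect_op cinner_self)

lemma Re_cinner_bound: "\<bar>Re (cinner x y)\<bar> \<le> norm x * norm y"
  using abs_Re_le_cmod Cauchy_Schwarz order_trans by blast

text \<open>Factor \<open>\<parallel>T x\<parallel>\<^sup>2 - s\<^sup>2 \<parallel>x\<parallel>\<^sup>2\<close> as a difference of squares; the factor \<open>\<parallel>T x\<parallel> + s \<parallel>x\<parallel>\<close> is at least
  \<open>s \<parallel>x\<parallel>\<close>, which is where \<open>s > 0\<close> matters.\<close>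
lemma defect_small_imp_ess_isometric:
  fixes T :: "'a :: complex_hilbert \<Rightarrow>\<^sub>L 'a"
  assumes T: "T \<in> bounded_ops" and s: "s > 0" and small: "ess_small (defect_op (s\<^sup>2) T)"
  shows "ess_isometric s T"
  unfolding ess_isometric_def
proof (intro allI impI)
  fix e :: real assume e: "e > 0"
  obtain B where B: "finite B"
    "\<And>x. x \<in> orth B \<Longrightarrow> norm (blinfun_apply (defect_op (s\<^sup>2) T) x) \<le> (e * s) * norm x"
    using ess_smallD[OF small, of "e * s"] e s by auto
  have "\<bar>norm (blinfun_apply T x) - s * norm x\<bar> \<le> e * norm x" if x: "x \<in> orth B" for x
  proof (cases "x = 0")
    case False
    let ?d = "\<bar>norm (blinfun_apply T x) - s * norm x\<bar>"
    have "?d * (s * norm x) \<le> ?d * (norm (blinfun_apply T x) + s * norm x)"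
      by (intro mult_left_mono) auto
    also have "\<dots> = \<bar>(norm (blinfun_apply T x) - s * norm x) * (norm (blinfun_apply T x) + s * norm x)\<bar>"
      using s by (simp add: abs_mult)
    also have "\<dots> = \<bar>Re (cinner (blinfun_apply (defect_op (s\<^sup>2) T) x) x)\<bar>"
      unfolding Re_cinner_defect_op[OF T] by (subst abs_minus_commute)
        (simp add: power2_eq_square algebra_simps)
    also have "\<dots> \<le> norm (blinfun_apply (defect_op (s\<^sup>2) T) x) * norm x" by (rule Re_cinner_bound)
    also have "\<dots> \<le> ((e * s) * norm x) * norm x" using B(2)[OF x] by (intro mult_right_mono) auto
    also have "\<dots> = (e * norm x) * (s * norm x)" by simp
    finally show ?thesis using s False by simp
  qed (simp add: blinfun.zero_right)
  then show "\<exists>B. finite B \<and> (\<forall>x\<in>orth B. \<bar>norm (blinfun_apply T x) - s * norm x\<bar> \<le> e * norm x)"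
    using B(1) by blast
qed

text \<open>Polarisation bounds \<open>\<langle>A x, y\<rangle>\<close> for \<open>x, y \<in> B\<^sup>\<bottom>\<close> by the quadratic form.  If \<open>x\<close> is moreover
  orthogonal to \<open>A B\<close>, then \<open>A x \<in> B\<^sup>\<bottom>\<close> and \<open>y = A x\<close> is allowed.\<close>
lemma symmetric_ess_small_if_form_small:
  fixes A :: "'a :: complex_hilbert \<Rightarrow>\<^sub>L 'a"
  assumes A: "symmetric_op A"
    and form: "\<And>e. e > 0 \<Longrightarrow> \<exists>B. finite B \<and>
      (\<forall>x\<in>orth B. \<bar>Re (cinner (blinfun_apply A x) x)\<bar> \<le> e * (norm x)\<^sup>2)"
  shows "ess_small A"
  unfolding ess_small_def
proof (intro allI impI)
  fix e :: real assume "e > 0"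
  then obtain B where B: "finite B"
    "\<And>x. x \<in> orth B \<Longrightarrow> \<bar>Re (cinner (blinfun_apply A x) x)\<bar> \<le> e * (norm x)\<^sup>2"
    using form by metis
  have "norm (blinfun_apply A x) \<le> e * norm x" if x: "x \<in> orth (B \<union> blinfun_apply A ` B)" for x
  proof (cases "x = 0 \<or> blinfun_apply A x = 0")
    case False
    define y where "y = blinfun_apply A x"
    have xB: "x \<in> orth B" using x by (simp add: orth_Un)
    have yB: "y \<in> orth B" using x by (auto simp: orth_def y_def symmetric_opD[OF A])
    define u where "u = (1 / norm x) *\<^sub>R x"
    define w where "w = (1 / norm y) *\<^sub>R y"
    have n: "norm u = 1" "norm w = 1" using False by (simp_all add: u_def w_def y_def)
    have uw: "u \<in> orth B" "w \<in> orth B"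
      unfolding u_def w_def using xB yB csubspace_scaleR[OF csubspace_orth] by blast+
    have sym: "Re (cinner (blinfun_apply A w) u) = Re (cinner (blinfun_apply A u) w)"
      unfolding symmetric_opD[OF A, of w u] by (subst cinner_commute) simp
    have "4 * Re (cinner (blinfun_apply A u) w)
        = Re (cinner (blinfun_apply A (u + w)) (u + w)) - Re (cinner (blinfun_apply A (u - w)) (u - w))"
      by (simp add: blinfun.bilinear_simps cinner_simps sym)
    also have "\<dots> \<le> e * (norm (u + w))\<^sup>2 + e * (norm (u - w))\<^sup>2"
      using B(2)[of "u + w"] B(2)[of "u - w"] uw complex_vector.subspace_add[OF csubspace_orth, of u B w]
        complex_vector.subspace_diff[OF csubspace_orth, of u B w]
      by (simp add: abs_le_iff)
    also have "\<dots> = e * 4" unfolding distrib_left[symmetric] parallelogram n by simp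
    finally have "Re (cinner (blinfun_apply A u) w) \<le> e" by simp
    also have "Re (cinner (blinfun_apply A u) w) = norm y / norm x"
      using False by (simp add: u_def w_def blinfun.scaleR_right cinner_simps flip: y_def)
        (simp add: y_def cinner_self power2_eq_square)
    finally show ?thesis using False by (simp add: y_def field_simps)
  qed (use \<open>e > 0\<close> in \<open>auto simp: blinfun.zero_right\<close>)
  then show "\<exists>B. finite B \<and> (\<forall>x\<in>orth B. norm (blinfun_apply A x) \<le> e * norm x)"
    using B(1) by (intro exI[of _ "B \<union> blinfun_apply A ` B"]) auto
qed

text \<open>In the same factorisation \<open>\<parallel>T x\<parallel> + s \<parallel>x\<parallel>\<close> is at most \<open>(\<parallel>T\<parallel> + s) \<parallel>x\<parallel>\<close>, so the form is small;
  and a symmetric operator with small form is small.\<close>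
lemma ess_isometric_imp_defect_small:
  fixes T :: "'a :: complex_hilbert \<Rightarrow>\<^sub>L 'a"
  assumes T: "T \<in> bounded_ops" and s: "s \<ge> 0" and iso: "ess_isometric s T"
  shows "ess_small (defect_op (s\<^sup>2) T)"
proof (rule symmetric_ess_small_if_form_small[OF symmetric_defect_op[OF T]])
  fix e :: real assume e: "e > 0"
  define C where "C = norm T + s + 1"
  have C: "C > 0" using s by (simp add: C_def add_nonneg_pos)
  obtain B where B: "finite B"
    "\<And>x. x \<in> orth B \<Longrightarrow> \<bar>norm (blinfun_apply T x) - s * norm x\<bar> \<le> (e / C) * norm x"
    using iso e C unfolding ess_isometric_def by (metis divide_pos_pos)
  have "\<bar>Re (cinner (blinfun_apply (defect_op (s\<^sup>2) T) x) x)\<bar> \<le> e * (norm x)\<^sup>2" if x: "x \<in> orth B" for x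
  proof -
    have "\<bar>Re (cinner (blinfun_apply (defect_op (s\<^sup>2) T) x) x)\<bar>
        = \<bar>(norm (blinfun_apply T x) - s * norm x) * (norm (blinfun_apply T x) + s * norm x)\<bar>"
      unfolding Re_cinner_defect_op[OF T] by (subst abs_minus_commute)
        (simp add: power2_eq_square algebra_simps)
    also have "\<dots> = \<bar>norm (blinfun_apply T x) - s * norm x\<bar> * (norm (blinfun_apply T x) + s * norm x)"
      using s by (simp add: abs_mult)
    also have "\<dots> \<le> ((e / C) * norm x) * (C * norm x)"
    proof (rule mult_mono)
      show "norm (blinfun_apply T x) + s * norm x \<le> C * norm x"
        using norm_blinfun[of T x] by (simp add: C_def distrib_right add_increasing2)
    qed (use B(2)[OF x] e C s in auto)
    also have "\<dots> = e * (norm x)\<^sup>2" using C by (simp add: power2_eq_square)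
    finally show ?thesis .
  qed
  then show "\<exists>B. finite B \<and> (\<forall>x\<in>orth B. \<bar>Re (cinner (blinfun_apply (defect_op (s\<^sup>2) T) x) x)\<bar> \<le> e * (norm x)\<^sup>2)"
    using B(1) by blast
qed

lemma defect_small_iff:
  assumes "T \<in> bounded_ops" "s > 0"
  shows "ess_small (defect_op (s\<^sup>2) T) \<longleftrightarrow> ess_isometric s T"
  using assms defect_small_imp_ess_isometric ess_isometric_imp_defect_small by (metis less_imp_le)


section \<open>Turning an essentially isometric operator into an exact one\<close>

lemma projection_op_exists:
  fixes M :: "'a :: complex_hilbert set"
  assumes M: "csubspace M" "closed M"
  obtains P where "P \<in> bounded_ops" "symmetric_op P"
    "\<And>x. blinfun_apply P x \<in> M" "\<And>x. x - blinfun_apply P x \<in> orth M"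
    "\<And>x. norm (blinfun_apply P x) \<le> norm x"
    "\<And>x. x \<in> M \<Longrightarrow> blinfun_apply P x = x" "\<And>x. x \<in> orth M \<Longrightarrow> blinfun_apply P x = 0"
proof -
  obtain p where p: "\<And>x. p x \<in> M" "\<And>x. x - p x \<in> orth M"
    using projection_exists[OF M] by metis
  have uniq: "p x = y" if "y \<in> M" "x - y \<in> orth M" for x y
  proof -
    have "p x - y \<in> M" using p(1) that(1) M(1) by (simp add: complex_vector.subspace_diff)
    moreover have "(x - y) - (x - p x) \<in> orth M"
      using that(2) p(2) complex_vector.subspace_diff[OF csubspace_orth] by blast
    ultimately have "p x - y = 0" using orth_disjoint[of "p x - y" M] by simp
    then show ?thesis by simp
  qed
  have add: "p (x + y) = p x + p y" for x y
  proof (rule uniq)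
    show "p x + p y \<in> M" using p(1) M(1) by (simp add: complex_vector.subspace_add)
    have "(x - p x) + (y - p y) \<in> orth M"
      using p(2) complex_vector.subspace_add[OF csubspace_orth] by blast
    then show "x + y - (p x + p y) \<in> orth M" by (simp add: algebra_simps)
  qed
  have scale: "p (a *\<^sub>C x) = a *\<^sub>C p x" for a x
  proof (rule uniq)
    show "a *\<^sub>C p x \<in> M" using p(1) M(1) by (simp add: complex_vector.subspace_scale)
    have "a *\<^sub>C (x - p x) \<in> orth M"
      using p(2) complex_vector.subspace_scale[OF csubspace_orth] by blast
    then show "a *\<^sub>C x - a *\<^sub>C p x \<in> orth M" by (simp add: complex_vector.scale_right_diff_distrib)
  qed
  have nrm: "norm (p x) \<le> norm x" for x
  proof -
    have "cinner (x - p x) (p x) = 0" using p by (simp add: orth_def)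
    from norm_add_sq_orth[OF this] have "(norm (p x))\<^sup>2 \<le> (norm x)\<^sup>2" by simp
    then show ?thesis by (rule power2_le_imp_le) simp
  qed
  have "bounded_linear p"
    by (rule bounded_linear_intro[where K = 1]) (simp_all add: add scale scaleR_scaleC nrm)
  then have app: "blinfun_apply (Blinfun p) = p" by (rule bounded_linear_Blinfun_apply)
  have sym: "cinner (p x) y = cinner x (p y)" for x y
  proof -
    have "cinner (p x) (y - p y) = 0" using p by (subst cinner_eq_0_commute) (simp add: orth_def)
    moreover have "cinner (x - p x) (p y) = 0" using p by (simp add: orth_def)
    ultimately show ?thesis by (simp add: cinner_simps)
  qed
  show thesis
  proof (rule that[of "Blinfun p"])
    show "Blinfun p \<in> bounded_ops" by (simp add: bounded_ops_def app scale)
    show "symmetric_op (Blinfun p)" by (simp add: symmetric_op_def app sym)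
    show "blinfun_apply (Blinfun p) x = x" if "x \<in> M" for x
      unfolding app using that by (intro uniq) (simp_all add: complex_vector.subspace_0[OF csubspace_orth])
    show "blinfun_apply (Blinfun p) x = 0" if "x \<in> orth M" for x
      unfolding app using that by (intro uniq) (simp_all add: complex_vector.subspace_0[OF M(1)])
  qed (simp_all add: app p nrm)
qed

text \<open>The complete metric space for the fixed point argument below.\<close>
lemma closed_small_symmetric_ops:
  "closed {Y :: 'a :: complex_hilbert \<Rightarrow>\<^sub>L 'a.
    Y \<in> bounded_ops \<and> symmetric_op Y \<and> ess_small Y \<and> norm Y \<le> e}"
proof -
  have app: "continuous_on UNIV (\<lambda>Y :: 'a \<Rightarrow>\<^sub>L 'a. blinfun_apply Y x)" for x
    by (intro continuous_intros)
  have "closed {Y :: 'a \<Rightarrow>\<^sub>L 'a. ess_small Y}"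
  proof -
    have "ess_small Y" if "Y \<in> closure {Y. ess_small Y}" for Y :: "'a \<Rightarrow>\<^sub>L 'a"
    proof (rule ess_small_approx)
      fix e :: real assume "e > 0"
      then obtain L where "ess_small L" "dist L Y < e"
        using \<open>Y \<in> closure _\<close> unfolding closure_approachable by blast
      then show "\<exists>L. ess_small L \<and> norm (Y - L) \<le> e"
        by (intro exI[of _ L]) (simp add: dist_norm norm_minus_commute)
    qed
    then show ?thesis using closure_subset_eq by blast
  qed
  moreover have "closed {Y :: 'a \<Rightarrow>\<^sub>L 'a. Y \<in> bounded_ops}"
    unfolding bounded_ops_def mem_Collect_eq
    by (intro closed_Collect_all closed_Collect_eq app
        bounded_linear.continuous_on[OF bounded_linear_scaleC_right])
  moreover have "closed {Y :: 'a \<Rightarrow>\<^sub>L 'a. symmetric_op Y}"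
    unfolding symmetric_op_def
    by (intro closed_Collect_all closed_Collect_eq app cinner.continuous_on continuous_on_const)
  moreover have "closed {Y :: 'a \<Rightarrow>\<^sub>L 'a. norm Y \<le> e}"
    by (intro closed_Collect_le continuous_intros)
  ultimately show ?thesis
    by (intro closed_Collect_conj)
qed

text \<open>The operator \<open>I + Y\<close> is an inverse square root of \<open>I - C\<close>.  Writing the equation
  \<open>(I + Y)(I - C)(I + Y) = I\<close> as \<open>2 Y = C + Y C + C Y - Y\<^sup>2 + Y C Y\<close> gives a contraction of the
  compact symmetric operators of norm at most \<open>e\<close>: for \<open>e \<le> 1/4\<close> the right-hand side has norm at
  most \<open>e + 3 e\<^sup>2 + e\<^sup>3 \<le> 2 e\<close>, and its Lipschitz constant is at most \<open>4 e + 2 e\<^sup>2 \<le> 9/8\<close>.\<close>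
lemma compact_inverse_square_root:
  fixes C :: "'a :: complex_hilbert \<Rightarrow>\<^sub>L 'a"
  assumes C: "C \<in> bounded_ops" "symmetric_op C" "ess_small C" "norm C \<le> e" and e: "e \<le> 1 / 4"
  obtains Y where "Y \<in> bounded_ops" "symmetric_op Y" "ess_small Y" "norm Y \<le> e"
    "\<And>x w. w = x + blinfun_apply Y x \<Longrightarrow>
      (w - blinfun_apply C w) + blinfun_apply Y (w - blinfun_apply C w) = x"
proof -
  define S where "S = {Y :: 'a \<Rightarrow>\<^sub>L 'a.
    Y \<in> bounded_ops \<and> symmetric_op Y \<and> ess_small Y \<and> norm Y \<le> e}"
  define G where "G Y = (1/2) *\<^sub>R (C + (Y o\<^sub>L C) + (C o\<^sub>L Y) - (Y o\<^sub>L Y) + (Y o\<^sub>L (C o\<^sub>L Y)))"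
    for Y :: "'a \<Rightarrow>\<^sub>L 'a"
  have e0: "e \<ge> 0" using C(4) norm_ge_zero order_trans by blast
  have nc: "norm (X o\<^sub>L Z) \<le> a * b" if "norm X \<le> a" "norm Z \<le> b" "a \<ge> 0" for X Z :: "'a \<Rightarrow>\<^sub>L 'a" and a b
    using norm_blinfun_compose[of X Z] mult_mono[OF that(1,2,3)] by (meson norm_ge_zero order_trans)
  have "complete S" unfolding S_def complete_eq_closed by (rule closed_small_symmetric_ops)
  moreover have "S \<noteq> {}" using C by (auto simp: S_def)
  moreover have "G ` S \<subseteq> S"
  proof
    fix Z assume "Z \<in> G ` S"
    then obtain Y where Y: "Y \<in> bounded_ops" "symmetric_op Y" "ess_small Y" "norm Y \<le> e" and Z: "Z = G Y"
      by (auto simp: S_def)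
    have "G Y \<in> bounded_ops"
      unfolding G_def using C(1) Y(1)
      by (intro bounded_ops_scaleR bounded_ops_add bounded_ops_diff bounded_ops_compose)
    moreover have "symmetric_op (G Y)"
      using C(2) Y(2) by (simp add: symmetric_op_def G_def blinfun.bilinear_simps cinner_simps)
    moreover have "ess_small (G Y)"
      unfolding G_def using C(1,3) Y(1,3)
      by (intro ess_small_scaleR ess_small_add ess_small_diff ess_small_compose_left) auto
    moreover have "norm (G Y) \<le> e"
    proof -
      have "norm (C + (Y o\<^sub>L C) + (C o\<^sub>L Y) - (Y o\<^sub>L Y) + (Y o\<^sub>L (C o\<^sub>L Y))) \<le> e + e * e + e * e + e * e + e * (e * e)"
        by (intro norm_triangle_le order_trans[OF norm_triangle_ineq4] add_mono nc C(4) Y(4) e0)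
      also have "\<dots> \<le> e + e * (1/4) + e * (1/4) + e * (1/4) + e * (1 / 4 * 1)"
        using e e0 by (intro add_mono mult_left_mono mult_mono) auto
      finally show ?thesis by (simp add: G_def)
    qed
    ultimately show "Z \<in> S" by (simp add: S_def Z)
  qed
  moreover have "dist (G Y) (G Z) \<le> (9/16) * dist Y Z" if "Y \<in> S" "Z \<in> S" for Y Z
  proof -
    have Y: "norm Y \<le> e" and Z: "norm Z \<le> e" using that by (auto simp: S_def)
    let ?d = "norm (Y - Z)"
    have "G Y - G Z = (1/2) *\<^sub>R (((Y - Z) o\<^sub>L C) + (C o\<^sub>L (Y - Z))
        - (((Y - Z) o\<^sub>L Y) + (Z o\<^sub>L (Y - Z))) + (((Y - Z) o\<^sub>L (C o\<^sub>L Y)) + (Z o\<^sub>L (C o\<^sub>L (Y - Z)))))"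
      by (rule blinfun_eqI) (simp add: G_def blinfun.bilinear_simps algebra_simps flip: scaleR_add_right)
    moreover have "norm (((Y - Z) o\<^sub>L C) + (C o\<^sub>L (Y - Z))
        - (((Y - Z) o\<^sub>L Y) + (Z o\<^sub>L (Y - Z))) + (((Y - Z) o\<^sub>L (C o\<^sub>L Y)) + (Z o\<^sub>L (C o\<^sub>L (Y - Z)))))
        \<le> (?d * e + e * ?d) + (?d * e + e * ?d) + (?d * (e * e) + e * (e * ?d))"
      by (intro norm_triangle_le order_trans[OF norm_triangle_ineq4] add_mono nc C(4) Y Z e0 order_refl norm_ge_zero)
    moreover have "(?d * e + e * ?d) + (?d * e + e * ?d) + (?d * (e * e) + e * (e * ?d)) = ?d * (4 * e + 2 * (e * e))"
      by (simp add: algebra_simps)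
    moreover have "\<dots> \<le> ?d * (4 * (1/4) + 2 * (1/4 * (1/4)))"
      using e e0 by (intro mult_left_mono add_mono mult_mono) auto
    ultimately show ?thesis by (simp add: dist_norm)
  qed
  ultimately have "\<exists>!Y\<in>S. G Y = Y" by (intro Banach_fix[of S "9/16"]) auto
  then obtain Y where Y: "Y \<in> S" "G Y = Y" by blast
  show thesis
  proof (rule that[of Y])
    fix x w assume w: "w = x + blinfun_apply Y x"
    have "2 *\<^sub>R blinfun_apply Y x = 2 *\<^sub>R blinfun_apply (G Y) x" by (simp only: Y(2))
    then have "2 *\<^sub>R blinfun_apply Y x = blinfun_apply C x + blinfun_apply Y (blinfun_apply C x)
        + blinfun_apply C (blinfun_apply Y x) - blinfun_apply Y (blinfun_apply Y x)
        + blinfun_apply Y (blinfun_apply C (blinfun_apply Y x))"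
      by (simp add: G_def blinfun.bilinear_simps)
    then show "(w - blinfun_apply C w) + blinfun_apply Y (w - blinfun_apply C w) = x"
      unfolding w by (simp add: blinfun.bilinear_simps scaleR_2 algebra_simps)
  qed (use Y(1) in \<open>auto simp: S_def\<close>)
qed

text \<open>Let \<open>A = \<alpha> I - T\<^sup>* T\<close>, compress it to a subspace of finite codimension on which it is small,
  \<open>\<alpha> C = Q A Q\<close>, and let \<open>R = I + Y\<close> be the inverse square root of \<open>I - C\<close>.  Up to finite rank
  \<open>R T\<^sup>* T R = \<alpha> R (I - C) R = \<alpha> I\<close>, so \<open>T R\<close> is exactly \<open>\<surd>\<alpha>\<close> times an isometry on a subspace of finite
  codimension.\<close>
lemma small_perturbation_isometric_off_finite:
  fixes T :: "'a :: complex_hilbert \<Rightarrow>\<^sub>L 'a"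
  assumes T: "T \<in> bounded_ops" and \<alpha>: "\<alpha> > 0" and small: "ess_small (defect_op \<alpha> T)"
    and e: "e > 0" "e \<le> 1 / 4"
  obtains Y B where "Y \<in> bounded_ops" "ess_small Y" "norm Y \<le> e" "finite B"
    "\<And>x y. x \<in> orth B \<Longrightarrow>
      cinner (blinfun_apply T (x + blinfun_apply Y x)) (blinfun_apply T (y + blinfun_apply Y y))
        = \<alpha> *\<^sub>R cinner x y"
proof -
  define A where "A = defect_op \<alpha> T"
  have A: "A \<in> bounded_ops" "symmetric_op A" "ess_small A"
    using T small by (simp_all add: A_def defect_bounded_op symmetric_defect_op)
  obtain B0 where B0: "finite B0" "\<And>x. x \<in> orth B0 \<Longrightarrow> norm (blinfun_apply A x) \<le> (\<alpha> * e) * norm x"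
    using ess_smallD[OF A(3), of "\<alpha> * e"] \<alpha> e by auto
  obtain Q where Q: "Q \<in> bounded_ops" "symmetric_op Q" "\<And>x. blinfun_apply Q x \<in> orth B0"
    "\<And>x. norm (blinfun_apply Q x) \<le> norm x" "\<And>x. x \<in> orth B0 \<Longrightarrow> blinfun_apply Q x = x"
    using projection_op_exists[OF csubspace_orth closed_orth, of B0] by metis
  define C where "C = (1 / \<alpha>) *\<^sub>R (Q o\<^sub>L (A o\<^sub>L Q))"
  have C: "C \<in> bounded_ops" "symmetric_op C" "ess_small C"
  proof -
    show "C \<in> bounded_ops"
      unfolding C_def by (intro bounded_ops_scaleR bounded_ops_compose Q(1) A(1))
    show "symmetric_op C"
      using Q(2) A(2) by (simp add: symmetric_op_def C_def blinfun.bilinear_simps cinner_simps)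
    show "ess_small C"
      unfolding C_def
      by (intro ess_small_scaleR ess_small_compose_left ess_small_compose_right Q(1) A(3))
  qed
  have "norm C \<le> e"
  proof (rule norm_blinfun_bound)
    fix x
    have "norm (blinfun_apply Q (blinfun_apply A (blinfun_apply Q x))) \<le> (\<alpha> * e) * norm (blinfun_apply Q x)"
      using Q(4) B0(2)[OF Q(3)] order_trans by blast
    also have "\<dots> \<le> (\<alpha> * e) * norm x" using \<alpha> e by (intro mult_left_mono Q(4)) auto
    finally show "norm (blinfun_apply C x) \<le> e * norm x"
      using \<alpha> by (simp add: C_def blinfun.bilinear_simps field_simps)
  qed (use e in simp)
  then obtain Y where Y: "Y \<in> bounded_ops" "symmetric_op Y" "ess_small Y" "norm Y \<le> e"
    "\<And>x w. w = x + blinfun_apply Y x \<Longrightarrow>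
      (w - blinfun_apply C w) + blinfun_apply Y (w - blinfun_apply C w) = x"
    using compact_inverse_square_root[OF C] e(2) by metis
  define B1 where "B1 = B0 \<union> blinfun_apply A ` B0"
  have AC: "blinfun_apply A x = \<alpha> *\<^sub>R blinfun_apply C x" if "x \<in> orth B1" for x
  proof -
    have "x \<in> orth B0" "blinfun_apply A x \<in> orth B0"
      using that by (auto simp: B1_def orth_def symmetric_opD[OF A(2)])
    then show ?thesis using \<alpha> by (simp add: C_def blinfun.bilinear_simps Q(5))
  qed
  define R where "R x = x + blinfun_apply Y x" for x
  have symR: "cinner (R x) y = cinner x (R y)" for x y
    by (simp add: R_def cinner_simps symmetric_opD[OF Y(2)])
  show thesis
  proof (rule that[of Y "R ` B1"])
    show "finite (R ` B1)" using B0(1) by (simp add: B1_def)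
    fix x y assume x: "x \<in> orth (R ` B1)"
    then have Rx: "R x \<in> orth B1" by (simp add: orth_def symR)
    have "cinner (blinfun_apply T (R x)) (blinfun_apply T (R y))
        = \<alpha> *\<^sub>R cinner (R x) (R y) - cinner (blinfun_apply A (R x)) (R y)"
      by (simp add: A_def cinner_defect_op[OF T])
    also have "\<dots> = \<alpha> *\<^sub>R cinner (R x - blinfun_apply C (R x)) (R y)"
      by (simp add: AC[OF Rx] cinner_simps scaleR_diff_right)
    also have "cinner (R x - blinfun_apply C (R x)) (R y) = cinner (R (R x - blinfun_apply C (R x))) y"
      by (simp only: symR)
    also have "R (R x - blinfun_apply C (R x)) = x"
      using Y(5)[of "R x" x] by (simp add: R_def)
    finally show "cinner (blinfun_apply T (x + blinfun_apply Y x)) (blinfun_apply T (y + blinfun_apply Y y))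
        = \<alpha> *\<^sub>R cinner x y" by (simp only: R_def)
  qed (use Y in auto)
qed

lemma ess_isometric_imp_closure_AN:
  fixes T :: "'a :: complex_hilbert \<Rightarrow>\<^sub>L 'a"
  assumes T: "T \<in> bounded_ops" and s: "s > 0" and iso: "ess_isometric s T"
  shows "T \<in> closure AN_ops"
  unfolding closure_approachable
proof (intro allI impI)
  fix \<epsilon> :: real assume \<epsilon>: "\<epsilon> > 0"
  define e where "e = min (1/4) (\<epsilon> / (2 * (norm T + 1)))"
  have p: "norm T + 1 > 0" by (simp add: add_nonneg_pos)
  have e: "e > 0" using \<epsilon> p by (simp add: e_def)
  have e4: "e \<le> 1/4" unfolding e_def by (rule min.cobounded1)
  have "s\<^sup>2 > 0" using s by simp
  then obtain Y B where Y: "Y \<in> bounded_ops" "norm Y \<le> e" "finite B"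
    "\<And>x y. x \<in> orth B \<Longrightarrow>
      cinner (blinfun_apply T (x + blinfun_apply Y x)) (blinfun_apply T (y + blinfun_apply Y y))
        = (s\<^sup>2) *\<^sub>R cinner x y"
    using small_perturbation_isometric_off_finite[OF T _ ess_isometric_imp_defect_small[OF T _ iso] e e4] s
    by (metis less_imp_le)
  let ?S = "T o\<^sub>L (id_blinfun + Y)"
  have "?S \<in> bounded_ops" by (intro bounded_ops_compose bounded_ops_add bounded_ops_id T Y(1))
  then have "?S \<in> AN_ops"
    using Y(4) by (intro AN_if_isometric_off_finite[OF _ Y(3), of _ "s\<^sup>2"]) (simp_all add: blinfun.add_left)
  moreover have "dist ?S T < \<epsilon>"
  proof -
    have "?S - T = T o\<^sub>L Y" by (rule blinfun_eqI) (simp add: blinfun.bilinear_simps)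
    then have "dist ?S T \<le> norm T * norm Y" by (simp add: dist_norm norm_blinfun_compose)
    also have "\<dots> \<le> (norm T + 1) * e" using Y(2) by (intro mult_mono) auto
    also have "\<dots> \<le> (norm T + 1) * (\<epsilon> / (2 * (norm T + 1)))"
      using p by (intro mult_left_mono) (auto simp: e_def)
    also have "\<dots> = \<epsilon> / 2" using p by (simp add: field_simps)
    also have "\<dots> < \<epsilon>" using \<epsilon> by simp
    finally show ?thesis .
  qed
  ultimately show "\<exists>S\<in>AN_ops. dist S T < \<epsilon>" by blast
qed

text \<open>With \<open>Q\<close> the projection onto \<open>B\<^sup>\<bottom>\<close>, the operator \<open>T (I + Y) Q\<close> satisfies
  \<open>\<parallel>T (I + Y) Q x\<parallel> = s \<parallel>Q x\<parallel>\<close>, and it differs from \<open>T\<close> by \<open>T Y\<close> up to finite rank.\<close>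
lemma ess_isometric_imp_partial_isometry_plus_compact:
  fixes T :: "'a :: complex_hilbert \<Rightarrow>\<^sub>L 'a"
  assumes T: "T \<in> bounded_ops" and s: "s > 0" and iso: "ess_isometric s T"
  shows "\<exists>K\<in>compact_ops. \<exists>V\<in>bounded_ops.
    partial_isometry V \<and> cfinite_dim (null_space V) \<and> T = K + s *\<^sub>R V"
proof -
  have "s\<^sup>2 > 0" using s by simp
  then obtain Y B where Y: "Y \<in> bounded_ops" "ess_small Y" "finite B"
    "\<And>x y. x \<in> orth B \<Longrightarrow>
      cinner (blinfun_apply T (x + blinfun_apply Y x)) (blinfun_apply T (y + blinfun_apply Y y))
        = (s\<^sup>2) *\<^sub>R cinner x y"
    using small_perturbation_isometric_off_finite[OF T _ ess_isometric_imp_defect_small[OF T _ iso], of "1/4"] s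
    by (metis less_imp_le order_refl zero_less_divide_1_iff zero_less_numeral)
  obtain Q where Q: "Q \<in> bounded_ops" "symmetric_op Q" "\<And>x. blinfun_apply Q x \<in> orth B"
    "\<And>x. x \<in> orth B \<Longrightarrow> blinfun_apply Q x = x"
    using projection_op_exists[OF csubspace_orth closed_orth, of B] by metis
  define W where "W = T o\<^sub>L ((id_blinfun + Y) o\<^sub>L Q)"
  define V where "V = (1 / s) *\<^sub>R W"
  define K where "K = T - W"
  have W: "W \<in> bounded_ops"
    unfolding W_def by (intro bounded_ops_compose bounded_ops_add bounded_ops_id T Y(1) Q(1))
  have V: "V \<in> bounded_ops" unfolding V_def by (intro bounded_ops_scaleR W)
  have "ess_small (K + (T o\<^sub>L Y))"
    by (rule ess_small_if_zero_on_orth[OF Y(3)])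
      (simp add: K_def W_def blinfun.bilinear_simps Q(4))
  then have "ess_small (K + (T o\<^sub>L Y) - (T o\<^sub>L Y))"
    by (intro ess_small_diff ess_small_compose_left Y(2))
  then have "ess_small K" by simp
  then have "K \<in> compact_ops"
    unfolding compact_ops_iff K_def using bounded_ops_diff[OF T W] by blast
  have nV: "norm (blinfun_apply V x) = norm (blinfun_apply Q x)" for x
  proof -
    have "(norm (blinfun_apply W x))\<^sup>2 = s\<^sup>2 * (norm (blinfun_apply Q x))\<^sup>2"
      using Y(4)[OF Q(3), of x "blinfun_apply Q x"]
      by (simp add: W_def blinfun.bilinear_simps flip: Re_cinner_self)
    then have "(norm (blinfun_apply W x))\<^sup>2 = (s * norm (blinfun_apply Q x))\<^sup>2"
      by (simp only: power_mult_distrib)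
    then have "norm (blinfun_apply W x) = s * norm (blinfun_apply Q x)"
      using s by (simp add: power2_eq_iff_nonneg)
    then show ?thesis using s by (simp add: V_def blinfun.scaleR_left)
  qed
  have null: "x \<in> null_space V \<longleftrightarrow> blinfun_apply Q x = 0" for x
    unfolding null_space_def mem_Collect_eq using nV[of x] by (metis norm_eq_zero)
  have "partial_isometry V"
    unfolding partial_isometry_def
  proof (intro allI impI)
    fix x assume x: "\<forall>y\<in>null_space V. cinner x y = 0"
    let ?n = "x - blinfun_apply Q x"
    have "?n \<in> null_space V" by (simp add: null blinfun.diff_right Q(3,4))
    then have "cinner x ?n = 0" using x by blast
    moreover have "cinner (blinfun_apply Q x) ?n = 0"
      by (simp add: symmetric_opD[OF Q(2)] blinfun.diff_right Q(3,4))
    ultimately have "cinner ?n ?n = 0" by (simp only: cinner.diff_left[of x]) simp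
    then show "norm (blinfun_apply V x) = norm x" by (simp add: nV cinner_self_eq_0)
  qed
  moreover have "cfinite_dim (null_space V)"
    using null Q(4)
    by (intro cfinite_dim_if_disjoint_orth[OF csubspace_null_space[OF V] closed_null_space Y(3)]) auto
  moreover have "T = K + s *\<^sub>R V" using s by (simp add: K_def V_def)
  ultimately show ?thesis using V \<open>K \<in> compact_ops\<close> by blast
qed

lemma partial_isometry_plus_compact_imp_ess_isometric:
  fixes V :: "'a :: complex_hilbert \<Rightarrow>\<^sub>L 'a"
  assumes K: "K \<in> compact_ops" and V: "partial_isometry V" "cfinite_dim (null_space V)" and s: "s \<ge> 0"
  shows "ess_isometric s (K + s *\<^sub>R V)"
  unfolding ess_isometric_def
proof (intro allI impI)
  fix e :: real assume "e > 0"
  then obtain A where A: "finite A" "\<And>x. x \<in> orth A \<Longrightarrow> norm (blinfun_apply K x) \<le> e * norm x"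
    using compact_imp_ess_small[OF K] ess_smallD by metis
  obtain F where F: "finite F" "cspan F = null_space V" using V(2) by (auto simp: cfinite_dim_def)
  have "\<bar>norm (blinfun_apply (K + s *\<^sub>R V) x) - s * norm x\<bar> \<le> e * norm x" if x: "x \<in> orth (A \<union> F)" for x
  proof -
    have "x \<in> orth (cspan F)" using x by (simp only: orth_Un orth_cspan Int_iff)
    then have "norm (blinfun_apply V x) = norm x"
      using V(1) unfolding F(2) by (simp add: partial_isometry_def orth_def)
    then have "norm (s *\<^sub>R blinfun_apply V x) = s * norm x" using s by simp
    then have "\<bar>norm (blinfun_apply (K + s *\<^sub>R V) x) - s * norm x\<bar> \<le> norm (blinfun_apply K x)"
      using norm_triangle_ineq3[of "blinfun_apply (K + s *\<^sub>R V) x" "s *\<^sub>R blinfun_apply V x"]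
      by (simp add: blinfun.add_left blinfun.scaleR_left)
    then show ?thesis using A(2)[of x] x by (simp add: orth_Un)
  qed
  then show "\<exists>B. finite B \<and> (\<forall>x\<in>orth B. \<bar>norm (blinfun_apply (K + s *\<^sub>R V) x) - s * norm x\<bar> \<le> e * norm x)"
    using A(1) F(1) by (intro exI[of _ "A \<union> F"]) auto
qed

section \<open>The essential spectrum of \<open>T\<^sup>* T\<close>\<close>

text \<open>If \<open>0\<close> is the top of the essential numerical range of the symmetric operator \<open>A\<close>, then
  \<open>Q = \<epsilon> - A\<close> is a positive form on some \<open>B\<^sup>\<bottom>\<close>.  A unit vector \<open>x \<in> B\<^sup>\<bottom>\<close> with \<open>\<langle>Q x, x\<rangle> \<le> 2\<epsilon>\<close> and
  \<open>Q x \<in> B\<^sup>\<bottom>\<close> has small \<open>Q x\<close>: otherwise a small step from \<open>x\<close> in the direction \<open>- Q x\<close> would make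
  the form negative.\<close>
lemma not_ess_bounded_below_at_top:
  fixes A :: "'a :: complex_hilbert \<Rightarrow>\<^sub>L 'a"
  assumes A: "symmetric_op A"
    and upper: "\<And>e. e > 0 \<Longrightarrow> \<exists>B. finite B \<and>
      (\<forall>x\<in>orth B. Re (cinner (blinfun_apply A x) x) \<le> e * (norm x)\<^sup>2)"
    and lower: "\<And>e B. e > 0 \<Longrightarrow> finite B \<Longrightarrow>
      \<exists>x\<in>orth B. norm x = 1 \<and> - e \<le> Re (cinner (blinfun_apply A x) x)"
  shows "\<not> ess_bounded_below A"
proof
  assume "ess_bounded_below A"
  then obtain c B0 where c: "c > 0" "finite B0"
    "\<And>x. x \<in> orth B0 \<Longrightarrow> c * norm x \<le> norm (blinfun_apply A x)"
    unfolding ess_bounded_below_def by blast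
  \<comment> \<open>\<open>q\<close> bounds the norm of \<open>Q\<close>, and \<open>1 / q\<close> will be the length of the step.  The choice of \<open>e\<close>
    makes \<open>\<parallel>Q x\<parallel>\<^sup>2 \<le> 2 e q \<le> c\<^sup>2 / 8\<close> incompatible with \<open>\<parallel>Q x\<parallel> \<ge> c - e \<ge> c / 2\<close>.\<close>
  define q where "q = norm A + 1"
  have q: "q \<ge> 1" by (simp add: q_def)
  define e where "e = min 1 (min (c / 2) (c\<^sup>2 / (16 * q)))"
  have e: "e > 0" "e \<le> 1" "e \<le> c / 2" using c(1) q by (simp_all add: e_def)
  have eq: "2 * e * q \<le> c\<^sup>2 / 8"
  proof -
    have "e \<le> c\<^sup>2 / (16 * q)" by (simp add: e_def)
    then show ?thesis using q by (simp add: field_simps)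
  qed
  obtain B1 where B1: "finite B1"
    "\<And>x. x \<in> orth B1 \<Longrightarrow> Re (cinner (blinfun_apply A x) x) \<le> e * (norm x)\<^sup>2"
    using upper[OF e(1)] by blast
  obtain x where x: "x \<in> orth (B0 \<union> (B1 \<union> blinfun_apply A ` B1))" "norm x = 1"
    "- e \<le> Re (cinner (blinfun_apply A x) x)"
    using lower[OF e(1), of "B0 \<union> (B1 \<union> blinfun_apply A ` B1)"] c(2) B1(1) by blast
  define Q where "Q z = e *\<^sub>R z - blinfun_apply A z" for z
  have symQ: "cinner (Q z) w = cinner z (Q w)" for z w
    by (simp add: Q_def cinner_simps symmetric_opD[OF A])
  have xB: "x \<in> orth B0" "x \<in> orth B1" using x(1) by (auto simp: orth_Un)
  have "blinfun_apply A x \<in> orth B1"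
    using x(1) by (auto simp: orth_def symmetric_opD[OF A])
  then have QxB: "Q x \<in> orth B1"
    unfolding Q_def using xB(2) csubspace_scaleR[OF csubspace_orth]
      complex_vector.subspace_diff[OF csubspace_orth] by blast
  define t where "t = 1 / q"
  have t: "t > 0" "t * q = 1" using q by (simp_all add: t_def)
  have bQ: "norm (Q z) \<le> q * norm z" for z
  proof -
    have "norm (Q z) \<le> e * norm z + norm A * norm z"
      unfolding Q_def using norm_triangle_ineq4[of "e *\<^sub>R z" "blinfun_apply A z"] norm_blinfun[of A z] e(1)
      by simp
    also have "\<dots> \<le> 1 * norm z + norm A * norm z"
      using e(2) by (intro add_right_mono mult_right_mono) auto
    finally show ?thesis by (simp add: q_def distrib_right)
  qed
  have Re_x: "Re (cinner (Q x) x) \<le> 2 * e"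
    using x(2,3) by (simp add: Q_def cinner_simps cinner_self)
  have Re_QQ: "Re (cinner (Q (Q x)) (Q x)) \<le> q * (norm (Q x))\<^sup>2"
  proof -
    have "Re (cinner (Q (Q x)) (Q x)) \<le> norm (Q (Q x)) * norm (Q x)"
      using Re_cinner_bound[of "Q (Q x)" "Q x"] by linarith
    also have "\<dots> \<le> (q * norm (Q x)) * norm (Q x)" by (intro mult_right_mono bQ) auto
    finally show ?thesis by (simp add: power2_eq_square)
  qed
  have "x - t *\<^sub>R Q x \<in> orth B1"
    using xB(2) QxB csubspace_scaleR[OF csubspace_orth] complex_vector.subspace_diff[OF csubspace_orth]
    by blast
  then have "0 \<le> Re (cinner (Q (x - t *\<^sub>R Q x)) (x - t *\<^sub>R Q x))"
    using B1(2)[of "x - t *\<^sub>R Q x"] by (simp add: Q_def[of "x - _"] cinner.diff_left cinner_scaleR_left cinner_self)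
  also have "Q (x - t *\<^sub>R Q x) = Q x - t *\<^sub>R Q (Q x)"
    by (simp add: Q_def blinfun.bilinear_simps algebra_simps)
  also have "Re (cinner (Q x - t *\<^sub>R Q (Q x)) (x - t *\<^sub>R Q x))
      = Re (cinner (Q x) x) - 2 * t * (norm (Q x))\<^sup>2 + t * (t * Re (cinner (Q (Q x)) (Q x)))"
    using symQ[of "Q x" x] by (simp add: cinner_simps cinner_self algebra_simps)
  also have "\<dots> \<le> 2 * e - 2 * t * (norm (Q x))\<^sup>2 + t * (t * (q * (norm (Q x))\<^sup>2))"
    using t(1) Re_x Re_QQ by (intro add_mono diff_right_mono mult_left_mono) auto
  also have "t * (t * (q * (norm (Q x))\<^sup>2)) = (t * q) * (t * (norm (Q x))\<^sup>2)" by simp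
  finally have "t * (norm (Q x))\<^sup>2 \<le> 2 * e" unfolding t(2) by simp
  then have "(norm (Q x))\<^sup>2 \<le> 2 * e * q" using q by (simp add: t_def field_simps)
  then have up: "(norm (Q x))\<^sup>2 \<le> c\<^sup>2 / 8" using eq by simp
  have "c \<le> norm (blinfun_apply A x)" using c(3)[OF xB(1)] x(2) by simp
  also have "blinfun_apply A x = e *\<^sub>R x - Q x" by (simp add: Q_def)
  also have "norm \<dots> \<le> e + norm (Q x)" using norm_triangle_ineq4[of "e *\<^sub>R x" "Q x"] x(2) e(1) by simp
  finally have "c / 2 \<le> norm (Q x)" using e(3) by simp
  then have "(c / 2)\<^sup>2 \<le> (norm (Q x))\<^sup>2" using c(1) by (intro power_mono) auto
  then have "c\<^sup>2 \<le> 4 * (norm (Q x))\<^sup>2" by (simp add: power_divide)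
  moreover have "c\<^sup>2 > 0" using c(1) by simp
  ultimately show False using up by linarith
qed

lemma shifted_op:
  fixes T :: "'a :: complex_hilbert \<Rightarrow>\<^sub>L 'a"
  assumes T: "T \<in> bounded_ops"
  shows "(adjoint_op T o\<^sub>L T) - \<mu> *\<^sub>C id_blinfun \<in> bounded_ops"
    and "adjoint_op ((adjoint_op T o\<^sub>L T) - \<mu> *\<^sub>C id_blinfun) = (adjoint_op T o\<^sub>L T) - cnj \<mu> *\<^sub>C id_blinfun"
proof -
  have b: "(adjoint_op T o\<^sub>L T) - \<mu> *\<^sub>C id_blinfun \<in> bounded_ops" for \<mu>
    by (intro bounded_ops_diff bounded_ops_compose bounded_ops_scaleC bounded_ops_id
        adjoint_bounded_op T)
  show "(adjoint_op T o\<^sub>L T) - \<mu> *\<^sub>C id_blinfun \<in> bounded_ops" by (rule b)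
  show "adjoint_op ((adjoint_op T o\<^sub>L T) - \<mu> *\<^sub>C id_blinfun) = (adjoint_op T o\<^sub>L T) - cnj \<mu> *\<^sub>C id_blinfun"
    by (rule adjoint_unique[OF b])
      (simp add: blinfun.bilinear_simps scaleC_blinfun.rep_eq cinner_simps
        cinner_adjoint[OF T] cinner_adjoint'[OF T])
qed

lemma shifted_op_real:
  "(adjoint_op T o\<^sub>L T) - complex_of_real \<alpha> *\<^sub>C id_blinfun = - defect_op \<alpha> T"
  by (simp add: defect_op_def flip: scaleR_scaleC)

lemma ess_bounded_below_uminus: "ess_bounded_below (- A) \<longleftrightarrow> ess_bounded_below A"
  by (simp add: ess_bounded_below_def blinfun.minus_left)

lemma real_mem_essential_spectrum:
  assumes "T \<in> bounded_ops" "\<not> ess_bounded_below (defect_op \<alpha> T)"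
  shows "complex_of_real \<alpha> \<in> essential_spectrum (adjoint_op T o\<^sub>L T)"
  using assms fredholm_iff[OF shifted_op(1)[OF assms(1)]]
  by (simp add: essential_spectrum_def shifted_op_real ess_bounded_below_uminus)

text \<open>The squares \<open>a\<^sup>2\<close> and \<open>b\<^sup>2\<close> of both essential bounds of \<open>T\<close> lie in the essential spectrum of \<open>T\<^sup>* T\<close>; if that
  is a single point, the bounds agree.  The upper bound is the top of the form of
  \<open>T\<^sup>* T - b\<^sup>2\<close>, the lower one that of \<open>a\<^sup>2 - T\<^sup>* T\<close>.\<close>
lemma singleton_essential_spectrum_imp_ess_isometric:
  fixes T :: "'a :: complex_hilbert \<Rightarrow>\<^sub>L 'a"
  assumes inf: "\<not> cfinite_dim (UNIV :: 'a set)" and T: "T \<in> bounded_ops" and \<alpha>: "\<alpha> > 0"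
    and spec: "essential_spectrum (adjoint_op T o\<^sub>L T) = {complex_of_real \<alpha>}"
  shows "ess_isometric (sqrt \<alpha>) T"
proof -
  obtain a b where ab: "0 \<le> a" "a \<le> b"
    "\<And>e. e > 0 \<Longrightarrow> \<exists>B. finite B \<and> (\<forall>x\<in>orth B.
        (a - e) * norm x \<le> norm (blinfun_apply T x) \<and> norm (blinfun_apply T x) \<le> (b + e) * norm x)"
    "\<And>e B. e > 0 \<Longrightarrow> finite B \<Longrightarrow> \<exists>x\<in>orth B. norm x = 1 \<and> norm (blinfun_apply T x) \<le> a + e"
    "\<And>e B. e > 0 \<Longrightarrow> finite B \<Longrightarrow> \<exists>x\<in>orth B. norm x = 1 \<and> b - e \<le> norm (blinfun_apply T x)"
    by (rule essential_bounds[OF inf, of T]) (rule that)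
  \<comment> \<open>Passing from bounds on \<open>y = \<parallel>T x\<parallel>\<close> to bounds on its square, with \<open>n = \<parallel>x\<parallel>\<close>.\<close>
  have up: "y\<^sup>2 - (c\<^sup>2) * n\<^sup>2 \<le> e * n\<^sup>2"
    if "0 \<le> y" "y \<le> (c + d) * n" "d * (2 * c + 1) \<le> e" "0 < d" "d \<le> 1" "0 \<le> c" "0 \<le> n" for y c d e n :: real
  proof -
    have "y\<^sup>2 \<le> ((c + d) * n)\<^sup>2" using that by (intro power_mono) auto
    also have "\<dots> = c\<^sup>2 * n\<^sup>2 + (d * (2 * c + d)) * n\<^sup>2" by (simp add: power2_eq_square algebra_simps)
    also have "d * (2 * c + d) \<le> e"
      using that mult_left_mono[of "2 * c + d" "2 * c + 1" d] by linarith
    finally show ?thesis by (simp add: mult_right_mono)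
  qed
  have lo: "c\<^sup>2 * n\<^sup>2 - y\<^sup>2 \<le> e * n\<^sup>2"
    if "(c - d) * n \<le> y" "d * (2 * c + 1) \<le> e" "0 < d" "0 \<le> c" "0 \<le> n" for y c d e n :: real
  proof (cases "d \<le> c")
    case True
    have "((c - d) * n)\<^sup>2 \<le> y\<^sup>2" using that True by (intro power_mono) auto
    moreover have "((c - d) * n)\<^sup>2 = c\<^sup>2 * n\<^sup>2 - (2 * d * c - d\<^sup>2) * n\<^sup>2"
      by (simp add: power2_eq_square algebra_simps)
    moreover have "(2 * d * c - d\<^sup>2) * n\<^sup>2 \<le> e * n\<^sup>2"
    proof (rule mult_right_mono)
      have "2 * d * c - d\<^sup>2 \<le> 2 * d * c + d" using that(3) zero_le_power2[of d] by linarith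
      also have "\<dots> \<le> e" using that(2) by (simp add: algebra_simps)
      finally show "2 * d * c - d\<^sup>2 \<le> e" .
    qed simp
    ultimately show ?thesis by linarith
  next
    case False
    have "c * c \<le> d * c" using False that by (intro mult_right_mono) auto
    also have "\<dots> \<le> d * (2 * c + 1)" using that by (intro mult_left_mono) auto
    also have "\<dots> \<le> e" by (rule that(2))
    finally have "c\<^sup>2 \<le> e" by (simp add: power2_eq_square)
    then have "c\<^sup>2 * n\<^sup>2 \<le> e * n\<^sup>2" by (intro mult_right_mono) auto
    then show ?thesis using zero_le_power2[of y] by linarith
  qed
  have d_ex: "\<exists>d>0. d \<le> 1 \<and> d * (2 * c + 1) \<le> e" if "e > 0" "c \<ge> 0" for c e :: real
  proof -
    have p: "2 * c + 1 > 0" using that by simp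
    have "min 1 (e / (2 * c + 1)) * (2 * c + 1) \<le> e / (2 * c + 1) * (2 * c + 1)"
      using p by (intro mult_right_mono min.cobounded2) auto
    then show ?thesis using p that by (intro exI[of _ "min 1 (e / (2 * c + 1))"]) auto
  qed
  have symm: "symmetric_op (- defect_op \<gamma> T)" for \<gamma>
    using symmetric_defect_op[OF T] by (simp add: symmetric_op_def blinfun.minus_left cinner_simps)
  have b0: "0 \<le> b" using ab by simp
  have "\<not> ess_bounded_below (- defect_op (b\<^sup>2) T)"
  proof (rule not_ess_bounded_below_at_top[OF symm])
    fix e :: real assume "e > 0"
    then obtain d where d: "d > 0" "d \<le> 1" "d * (2 * b + 1) \<le> e" using d_ex b0 by blast
    obtain B where B: "finite B" "\<And>x. x \<in> orth B \<Longrightarrow> norm (blinfun_apply T x) \<le> (b + d) * norm x"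
      using ab(3)[OF d(1)] by blast
    show "\<exists>B. finite B \<and> (\<forall>x\<in>orth B. Re (cinner (blinfun_apply (- defect_op (b\<^sup>2) T) x) x) \<le> e * (norm x)\<^sup>2)"
      using up[OF norm_ge_zero B(2) d(3,1,2) b0 norm_ge_zero] B(1)
      by (intro exI[of _ B]) (simp add: blinfun.minus_left cinner.minus_left Re_cinner_defect_op[OF T])
  next
    fix e :: real and B :: "'a set" assume "e > 0" and B: "finite B"
    then obtain d where d: "d > 0" "d \<le> 1" "d * (2 * b + 1) \<le> e" using d_ex b0 by blast
    obtain x where x: "x \<in> orth B" "norm x = 1" "b - d \<le> norm (blinfun_apply T x)"
      using ab(5)[OF d(1) B] by blast
    then show "\<exists>x\<in>orth B. norm x = 1 \<and> - e \<le> Re (cinner (blinfun_apply (- defect_op (b\<^sup>2) T) x) x)"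
      using lo[of b d 1 "norm (blinfun_apply T x)" e] d b0
      by (intro bexI[of _ x]) (simp_all add: blinfun.minus_left cinner.minus_left Re_cinner_defect_op[OF T])
  qed
  then have "complex_of_real (b\<^sup>2) \<in> {complex_of_real \<alpha>}"
    using real_mem_essential_spectrum[OF T] spec by (simp only: ess_bounded_below_uminus)
  then have b: "b\<^sup>2 = \<alpha>" by (simp only: singleton_iff of_real_eq_iff)
  have "\<not> ess_bounded_below (defect_op (a\<^sup>2) T)"
  proof (rule not_ess_bounded_below_at_top[OF symmetric_defect_op[OF T]])
    fix e :: real assume "e > 0"
    then obtain d where d: "d > 0" "d \<le> 1" "d * (2 * a + 1) \<le> e" using d_ex ab(1) by blast
    obtain B where B: "finite B" "\<And>x. x \<in> orth B \<Longrightarrow> (a - d) * norm x \<le> norm (blinfun_apply T x)"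
      using ab(3)[OF d(1)] by blast
    show "\<exists>B. finite B \<and> (\<forall>x\<in>orth B. Re (cinner (blinfun_apply (defect_op (a\<^sup>2) T) x) x) \<le> e * (norm x)\<^sup>2)"
      using lo[OF B(2) d(3,1) ab(1) norm_ge_zero] B(1)
      by (intro exI[of _ B]) (simp add: Re_cinner_defect_op[OF T])
  next
    fix e :: real and B :: "'a set" assume "e > 0" and B: "finite B"
    then obtain d where d: "d > 0" "d \<le> 1" "d * (2 * a + 1) \<le> e" using d_ex ab(1) by blast
    obtain x where x: "x \<in> orth B" "norm x = 1" "norm (blinfun_apply T x) \<le> a + d"
      using ab(4)[OF d(1) B] by blast
    then show "\<exists>x\<in>orth B. norm x = 1 \<and> - e \<le> Re (cinner (blinfun_apply (defect_op (a\<^sup>2) T) x) x)"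
      using up[of "norm (blinfun_apply T x)" a d 1 e] d ab(1)
      by (intro bexI[of _ x]) (simp_all add: Re_cinner_defect_op[OF T])
  qed
  then have "complex_of_real (a\<^sup>2) \<in> {complex_of_real \<alpha>}"
    using real_mem_essential_spectrum[OF T] spec by (simp only:)
  then have a: "a\<^sup>2 = \<alpha>" by (simp only: singleton_iff of_real_eq_iff)
  have "b = a" using a b ab(1) b0 power2_eq_iff_nonneg by metis
  then have "ess_isometric a T" using ab(3) by (intro ess_isometric_if_equal_bounds) simp
  moreover have "a = sqrt \<alpha>" using a ab(1) real_sqrt_unique by metis
  ultimately show ?thesis by simp
qed

lemma ess_small_not_ess_bounded_below:
  fixes K :: "'a :: complex_hilbert \<Rightarrow>\<^sub>L 'a"
  assumes inf: "\<not> cfinite_dim (UNIV :: 'a set)" and K: "ess_small K"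
  shows "\<not> ess_bounded_below K"
proof
  assume "ess_bounded_below K"
  then obtain c A where A: "c > 0" "finite A"
    "\<And>x. x \<in> orth A \<Longrightarrow> c * norm x \<le> norm (blinfun_apply K x)"
    unfolding ess_bounded_below_def by blast
  obtain B where B: "finite B" "\<And>x. x \<in> orth B \<Longrightarrow> norm (blinfun_apply K x) \<le> (c / 2) * norm x"
    using ess_smallD[OF K, of "c / 2"] A(1) by auto
  obtain x where "x \<in> orth (A \<union> B)" "norm x = 1"
    using unit_vector_orth_finite[OF inf, of "A \<union> B"] A(2) B(1) by auto
  then show False using A(1) A(3)[of x] B(2)[of x] by (simp add: orth_Un)
qed

text \<open>For \<open>\<mu> \<noteq> \<alpha>\<close> the operator \<open>T\<^sup>* T - \<mu>\<close> is a nonzero multiple of the identity up to a small error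
  off finitely many vectors, and so is its adjoint \<open>T\<^sup>* T - \<mu>\<close> with \<open>\<mu>\<close> conjugated; for \<open>\<mu> = \<alpha>\<close> it is
  compact, which in infinite dimensions excludes being bounded below.\<close>
lemma defect_small_imp_singleton_essential_spectrum:
  fixes T :: "'a :: complex_hilbert \<Rightarrow>\<^sub>L 'a"
  assumes inf: "\<not> cfinite_dim (UNIV :: 'a set)" and T: "T \<in> bounded_ops"
    and small: "ess_small (defect_op \<alpha> T)"
  shows "essential_spectrum (adjoint_op T o\<^sub>L T) = {complex_of_real \<alpha>}"
proof -
  have bb: "ess_bounded_below ((adjoint_op T o\<^sub>L T) - \<mu> *\<^sub>C id_blinfun)" if \<mu>: "\<mu> \<noteq> complex_of_real \<alpha>" for \<mu>
  proof -
    define c where "c = cmod (complex_of_real \<alpha> - \<mu>)"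
    have c: "c > 0" using \<mu> by (simp add: c_def)
    obtain B where B: "finite B" "\<And>x. x \<in> orth B \<Longrightarrow> norm (blinfun_apply (defect_op \<alpha> T) x) \<le> (c / 2) * norm x"
      using ess_smallD[OF small, of "c / 2"] c by auto
    have "c / 2 * norm x \<le> norm (blinfun_apply ((adjoint_op T o\<^sub>L T) - \<mu> *\<^sub>C id_blinfun) x)"
      if x: "x \<in> orth B" for x
    proof -
      have "blinfun_apply ((adjoint_op T o\<^sub>L T) - \<mu> *\<^sub>C id_blinfun) x
          = (complex_of_real \<alpha> - \<mu>) *\<^sub>C x - blinfun_apply (defect_op \<alpha> T) x"
        by (simp add: blinfun_apply_defect_op blinfun.bilinear_simps scaleC_blinfun.rep_eq
            complex_vector.scale_left_diff_distrib scaleR_scaleC)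
      moreover have "norm ((complex_of_real \<alpha> - \<mu>) *\<^sub>C x) = c * norm x" by (simp add: norm_scaleC c_def)
      ultimately show ?thesis
        using norm_triangle_ineq2[of "(complex_of_real \<alpha> - \<mu>) *\<^sub>C x" "blinfun_apply (defect_op \<alpha> T) x"] B(2)[OF x]
        by simp
    qed
    then show ?thesis unfolding ess_bounded_below_def using B(1) c by (intro exI[of _ "c / 2"]) auto
  qed
  have "\<mu> \<notin> essential_spectrum (adjoint_op T o\<^sub>L T)" if \<mu>: "\<mu> \<noteq> complex_of_real \<alpha>" for \<mu>
  proof -
    have "cnj \<mu> \<noteq> complex_of_real \<alpha>" using \<mu> by (metis complex_cnj_cnj complex_cnj_complex_of_real)
    then have "cfinite_dim (null_space (adjoint_op ((adjoint_op T o\<^sub>L T) - \<mu> *\<^sub>C id_blinfun)))"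
      unfolding shifted_op(2)[OF T] by (intro ess_bounded_below_imp_closed_range shifted_op(1) T bb)
    then show ?thesis
      using bb[OF \<mu>] fredholm_iff[OF shifted_op(1)[OF T]] by (simp add: essential_spectrum_def)
  qed
  moreover have "complex_of_real \<alpha> \<in> essential_spectrum (adjoint_op T o\<^sub>L T)"
    by (intro real_mem_essential_spectrum T ess_small_not_ess_bounded_below inf small)
  ultimately show ?thesis by blast
qed


section \<open>The Moore--Penrose inverse\<close>

text \<open>The characteristic property behind the definite description \<^const>\<open>mp_inverse\<close>.\<close>
definition is_mp_inverse :: "('a :: complex_hilbert \<Rightarrow>\<^sub>L 'a) \<Rightarrow> ('a \<Rightarrow>\<^sub>L 'a) \<Rightarrow> bool" where
  "is_mp_inverse T S \<longleftrightarrow> S \<in> bounded_ops \<and>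
     selfadjoint_op (T o\<^sub>L S) \<and> selfadjoint_op (S o\<^sub>L T) \<and>
     T o\<^sub>L S o\<^sub>L T = T \<and> S o\<^sub>L T o\<^sub>L S = S"

text \<open>The inverse sends \<open>y\<close> to the unique \<open>x \<bottom> N(T)\<close> for which \<open>T x\<close> is the projection of \<open>y\<close> to the
  range; it is bounded because \<open>T\<close> is bounded below on \<open>N(T)\<^sup>\<bottom>\<close>.\<close>
lemma mp_inverse_exists:
  fixes T :: "'a :: complex_hilbert \<Rightarrow>\<^sub>L 'a"
  assumes T: "T \<in> bounded_ops" and closed: "closed (range (blinfun_apply T))"
  shows "\<exists>S. is_mp_inverse T S"
proof -
  let ?N = "null_space T"
  obtain c where c: "c > 0" "\<And>x. x \<in> orth ?N \<Longrightarrow> c * norm x \<le> norm (blinfun_apply T x)"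
    using closed_range_imp_bounded_below[OF T closed] by blast
  obtain P where P: "P \<in> bounded_ops" "symmetric_op P" "\<And>x. blinfun_apply P x \<in> range (blinfun_apply T)"
    "\<And>x. norm (blinfun_apply P x) \<le> norm x" "\<And>x. x \<in> range (blinfun_apply T) \<Longrightarrow> blinfun_apply P x = x"
    using projection_op_exists[OF csubspace_range[OF T] closed] by metis
  obtain N where N: "symmetric_op N" "\<And>x. blinfun_apply N x \<in> ?N" "\<And>x. x - blinfun_apply N x \<in> orth ?N"
    using projection_op_exists[OF csubspace_null_space[OF T] closed_null_space] by metis
  have TN: "blinfun_apply T (x - blinfun_apply N x) = blinfun_apply T x" for x
    using N(2)[of x] by (simp add: null_space_def blinfun.diff_right)
  have "\<exists>x. x \<in> orth ?N \<and> blinfun_apply T x = blinfun_apply P y" for y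
  proof -
    obtain x where "blinfun_apply P y = blinfun_apply T x" using P(3) by blast
    then show ?thesis using N(3)[of x] TN[of x] by (intro exI[of _ "x - blinfun_apply N x"]) simp
  qed
  then obtain s where s: "\<And>y. s y \<in> orth ?N" "\<And>y. blinfun_apply T (s y) = blinfun_apply P y" by metis
  have uniq: "s y = x" if "x \<in> orth ?N" "blinfun_apply T x = blinfun_apply P y" for x y
  proof -
    have "s y - x \<in> orth ?N" using s(1) that(1) complex_vector.subspace_diff[OF csubspace_orth] by blast
    moreover have "s y - x \<in> ?N" using s(2) that(2) by (simp add: null_space_def blinfun.diff_right)
    ultimately show ?thesis using orth_disjoint[of "s y - x" ?N] by simp
  qed
  have add: "s (x + y) = s x + s y" for x y
    by (rule uniq) (simp_all add: s blinfun.add_right complex_vector.subspace_add[OF csubspace_orth])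
  have scale: "s (a *\<^sub>C x) = a *\<^sub>C s x" for a x
    by (rule uniq) (simp_all add: s bounded_opsD[OF T] bounded_opsD[OF P(1)]
        complex_vector.subspace_scale[OF csubspace_orth])
  have "bounded_linear s"
  proof (rule bounded_linear_intro[where K = "1 / c"])
    show "norm (s y) \<le> norm y * (1 / c)" for y
      using c(2)[OF s(1)[of y]] P(4)[of y] c(1) by (simp add: s(2) field_simps)
  qed (simp_all add: add scale scaleR_scaleC)
  then have app: "blinfun_apply (Blinfun s) = s" by (rule bounded_linear_Blinfun_apply)
  define S where "S = Blinfun s"
  have S: "S \<in> bounded_ops" by (simp add: S_def bounded_ops_def app scale)
  have TS: "blinfun_apply T (blinfun_apply S y) = blinfun_apply P y" for y by (simp add: S_def app s(2))
  have ST: "blinfun_apply S (blinfun_apply T x) = x - blinfun_apply N x" for x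
    unfolding S_def app by (rule uniq) (simp_all add: N(3) TN P(5))
  have "selfadjoint_op (T o\<^sub>L S)"
    unfolding selfadjoint_op_iff[OF bounded_ops_compose[OF T S]]
    by (simp add: TS symmetric_opD[OF P(2)])
  moreover have "selfadjoint_op (S o\<^sub>L T)"
    unfolding selfadjoint_op_iff[OF bounded_ops_compose[OF S T]]
    by (simp add: ST symmetric_opD[OF N(1)] cinner_simps)
  moreover have "T o\<^sub>L S o\<^sub>L T = T" by (rule blinfun_eqI) (simp add: TS P(5))
  moreover have "S o\<^sub>L T o\<^sub>L S = S"
  proof (rule blinfun_eqI)
    fix y
    show "blinfun_apply (S o\<^sub>L T o\<^sub>L S) y = blinfun_apply S y"
      using uniq[of "s y" "blinfun_apply P y"] s P(3,5) by (simp add: TS) (simp add: S_def app)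
  qed
  ultimately show ?thesis using S by (auto simp: is_mp_inverse_def)
qed

text \<open>Both \<open>T S\<close> and \<open>T S'\<close> are orthogonal projections with the same range, and similarly
  \<open>S T\<close> and \<open>S' T\<close>; algebraically, \<open>T S = (T S')(T S)\<close> has adjoint \<open>(T S)(T S') = T S'\<close>.\<close>
lemma mp_inverse_unique:
  fixes T :: "'a :: complex_hilbert \<Rightarrow>\<^sub>L 'a"
  assumes T: "T \<in> bounded_ops" and S: "is_mp_inverse T S" and S': "is_mp_inverse T S'"
  shows "S = S'"
proof -
  have b: "S \<in> bounded_ops" "S' \<in> bounded_ops" using S S' by (auto simp: is_mp_inverse_def)
  have pt: "blinfun_apply T (blinfun_apply R (blinfun_apply T x)) = blinfun_apply T x \<and>
      blinfun_apply R (blinfun_apply T (blinfun_apply R x)) = blinfun_apply R x"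
    if "is_mp_inverse T R" for R x
  proof -
    have "blinfun_apply (T o\<^sub>L R o\<^sub>L T) x = blinfun_apply T x" "blinfun_apply (R o\<^sub>L T o\<^sub>L R) x = blinfun_apply R x"
      using that by (simp_all only: is_mp_inverse_def)
    then show ?thesis by simp
  qed
  have sTS: "cinner (blinfun_apply T (blinfun_apply R x)) y = cinner x (blinfun_apply T (blinfun_apply R y))"
    "cinner (blinfun_apply R (blinfun_apply T x)) y = cinner x (blinfun_apply R (blinfun_apply T y))"
    if "is_mp_inverse T R" for R x y
    using that selfadjoint_op_iff[OF bounded_ops_compose[OF T, of R]]
      selfadjoint_op_iff[OF bounded_ops_compose[OF _ T, of R]] by (auto simp: is_mp_inverse_def)
  have TS: "blinfun_apply T (blinfun_apply S x) = blinfun_apply T (blinfun_apply S' x)" for x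
  proof (rule cinner_ext)
    fix y
    have "cinner (blinfun_apply T (blinfun_apply S x)) y
        = cinner (blinfun_apply T (blinfun_apply S' (blinfun_apply T (blinfun_apply S x)))) y"
      by (simp add: pt[OF S'])
    also have "\<dots> = cinner x (blinfun_apply T (blinfun_apply S (blinfun_apply T (blinfun_apply S' y))))"
      by (simp only: sTS(1)[OF S] sTS(1)[OF S'])
    also have "\<dots> = cinner (blinfun_apply T (blinfun_apply S' x)) y"
      by (simp only: pt[OF S] sTS(1)[OF S'])
    finally show "cinner (blinfun_apply T (blinfun_apply S x)) y = cinner (blinfun_apply T (blinfun_apply S' x)) y" .
  qed
  have ST: "blinfun_apply S (blinfun_apply T x) = blinfun_apply S' (blinfun_apply T x)" for x
  proof (rule cinner_ext)
    fix y
    have "cinner (blinfun_apply S (blinfun_apply T x)) y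
        = cinner (blinfun_apply S (blinfun_apply T (blinfun_apply S' (blinfun_apply T x)))) y"
      by (simp add: pt[OF S'])
    also have "\<dots> = cinner x (blinfun_apply S' (blinfun_apply T (blinfun_apply S (blinfun_apply T y))))"
      by (simp only: sTS(2)[OF S] sTS(2)[OF S'])
    also have "\<dots> = cinner (blinfun_apply S' (blinfun_apply T x)) y"
      by (simp only: pt[OF S] sTS(2)[OF S'])
    finally show "cinner (blinfun_apply S (blinfun_apply T x)) y = cinner (blinfun_apply S' (blinfun_apply T x)) y" .
  qed
  show ?thesis
  proof (rule blinfun_eqI)
    fix x
    have "blinfun_apply S x = blinfun_apply S (blinfun_apply T (blinfun_apply S x))"
      by (simp only: pt[OF S])
    also have "\<dots> = blinfun_apply S' (blinfun_apply T (blinfun_apply S' x))" by (simp only: ST TS)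
    also have "\<dots> = blinfun_apply S' x" by (simp only: pt[OF S'])
    finally show "blinfun_apply S x = blinfun_apply S' x" .
  qed
qed

lemma
  fixes T :: "'a :: complex_hilbert \<Rightarrow>\<^sub>L 'a"
  assumes T: "T \<in> bounded_ops" and closed: "closed (range (blinfun_apply T))"
  shows mp_inverse_bounded_op: "mp_inverse T \<in> bounded_ops"
    and mp_inverse_left: "x \<in> orth (null_space T) \<Longrightarrow> blinfun_apply (mp_inverse T) (blinfun_apply T x) = x"
    and adjoint_mp_inverse:
      "blinfun_apply (adjoint_op T) (blinfun_apply T (blinfun_apply (mp_inverse T) y)) = blinfun_apply (adjoint_op T) y"
proof -
  let ?S = "mp_inverse T"
  have "is_mp_inverse T ?S"
  proof -
    obtain S where S: "is_mp_inverse T S" using mp_inverse_exists[OF T closed] by blast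
    then have "mp_inverse T = S"
      unfolding mp_inverse_def is_mp_inverse_def[symmetric]
      by (intro the_equality) (auto intro: mp_inverse_unique[OF T])
    then show ?thesis using S by simp
  qed
  then have S: "?S \<in> bounded_ops" "selfadjoint_op (T o\<^sub>L ?S)" "selfadjoint_op (?S o\<^sub>L T)" and
    eq: "T o\<^sub>L ?S o\<^sub>L T = T"
    by (simp_all only: is_mp_inverse_def)
  show "?S \<in> bounded_ops" by (rule S(1))
  have TST: "blinfun_apply T (blinfun_apply ?S (blinfun_apply T x)) = blinfun_apply T x" for x
    using arg_cong[OF eq, of "\<lambda>U. blinfun_apply U x"] by simp
  have sym: "cinner (blinfun_apply T (blinfun_apply ?S x)) y = cinner x (blinfun_apply T (blinfun_apply ?S y))"
    "cinner (blinfun_apply ?S (blinfun_apply T x)) y = cinner x (blinfun_apply ?S (blinfun_apply T y))" for x y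
    using S(2,3) selfadjoint_op_iff[OF bounded_ops_compose[OF T S(1)]]
      selfadjoint_op_iff[OF bounded_ops_compose[OF S(1) T]] by auto
  show "blinfun_apply ?S (blinfun_apply T x) = x" if x: "x \<in> orth (null_space T)"
  proof -
    have "blinfun_apply ?S (blinfun_apply T x) \<in> orth (null_space T)"
      by (simp add: orth_def sym(2)) (simp add: null_space_def blinfun.zero_right)
    then have "x - blinfun_apply ?S (blinfun_apply T x) \<in> orth (null_space T)"
      using x complex_vector.subspace_diff[OF csubspace_orth] by blast
    moreover have "x - blinfun_apply ?S (blinfun_apply T x) \<in> null_space T"
      by (simp add: null_space_def blinfun.diff_right TST)
    ultimately show ?thesis using orth_disjoint by fastforce
  qed
  show "blinfun_apply (adjoint_op T) (blinfun_apply T (blinfun_apply ?S y)) = blinfun_apply (adjoint_op T) y"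
    by (rule cinner_ext) (simp add: cinner_adjoint'[OF T] sym(1) TST)
qed

text \<open>Since \<open>T\<^sup>* = T\<^sup>* T T\<^sup>\<dagger>\<close>, one has \<open>\<alpha> T\<^sup>\<dagger> - T\<^sup>* = (\<alpha> I - T\<^sup>* T) T\<^sup>\<dagger>\<close>.\<close>
lemma defect_small_imp_mp_inverse_compact:
  fixes T :: "'a :: complex_hilbert \<Rightarrow>\<^sub>L 'a"
  assumes T: "T \<in> bounded_ops" and closed: "closed (range (blinfun_apply T))"
    and small: "ess_small (defect_op \<alpha> T)"
  shows "\<alpha> *\<^sub>R mp_inverse T - adjoint_op T \<in> compact_ops"
proof -
  have "\<alpha> *\<^sub>R mp_inverse T - adjoint_op T = defect_op \<alpha> T o\<^sub>L mp_inverse T"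
    by (rule blinfun_eqI)
      (simp add: blinfun.bilinear_simps blinfun_apply_defect_op adjoint_mp_inverse[OF T closed])
  then show ?thesis
    by (simp add: compact_ops_iff bounded_ops_compose defect_bounded_op T ess_small_compose_right
        mp_inverse_bounded_op closed small)
qed

text \<open>Composing with \<open>T\<close> on the right undoes the previous factorisation off the null space, as
  \<open>T\<^sup>\<dagger> T\<close> is the identity on \<open>N(T)\<^sup>\<bottom>\<close>.\<close>
lemma mp_inverse_compact_imp_defect_small:
  fixes T :: "'a :: complex_hilbert \<Rightarrow>\<^sub>L 'a"
  assumes T: "T \<in> bounded_ops" and closed: "closed (range (blinfun_apply T))"
    and fin: "cfinite_dim (null_space T)"
    and comp: "\<alpha> *\<^sub>R mp_inverse T - adjoint_op T \<in> compact_ops"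
  shows "ess_small (defect_op \<alpha> T)"
proof -
  let ?C = "(\<alpha> *\<^sub>R mp_inverse T - adjoint_op T) o\<^sub>L T"
  obtain F where F: "finite F" "cspan F = null_space T" using fin by (auto simp: cfinite_dim_def)
  have "blinfun_apply (defect_op \<alpha> T - ?C) x = 0" if "x \<in> orth F" for x
  proof -
    have "x \<in> orth (null_space T)" using that by (simp only: orth_cspan flip: F(2))
    then show ?thesis
      by (simp add: blinfun.bilinear_simps blinfun_apply_defect_op mp_inverse_left[OF T closed])
  qed
  then have "ess_small (defect_op \<alpha> T - ?C)" by (rule ess_small_if_zero_on_orth[OF F(1)])
  then have "ess_small (defect_op \<alpha> T - ?C + ?C)"
    using comp by (intro ess_small_add ess_small_compose_right T) (simp_all add: compact_ops_iff)
  then show ?thesis by simp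
qed

lemma ess_isometric_imp_ess_bounded_below:
  fixes T :: "'a :: complex_hilbert \<Rightarrow>\<^sub>L 'a"
  assumes "s > 0" "ess_isometric s T"
  shows "ess_bounded_below T"
proof -
  obtain B where B: "finite B" "\<forall>x\<in>orth B. \<bar>norm (blinfun_apply T x) - s * norm x\<bar> \<le> s / 2 * norm x"
    using assms unfolding ess_isometric_def by (meson half_gt_zero)
  have "s / 2 * norm x \<le> norm (blinfun_apply T x)" if "x \<in> orth B" for x
    using abs_le_D2[OF bspec[OF B(2) that]] by (simp add: field_simps)
  then show ?thesis using B(1) assms(1) unfolding ess_bounded_below_def
    by (intro exI[of _ "s / 2"]) auto
qed

section \<open>The equivalences\<close>

theorem theorem2p14:
  fixes T :: "'a :: complex_hilbert \<Rightarrow>\<^sub>L 'a"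
  assumes infinite_dim: "\<not> cfinite_dim (UNIV :: 'a set)"
    and separable: "separable_space (euclidean :: 'a topology)"
    and T: "T \<in> bounded_ops - compact_ops"
  shows
    "(T \<in> closure AN_ops \<longleftrightarrow>
       (\<exists>\<alpha>>0. essential_spectrum (adjoint_op T o\<^sub>L T) = {complex_of_real \<alpha>})) \<and>
     (T \<in> closure AN_ops \<longleftrightarrow>
       (\<exists>\<alpha>>0. \<exists>K\<in>compact_ops. \<exists>V\<in>bounded_ops.
          partial_isometry V \<and> cfinite_dim (null_space V) \<and> T = K + sqrt \<alpha> *\<^sub>R V)) \<and>
     (T \<in> closure AN_ops \<longleftrightarrow>
       (\<exists>\<alpha>>0. \<alpha> *\<^sub>R id_blinfun - (adjoint_op T o\<^sub>L T) \<in> compact_ops)) \<and>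
     (T \<in> closure AN_ops \<longleftrightarrow>
       closed (range (blinfun_apply T)) \<and> cfinite_dim (null_space T) \<and>
       (\<exists>\<alpha>>0. \<alpha> *\<^sub>R mp_inverse T - adjoint_op T \<in> compact_ops))"
proof -
  have T: "T \<in> bounded_ops" and not_small: "\<not> ess_small T"
    using assms(3) by (auto simp: compact_ops_iff)
  let ?hub = "\<exists>\<alpha>>0. ess_isometric (sqrt \<alpha>) T"
  have defect: "ess_small (defect_op \<alpha> T) \<longleftrightarrow> ess_isometric (sqrt \<alpha>) T" if "\<alpha> > 0" for \<alpha>
    using defect_small_iff[OF T, of "sqrt \<alpha>"] that by simp
  have 1: "T \<in> closure AN_ops \<longleftrightarrow> ?hub"
  proof
    assume "T \<in> closure AN_ops"
    then obtain s where s: "s \<ge> 0" "ess_isometric s T"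
      using closure_AN_imp_ess_isometric[OF infinite_dim] by blast
    have "s \<noteq> 0"
    proof
      assume "s = 0"
      then have "ess_small T" using s(2) by (simp add: ess_isometric_def ess_small_def)
      then show False using not_small by contradiction
    qed
    then show ?hub using s by (intro exI[of _ "s\<^sup>2"]) auto
  qed (use ess_isometric_imp_closure_AN[OF T] real_sqrt_gt_zero in blast)
  have 2: "?hub \<longleftrightarrow> (\<exists>\<alpha>>0. essential_spectrum (adjoint_op T o\<^sub>L T) = {complex_of_real \<alpha>})"
    using singleton_essential_spectrum_imp_ess_isometric[OF infinite_dim T]
      defect_small_imp_singleton_essential_spectrum[OF infinite_dim T] defect by blast
  have 3: "?hub \<longleftrightarrow> (\<exists>\<alpha>>0. \<exists>K\<in>compact_ops. \<exists>V\<in>bounded_ops.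
      partial_isometry V \<and> cfinite_dim (null_space V) \<and> T = K + sqrt \<alpha> *\<^sub>R V)"
  proof
    assume ?hub
    then show "\<exists>\<alpha>>0. \<exists>K\<in>compact_ops. \<exists>V\<in>bounded_ops.
        partial_isometry V \<and> cfinite_dim (null_space V) \<and> T = K + sqrt \<alpha> *\<^sub>R V"
      using ess_isometric_imp_partial_isometry_plus_compact[OF T] real_sqrt_gt_zero by blast
  next
    assume "\<exists>\<alpha>>0. \<exists>K\<in>compact_ops. \<exists>V\<in>bounded_ops.
        partial_isometry V \<and> cfinite_dim (null_space V) \<and> T = K + sqrt \<alpha> *\<^sub>R V"
    then obtain \<alpha> K V where *: "\<alpha> > 0" "K \<in> compact_ops" "partial_isometry V" "cfinite_dim (null_space V)"
      and eq: "T = K + sqrt \<alpha> *\<^sub>R V" by blast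
    have "ess_isometric (sqrt \<alpha>) T"
      unfolding eq using * by (intro partial_isometry_plus_compact_imp_ess_isometric) auto
    then show ?hub using *(1) by blast
  qed
  have 4: "?hub \<longleftrightarrow> (\<exists>\<alpha>>0. \<alpha> *\<^sub>R id_blinfun - (adjoint_op T o\<^sub>L T) \<in> compact_ops)"
    using defect defect_bounded_op[OF T] unfolding compact_ops_iff defect_op_def by blast
  have 5: "?hub \<longleftrightarrow> closed (range (blinfun_apply T)) \<and> cfinite_dim (null_space T) \<and>
      (\<exists>\<alpha>>0. \<alpha> *\<^sub>R mp_inverse T - adjoint_op T \<in> compact_ops)"
  proof
    assume ?hub
    then obtain \<alpha> where \<alpha>: "\<alpha> > 0" "ess_isometric (sqrt \<alpha>) T" by blast
    then have "ess_bounded_below T" by (intro ess_isometric_imp_ess_bounded_below[of "sqrt \<alpha>"]) auto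
    note cl = ess_bounded_below_imp_closed_range[OF T this]
    then show "closed (range (blinfun_apply T)) \<and> cfinite_dim (null_space T) \<and>
        (\<exists>\<alpha>>0. \<alpha> *\<^sub>R mp_inverse T - adjoint_op T \<in> compact_ops)"
      using defect_small_imp_mp_inverse_compact[OF T cl(1)] defect \<alpha> by blast
  next
    assume "closed (range (blinfun_apply T)) \<and> cfinite_dim (null_space T) \<and>
        (\<exists>\<alpha>>0. \<alpha> *\<^sub>R mp_inverse T - adjoint_op T \<in> compact_ops)"
    then show ?hub using mp_inverse_compact_imp_defect_small[OF T] defect by blast
  qed
  show ?thesis using 1 2 3 4 5 by (simp only:)
qed

end
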